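(* Let $\Sigma$ be a detector surface, $\varepsilon>0$, and let $(f,\alpha_1,\rho_1)$ be as in the context, i.e. $\Sigma$ encloses the compact support of $f$ and $\operatorname{supp}\alpha_1\cup\operatorname{supp}\rho_1\subsetneq\operatorname{int}(\operatorname{supp}f)$. For $\alpha_1$ sufficiently small in the $C^2$-norm (i.e. there is $\delta>0$ depending only on $\Sigma$ and $\varepsilon$ such that the following holds whenever $\|\alpha_1\|_{C^2(\mathbb{R}^3)}<\delta$), one has for all $x\in\Sigma$ and $y\in\mathbb{R}^3\setminus\{x\}$ $$f(y)=\Big(8\pi|y-x|\,N_{0,x}(y)-4\pi N_{\infty,x}(y)\Big)\left(1-\varepsilon\alpha_1(y)+\frac12\int_{L_{x,y}}\left(1-\frac{|z-x|}{|y-x|}\right)|z-x|\,\varepsilon\Delta\alpha_1(z)\,\mathrm{d}s(z)\right)^{-1},$$ and, for all $x\in\Sigma$ and all $y$ with $f(y)\ne0$, $$\varepsilon\rho_1(y)=1-\varepsilon\alpha_1(y)-\frac{4\pi N_{\infty,x}(y)}{f(y)}.$$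
   Context: Setting: $\Sigma=\partial D$ for a bounded open set $D\subset\mathbb{R}^3$ (the detector surface); $f:\mathbb{R}^3\to[0,\infty)$ is a continuous function with compact support $\operatorname{supp}f\subset D$ ($\Sigma$ encloses $\operatorname{supp}f$); $\alpha_1\in C^2_{\mathrm c}(\mathbb{R}^3)$ and $\rho_1\in C^1_{\mathrm c}(\mathbb{R}^3)$ are real-valued; $\varepsilon>0$ is fixed. $L_{x,y}$ denotes the straight line segment between $x$ and $y$, with arc length measure $\mathrm{d}s$. With $\mathscr E_t(x,y)=\{z\in\mathbb{R}^3\mid|z-x|+|z-y|\le t\}$, the kernel is, for $t\ge|y-x|$, $x\ne y$, $$\begin{aligned}K(t,x,y;\varepsilon)&=\frac{(t-|y-x|)^2}{8\pi|y-x|}\,(1-\varepsilon\alpha_1(y))+\int_{\mathscr E_t(x,y)}\frac{1}{16\pi^2|z-x||z-y|}\,\varepsilon\alpha_1(z)\,\mathrm{d}z\\&\quad+\int_{\mathscr E_t(x,y)}\frac{t-|z-x|-|z-y|}{16\pi^2|z-x||z-y|}\,\varepsilon\nabla\rho_1(z)\cdot\frac{z-y}{|z-y|}\,\mathrm{d}z\\&\quad+\int_{\mathscr E_t(x,y)}\frac{(t-|z-x|-|z-y|)^2}{32\pi^2|z-x||z-y|^2}\,\varepsilon\nabla\rho_1(z)\cdot\frac{z-y}{|z-y|}\,\mathrm{d}z,\end{aligned}$$ and $K(t,x,y;\varepsilon)=0$ for $t<|y-x|$. The measurements are $M_{r,\theta}(t,x)=\int_{B_t(x)\cap E_{r,\theta}}K(t,x,y;\varepsilon)f(y)\,\mathrm{d}s(y)=\mathcal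 R_3[K(t,x,\cdot\,;\varepsilon)f](r,\theta)$ for $x\in\Sigma$, $t>0$, $r\ge0$, $\theta\in\mathbf{S}^2$, where $E_{r,\theta}=\{y\in\mathbb{R}^3\mid y\cdot\theta=r\}$ and $\mathcal R_3$ is the three-dimensional Radon transform (integration over planes). Hence $\mathcal R_3^{-1}[M_{r,\theta}(t,x)](y)=K(t,x,y;\varepsilon)f(y)$. The data are, for $x\in\Sigma$ and $y\in\mathbb{R}^3\setminus\{x\}$, $$N_{0,x}(y)=\lim_{t\downarrow|y-x|}\partial_{tt}\mathcal R_3^{-1}[M_{r,\theta}(t,x)](y),\qquad M_{\infty,x}(y)=\lim_{t\to\infty}\partial_{tt}\mathcal R_3^{-1}[M_{r,\theta}(t,x)](y),$$ $$N_{\infty,x}(y)=\lim_{t\to\infty}\Big(M_{\infty,x}(y)\,t-\partial_t\mathcal R_3^{-1}[M_{r,\theta}(t,x)](y)\Big).$$ *)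

theory Defs
  imports "HOL-Analysis.Analysis"
begin

subsection \<open>Function classes on three-dimensional space\<close>

definition supp :: "(real^3 \<Rightarrow> real) \<Rightarrow> (real^3) set" where
  "supp g = closure {z. g z \<noteq> 0}"

definition Cc :: "(real^3 \<Rightarrow> real) set" where
  "Cc = {g. continuous_on UNIV g \<and> compact (supp g)}"

definition partial :: "3 \<Rightarrow> (real^3 \<Rightarrow> real) \<Rightarrow> real^3 \<Rightarrow> real" where
  "partial i g z = frechet_derivative g (at z) (axis i 1)"

definition grad :: "(real^3 \<Rightarrow> real) \<Rightarrow> real^3 \<Rightarrow> real^3" where
  "grad g z = (\<chi> i. partial i g z)"

definition laplacian :: "(real^3 \<Rightarrow> real) \<Rightarrow> real^3 \<Rightarrow> real" where
  "laplacian g z = (\<Sum>i\<in>UNIV. partial i (partial i g) z)"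

definition C1 :: "(real^3 \<Rightarrow> real) set" where
  "C1 = {g. (\<forall>z. g differentiable at z) \<and> (\<forall>i. continuous_on UNIV (partial i g))}"

definition C2 :: "(real^3 \<Rightarrow> real) set" where
  "C2 = {g \<in> C1. \<forall>i. partial i g \<in> C1}"

text \<open>The suprema are finite for compactly supported functions of class \<open>C2\<close>, the only ones
  to which the norm is applied.\<close>

definition C2_norm :: "(real^3 \<Rightarrow> real) \<Rightarrow> real" where
  "C2_norm g = (SUP z. \<bar>g z\<bar>) + (\<Sum>i\<in>UNIV. SUP z. \<bar>partial i g z\<bar>)
     + (\<Sum>i\<in>UNIV. \<Sum>j\<in>UNIV. SUP z. \<bar>partial i (partial j g) z\<bar>)"


subsection \<open>The kernel\<close>

definition ellipsoid :: "real \<Rightarrow> real^3 \<Rightarrow> real^3 \<Rightarrow> (real^3) set" where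
  "ellipsoid t x y = {z. norm (z - x) + norm (z - y) \<le> t}"

text \<open>The kernel is only meaningful for \<open>x \<noteq> y\<close>. Its value at \<open>y = x\<close> is irrelevant below, where
  it is always multiplied by \<open>f x = 0\<close>: \<open>x\<close> lies on the detector surface, outside the support
  of \<open>f\<close>.\<close>

definition K ::
  "real \<Rightarrow> (real^3 \<Rightarrow> real) \<Rightarrow> (real^3 \<Rightarrow> real) \<Rightarrow> real \<Rightarrow> real^3 \<Rightarrow> real^3 \<Rightarrow> real" where
  "K \<epsilon> \<alpha> \<rho> t x y =
    (if t < norm (y - x) then 0 else
       (t - norm (y - x))\<^sup>2 / (8 * pi * norm (y - x)) * (1 - \<epsilon> * \<alpha> y)
     + (LINT z:ellipsoid t x y|lborel.
          1 / (16 * pi\<^sup>2 * norm (z - x) * norm (z - y)) * (\<epsilon> * \<alpha> z))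
     + (LINT z:ellipsoid t x y|lborel.
          (t - norm (z - x) - norm (z - y)) / (16 * pi\<^sup>2 * norm (z - x) * norm (z - y))
          * (\<epsilon> * (grad \<rho> z \<bullet> ((z - y) /\<^sub>R norm (z - y)))))
     + (LINT z:ellipsoid t x y|lborel.
          (t - norm (z - x) - norm (z - y))\<^sup>2 / (32 * pi\<^sup>2 * norm (z - x) * (norm (z - y))\<^sup>2)
          * (\<epsilon> * (grad \<rho> z \<bullet> ((z - y) /\<^sub>R norm (z - y))))))"


subsection \<open>Integration over planes and the Radon transform\<close>

text \<open>Surface measure on the plane \<open>{y. y \<bullet> \<theta> = r}\<close>, for a unit vector \<open>\<theta>\<close>, is the image of planar
  Lebesgue measure under \<open>(a, b) \<mapsto> r \<theta> + a u + b (\<theta> \<times> u)\<close>, where \<open>u\<close> is any unit vector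
  orthogonal to \<open>\<theta>\<close>; by rotation invariance the choice of \<open>u\<close> does not matter.\<close>

definition plane_frame :: "real^3 \<Rightarrow> real^3" where
  "plane_frame \<theta> = (SOME u. norm u = 1 \<and> u \<bullet> \<theta> = 0)"

definition plane_measure :: "real \<Rightarrow> real^3 \<Rightarrow> (real^3) measure" where
  "plane_measure r \<theta> = distr (lborel :: (real \<times> real) measure) borel
     (\<lambda>(a, b). r *\<^sub>R \<theta> + a *\<^sub>R plane_frame \<theta> + b *\<^sub>R cross3 \<theta> (plane_frame \<theta>))"

definition radon3 :: "(real^3 \<Rightarrow> real) \<Rightarrow> real \<Rightarrow> real^3 \<Rightarrow> real" where
  "radon3 g r \<theta> = (LINT y|plane_measure r \<theta>. g y)"

text \<open>The inverse of the Radon transform, taken as an operator on continuous compactly supported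
  functions, where it is injective. The functions reconstructed below are merely continuous, so
  a pointwise differential inversion formula would not be available.\<close>

definition radon3_inv :: "(real \<Rightarrow> real^3 \<Rightarrow> real) \<Rightarrow> real^3 \<Rightarrow> real" where
  "radon3_inv m = (THE g. g \<in> Cc \<and> (\<forall>r\<ge>0. \<forall>\<theta>\<in>sphere 0 1. radon3 g r \<theta> = m r \<theta>))"


subsection \<open>Measurements and data\<close>

definition M ::
  "real \<Rightarrow> (real^3 \<Rightarrow> real) \<Rightarrow> (real^3 \<Rightarrow> real) \<Rightarrow> (real^3 \<Rightarrow> real)
    \<Rightarrow> real \<Rightarrow> real^3 \<Rightarrow> real \<Rightarrow> real^3 \<Rightarrow> real" where
  "M \<epsilon> \<alpha> \<rho> f t x r \<theta> = (LINT y:ball x t|plane_measure r \<theta>. K \<epsilon> \<alpha> \<rho> t x y * f y)"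

definition recon ::
  "real \<Rightarrow> (real^3 \<Rightarrow> real) \<Rightarrow> (real^3 \<Rightarrow> real) \<Rightarrow> (real^3 \<Rightarrow> real)
    \<Rightarrow> real^3 \<Rightarrow> real^3 \<Rightarrow> real \<Rightarrow> real" where
  "recon \<epsilon> \<alpha> \<rho> f x y t = radon3_inv (M \<epsilon> \<alpha> \<rho> f t x) y"

definition N0 ::
  "real \<Rightarrow> (real^3 \<Rightarrow> real) \<Rightarrow> (real^3 \<Rightarrow> real) \<Rightarrow> (real^3 \<Rightarrow> real)
    \<Rightarrow> real^3 \<Rightarrow> real^3 \<Rightarrow> real" where
  "N0 \<epsilon> \<alpha> \<rho> f x y = Lim (at_right (norm (y - x))) (deriv (deriv (recon \<epsilon> \<alpha> \<rho> f x y)))"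

definition Minf ::
  "real \<Rightarrow> (real^3 \<Rightarrow> real) \<Rightarrow> (real^3 \<Rightarrow> real) \<Rightarrow> (real^3 \<Rightarrow> real)
    \<Rightarrow> real^3 \<Rightarrow> real^3 \<Rightarrow> real" where
  "Minf \<epsilon> \<alpha> \<rho> f x y = Lim at_top (deriv (deriv (recon \<epsilon> \<alpha> \<rho> f x y)))"

definition Ninf ::
  "real \<Rightarrow> (real^3 \<Rightarrow> real) \<Rightarrow> (real^3 \<Rightarrow> real) \<Rightarrow> (real^3 \<Rightarrow> real)
    \<Rightarrow> real^3 \<Rightarrow> real^3 \<Rightarrow> real" where
  "Ninf \<epsilon> \<alpha> \<rho> f x y =
     Lim at_top (\<lambda>t. Minf \<epsilon> \<alpha> \<rho> f x y * t - deriv (recon \<epsilon> \<alpha> \<rho> f x y) t)"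

text \<open>\<open>deriv\<close>, \<open>Lim\<close> and \<open>THE\<close> are total, so the existence of everything that enters the three
  data has to be said separately. The reconstruction is only required to be twice differentiable
  in time after the first arrival \<open>t = norm (y - x)\<close>.\<close>

definition data_exist ::
  "real \<Rightarrow> (real^3 \<Rightarrow> real) \<Rightarrow> (real^3 \<Rightarrow> real) \<Rightarrow> (real^3 \<Rightarrow> real)
    \<Rightarrow> real^3 \<Rightarrow> real^3 \<Rightarrow> bool" where
  "data_exist \<epsilon> \<alpha> \<rho> f x y \<longleftrightarrow>
     (\<forall>t>0. \<exists>!g. g \<in> Cc \<and>
        (\<forall>r\<ge>0. \<forall>\<theta>\<in>sphere 0 1. radon3 g r \<theta> = M \<epsilon> \<alpha> \<rho> f t x r \<theta>)) \<and>
     (\<forall>t>norm (y - x). recon \<epsilon> \<alpha> \<rho> f x y differentiable at t \<and>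
        deriv (recon \<epsilon> \<alpha> \<rho> f x y) differentiable at t) \<and>
     (\<exists>l. (deriv (deriv (recon \<epsilon> \<alpha> \<rho> f x y)) \<longlongrightarrow> l) (at_right (norm (y - x)))) \<and>
     (\<exists>l. (deriv (deriv (recon \<epsilon> \<alpha> \<rho> f x y)) \<longlongrightarrow> l) at_top) \<and>
     (\<exists>l. ((\<lambda>t. Minf \<epsilon> \<alpha> \<rho> f x y * t - deriv (recon \<epsilon> \<alpha> \<rho> f x y) t) \<longlongrightarrow> l) at_top)"


subsection \<open>Line integrals along segments\<close>

definition segment_integral :: "real^3 \<Rightarrow> real^3 \<Rightarrow> (real^3 \<Rightarrow> real) \<Rightarrow> real" where
  "segment_integral x y g = norm (y - x) * (LINT s:{0..1}|lborel. g (x + s *\<^sub>R (y - x)))"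

end

theory Submission imports Defs begin

text \<open>For \<open>x\<close> outside \<open>supp f\<close> the function \<open>y \<mapsto> K(t, x, y) f(y)\<close> is continuous with compact support, so the
  injectivity of the Radon transform on such functions identifies the reconstruction with it.
  Injectivity: a function with vanishing plane integrals is orthogonal to all exponentials
  \<open>exp (\<xi> \<bullet> y)\<close>, hence, by Stone--Weierstrass, to itself.

  In prolate spheroidal coordinates with foci \<open>x\<close>, \<open>y\<close> and \<open>p = |z - x| + |z - y|\<close>, the volume element
  divided by \<open>|z - x| |z - y|\<close> is \<open>(1/2) dp dv d\<phi>\<close>, so every integral in the kernel becomes
  \<open>(1/2) \<integral> (t - p)^j m(p) dp\<close> over \<open>[d, t]\<close>, where \<open>d = |y - x|\<close> and \<open>m(p)\<close> is a mean over the confocal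
  shell of parameter \<open>p\<close>. Differentiating twice in \<open>t\<close> leaves \<open>m'\<close> for the term with \<open>\<alpha>\<close> and \<open>m\<close> for
  the first term with \<open>\<rho>\<close>. As \<open>t\<close> decreases to \<open>d\<close> the shells collapse to the segment from \<open>x\<close> to
  \<open>y\<close>: the second order Taylor terms in \<open>m'\<close> produce the weighted integral of \<open>\<Delta>\<alpha>\<close>, and the \<open>\<rho>\<close> mean
  telescopes to a multiple of \<open>\<rho> y\<close>. For large \<open>t\<close> everything is affine in \<open>t\<close>, and the constant
  term is \<open>\<integral> \<nabla>\<rho>(z) \<bullet> (z - y) / |z - y|^3 dz = - 4 \<pi> \<rho> y\<close>, which is the case \<open>d = 0\<close> (spherical
  coordinates) of the same change of variables.\<close>

subsection \<open>Orthonormal frames\<close>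

text \<open>The data are combined so that \<rho> cancels. With \<open>d = norm (y - x)\<close> and
  \<open>S\<close> half of the weighted line integral, the limit at first arrival gives \<open>8 pi
  d N0 = f y (2 (1 - \<epsilon> \<alpha> y) - \<epsilon> \<rho> y + S)\<close>, and the late limit
  gives \<open>4 pi Ninf = f y (1 - \<epsilon> \<alpha> y - \<epsilon> \<rho> y)\<close>. The
  difference is \<open>f y\<close> times the denominator. The lower end of the telescoping \<rho>
  integral is \<open>\<rho> x\<close>, which vanishes because \<open>x\<close> lies outside
  \<open>D\<close>.

  The Newtonian integral enters at late times through \<open>|z - x| = p - |z - y|\<close>, which
  merges the two \<rho> terms of the kernel.

  Dividing requires a bound on \<open>S\<close> that is uniform in \<open>y\<close>, although
  \<open>y\<close> runs through all of space and \<open>S\<close> carries a factor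
  \<open>d^2\<close>. Let \<Sigma> lie in the ball of radius \<open>R\<close> about 0. The segment
  leaves that ball after length at most \<open>2 R\<close>, so only parameters
  \<open>s \<le> 2 R / d\<close> see the support of \<alpha>, and \<open>d^2\<close> cancels. Since
  \<delta> may depend only on \<Sigma> and \<epsilon>, the position of \<open>D\<close> in that ball
  is deduced from its frontier.\<close>

lemma distr_lborel_orthogonal:
  fixes f :: "real^'n::{finite,wellorder} \<Rightarrow> real^'n::_"
  assumes f: "orthogonal_transformation f"
  shows "distr lborel borel f = lborel"
proof (rule lborel_eqI[symmetric])
  fix l u :: "real^'n::_"
  assume le: "\<And>b. b \<in> Basis \<Longrightarrow> l \<bullet> b \<le> u \<bullet> b"
  have lf: "linear f" using f orthogonal_transformation_linear by blast
  have bij: "bij f" using f orthogonal_transformation_bij by blast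
  have cf: "continuous_on UNIV f" using lf by (simp add: linear_continuous_on linear_conv_bounded_linear)
  have [measurable]: "f \<in> borel_measurable borel" by (rule borel_measurable_continuous_onI[OF cf])
  have g: "orthogonal_transformation (inv f)" by (rule orthogonal_transformation_inv[OF f])
  \<comment> \<open>A preimage under \<open>f\<close> is an image under its inverse, again an
    orthogonal map, so invariance of the measure of images applies.\<close>
  have pre: "f -` box l u = inv f ` box l u" by (rule bij_vimage_eq_inv_image[OF bij])
  have B: "f -` box l u \<in> sets borel"
    using measurable_sets[of f borel borel "box l u"] by simp
  have "emeasure (distr lborel borel f) (box l u) = emeasure lborel (f -` box l u)"
    by (simp add: emeasure_distr)
  also have "\<dots> = emeasure lebesgue (inv f ` box l u)"
    unfolding pre[symmetric]
    using B by (simp add: main_part_sets)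
  also have "\<dots> = ennreal (measure lebesgue (inv f ` box l u))"
    by (rule emeasure_eq_measure2, rule measurable_orthogonal_image[OF g]) simp
  also have "\<dots> = ennreal (measure lebesgue (box l u))"
    by (subst measure_orthogonal_image[OF g]) simp_all
  also have "\<dots> = (\<Prod>b\<in>Basis. (u - l) \<bullet> b)"
    by (subst measure_completion) (simp_all add: measure_lborel_box le)
  finally show "emeasure (distr lborel borel f) (box l u) = (\<Prod>b\<in>Basis. (u - l) \<bullet> b)" .
qed simp

lemma continuous_on_vector3:
  "continuous_on S (\<lambda>(a, b, c). vector [a, b, c] :: real^3)"
proof -
  have eq: "(\<lambda>(a, b, c). vector [a, b, c] :: real^3) =
      (\<lambda>w. fst w *\<^sub>R axis 1 1 + fst (snd w) *\<^sub>R axis 2 1 + snd (snd w) *\<^sub>R axis 3 1)"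
    by (auto simp: fun_eq_iff vec_eq_iff forall_3 axis_def)
  show ?thesis unfolding eq by (intro continuous_intros)
qed

lemma emeasure_lborel_prod_set:
  fixes A :: "'a::euclidean_space set" and B :: "'b::euclidean_space set"
  assumes "A \<in> sets borel" "B \<in> sets borel"
  shows "emeasure lborel (A \<times> B) = emeasure lborel A * emeasure lborel B"
  using lborel.emeasure_pair_measure_Times[of A lborel B] assms by (simp add: lborel_prod)

lemma distr_lborel_vector3:
  "distr (lborel :: (real \<times> real \<times> real) measure) borel (\<lambda>(a, b, c). vector [a, b, c] :: real^3) = lborel"
  (is "distr _ _ ?f = _")
proof (rule lborel_eqI[symmetric])
  fix l u :: "real^3"
  assume le: "\<And>b. b \<in> Basis \<Longrightarrow> l \<bullet> b \<le> u \<bullet> b"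
  have le': "l $ i \<le> u $ i" for i using le[of "axis i 1"] by (simp add: axis_in_Basis_iff cart_eq_inner_axis)
  have "continuous_on UNIV ?f"
    by (rule continuous_on_vector3)
  then have [measurable]: "?f \<in> borel_measurable borel" by (rule borel_measurable_continuous_onI)
  have pre: "?f -` box l u = box (l$1) (u$1) \<times> box (l$2) (u$2) \<times> box (l$3) (u$3)"
    unfolding set_eq_iff mem_Times_iff vimage_eq mem_box_cart forall_3 split_paired_All by simp
  have "emeasure (distr lborel borel ?f) (box l u) = emeasure lborel (?f -` box l u)"
    by (simp add: emeasure_distr)
  also have "\<dots> = ennreal (u$1 - l$1) * (ennreal (u$2-l$2) * ennreal (u$3-l$3))"
    unfolding pre using le'[of 1] le'[of 2] le'[of 3] by (simp add: emeasure_lborel_prod_set borel_open open_Times)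
  also have "\<dots> = ennreal ((u$1 - l$1) * ((u$2 - l$2) * (u$3 - l$3)))"
    using le'[of 1] le'[of 2] le'[of 3] by (simp only: ennreal_mult diff_ge_0_iff_ge mult_nonneg_nonneg)
  also have "(u$1 - l$1) * ((u$2 - l$2) * (u$3 - l$3)) = (\<Prod>b\<in>Basis. (u - l) \<bullet> b)"
  proof -
    have B: "(Basis :: (real^3) set) = {axis 1 1, axis 2 1, axis 3 1}"
      unfolding Basis_vec_def by (auto simp: axis_eq_axis) (metis exhaust_3)
    show ?thesis unfolding B by (simp add: axis_eq_axis inner_axis)
  qed
  finally show "emeasure (distr lborel borel ?f) (box l u) = (\<Prod>b\<in>Basis. (u - l) \<bullet> b)" .
qed simp

definition orthonormal3 :: "real^3 \<Rightarrow> real^3 \<Rightarrow> real^3 \<Rightarrow> bool" where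
  "orthonormal3 e1 e2 e3 \<longleftrightarrow> norm e1 = 1 \<and> norm e2 = 1 \<and> norm e3 = 1 \<and>
     e1 \<bullet> e2 = 0 \<and> e1 \<bullet> e3 = 0 \<and> e2 \<bullet> e3 = 0"

text \<open>Triples as domain let Fubini split off the first coordinate, which is the plane offset
  \<open>r\<close> in the Radon part; the spheroidal coordinates, with first component
  \<open>p\<close>, are also given as triples.\<close>

definition frame_map :: "real^3 \<Rightarrow> real^3 \<Rightarrow> real^3 \<Rightarrow> real^3 \<Rightarrow> real \<times> real \<times> real \<Rightarrow> real^3" where
  "frame_map q e1 e2 e3 = (\<lambda>(a, b, c). q + a *\<^sub>R e1 + b *\<^sub>R e2 + c *\<^sub>R e3)"

lemma frame_map_measurable[measurable]: "frame_map q e1 e2 e3 \<in> borel_measurable borel"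
  unfolding frame_map_def case_prod_unfold
  by (intro borel_measurable_continuous_onI continuous_intros)

lemma orthonormal3_inner:
  assumes "orthonormal3 e1 e2 e3"
  shows "e1 \<bullet> e1 = 1" "e2 \<bullet> e2 = 1" "e3 \<bullet> e3 = 1" "e1 \<bullet> e2 = 0" "e1 \<bullet> e3 = 0" "e2 \<bullet> e3 = 0"
    "e2 \<bullet> e1 = 0" "e3 \<bullet> e1 = 0" "e3 \<bullet> e2 = 0"
  using assms by (auto simp: orthonormal3_def dot_square_norm inner_commute)

lemma orthonormal3_transformation:
  assumes "orthonormal3 e1 e2 e3"
  shows "orthogonal_transformation (\<lambda>w::real^3. (w$1) *\<^sub>R e1 + (w$2) *\<^sub>R e2 + (w$3) *\<^sub>R e3)"
  unfolding orthogonal_transformation_def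
proof (intro conjI allI)
  show "linear (\<lambda>w::real^3. (w$1) *\<^sub>R e1 + (w$2) *\<^sub>R e2 + (w$3) *\<^sub>R e3)"
    by (auto simp: linear_iff algebra_simps)
  fix v w :: "real^3"
  show "((v$1) *\<^sub>R e1 + (v$2) *\<^sub>R e2 + (v$3) *\<^sub>R e3) \<bullet> ((w$1) *\<^sub>R e1 + (w$2) *\<^sub>R e2 + (w$3) *\<^sub>R e3) = v \<bullet> w"
    by (simp add: inner_add_left inner_add_right orthonormal3_inner[OF assms])
      (simp add: inner_vec_def sum_3)
qed

lemma distr_lborel_frame_map:
  assumes "orthonormal3 e1 e2 e3"
  shows "distr lborel borel (frame_map q e1 e2 e3) = lborel"
proof -
  let ?v = "\<lambda>(a, b, c). vector [a, b, c] :: real^3"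
  define f where "f = (\<lambda>w::real^3. (w$1) *\<^sub>R e1 + (w$2) *\<^sub>R e2 + (w$3) *\<^sub>R e3)"
  have ot: "orthogonal_transformation f"
    unfolding f_def by (rule orthonormal3_transformation[OF assms])
  have [measurable]: "f \<in> borel_measurable borel" unfolding f_def
    by (intro borel_measurable_continuous_onI continuous_intros)
  have "continuous_on UNIV ?v"
    by (rule continuous_on_vector3)
  then have [measurable]: "?v \<in> borel_measurable borel" by (rule borel_measurable_continuous_onI)
  have eq: "frame_map q e1 e2 e3 = (+) q \<circ> (f \<circ> ?v)"
    by (auto simp: frame_map_def f_def add_ac)
  have "distr lborel borel (frame_map q e1 e2 e3) = distr (distr (distr lborel borel ?v) borel f) borel ((+) q)"
    unfolding eq by (subst distr_distr, measurable)+ (simp add: comp_assoc)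
  then show ?thesis by (simp add: distr_lborel_vector3 distr_lborel_orthogonal[OF ot] lborel_distr_plus)
qed

lemma orthonormal3_plane_frame:
  assumes "norm \<theta> = 1"
  shows "orthonormal3 \<theta> (plane_frame \<theta>) (cross3 \<theta> (plane_frame \<theta>))"
proof -
  have "\<exists>u::real^3. norm u = 1 \<and> u \<bullet> \<theta> = 0"
  proof -
    obtain w :: "real^3" where "w \<noteq> 0" "orthogonal \<theta> w"
      using orthogonal_to_vector_exists[of \<theta>] by auto
    then show ?thesis
      by (intro exI[of _ "w /\<^sub>R norm w"]) (auto simp: orthogonal_def inner_commute)
  qed
  from someI_ex[OF this] have u: "norm (plane_frame \<theta>) = 1" "plane_frame \<theta> \<bullet> \<theta> = 0"
    unfolding plane_frame_def by auto
  have "(norm (cross3 \<theta> (plane_frame \<theta>)))\<^sup>2 = 1"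
    using norm_cross_dot[of \<theta> "plane_frame \<theta>"] assms u by (simp add: inner_commute)
  then have "norm (cross3 \<theta> (plane_frame \<theta>)) = 1" by (simp add: power2_eq_1_iff) (smt (verit) norm_ge_zero)
  with assms u show ?thesis by (auto simp: orthonormal3_def dot_cross_self inner_commute)
qed

lemma orthonormal3_expand:
  assumes "orthonormal3 e1 e2 e3"
  shows "w = (w \<bullet> e1) *\<^sub>R e1 + (w \<bullet> e2) *\<^sub>R e2 + (w \<bullet> e3) *\<^sub>R e3"
proof -
  obtain v :: "real^3" where v: "w = (v$1) *\<^sub>R e1 + (v$2) *\<^sub>R e2 + (v$3) *\<^sub>R e3"
    using surjD[OF orthogonal_transformation_surj[OF orthonormal3_transformation[OF assms]], of w] by blast
  show ?thesis unfolding v by (simp add: inner_add_left orthonormal3_inner[OF assms])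
qed

subsection \<open>Injectivity of the Radon transform\<close>

lemma Cc_continuous: "g \<in> Cc \<Longrightarrow> continuous_on S g"
  by (auto simp: Cc_def intro: continuous_on_subset)

lemma Cc_borel: "g \<in> Cc \<Longrightarrow> g \<in> borel_measurable borel"
  by (intro borel_measurable_continuous_onI Cc_continuous)

lemma supp_zero: "z \<notin> supp g \<Longrightarrow> g z = 0"
  using closure_subset[of "{z. g z \<noteq> 0}"] by (auto simp: supp_def)

lemma integrable_compact_supp:
  fixes h :: "real^3 \<Rightarrow> real"
  assumes "compact S" "continuous_on UNIV h" "\<And>z. z \<notin> S \<Longrightarrow> h z = 0"
  shows "integrable lborel h"
proof -
  have "integrable lborel (\<lambda>z. indicator S z *\<^sub>R h z)"
    using assms by (intro borel_integrable_compact) (auto intro: continuous_on_subset)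
  moreover have "(\<lambda>z. indicator S z *\<^sub>R h z) = h"
    using assms(3) by (auto simp: fun_eq_iff indicator_def)
  ultimately show ?thesis by simp
qed

lemma radon3_frame_map:
  assumes [measurable]: "g \<in> borel_measurable borel"
  shows "radon3 g r \<theta> = (LINT w|lborel. g (frame_map 0 \<theta> (plane_frame \<theta>) (cross3 \<theta> (plane_frame \<theta>)) (r, w)))"
proof -
  have [measurable]: "(\<lambda>(a, b). r *\<^sub>R \<theta> + a *\<^sub>R plane_frame \<theta> + b *\<^sub>R cross3 \<theta> (plane_frame \<theta>)) \<in> borel_measurable (borel :: (real \<times> real) measure)"
    unfolding case_prod_unfold by (intro borel_measurable_continuous_onI continuous_intros)
  show ?thesis unfolding radon3_def plane_measure_def
    by (subst integral_distr, simp, simp) (simp add: frame_map_def case_prod_unfold)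
qed

text \<open>Fubini in the frame adapted to \<theta>: the factor in front of \<open>g\<close> depends
  only on \<open>y \<bullet> \<theta>\<close>, which is constant on each plane, so it leaves the
  plane integral. The set \<open>T\<close> restricts the offsets to those where the transform is
  known.\<close>

lemma integral_halfspace_radon3:
  assumes g: "g \<in> Cc" and \<theta>: "norm \<theta> = 1" and T[measurable]: "T \<in> sets borel"
  shows "integrable lborel (\<lambda>y. indicator T (y \<bullet> \<theta>) * (exp (s * (y \<bullet> \<theta>)) * g y))" (is "integrable _ ?F")
    and "(LINT y|lborel. indicator T (y \<bullet> \<theta>) * (exp (s * (y \<bullet> \<theta>)) * g y)) =
         (LINT r|lborel. indicator T r * exp (s * r) * radon3 g r \<theta>)"
proof -
  let ?f = "frame_map 0 \<theta> (plane_frame \<theta>) (cross3 \<theta> (plane_frame \<theta>))"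
  note on = orthonormal3_plane_frame[OF \<theta>]
  note [measurable] = Cc_borel[OF g]
  have "integrable lborel (\<lambda>y. exp (s * (y \<bullet> \<theta>)) * g y)"
    using g by (intro integrable_compact_supp[of "supp g"])
      (auto simp: Cc_def supp_zero intro!: continuous_intros)
  then have "integrable lborel (\<lambda>y. indicator ((\<lambda>y. y \<bullet> \<theta>) -` T) y *\<^sub>R (exp (s * (y \<bullet> \<theta>)) * g y))"
    using measurable_sets[of "\<lambda>y. y \<bullet> \<theta>" borel borel T] T
    by (intro integrable_mult_indicator) auto
  also have "(\<lambda>y. indicator ((\<lambda>y. y \<bullet> \<theta>) -` T) y *\<^sub>R (exp (s * (y \<bullet> \<theta>)) * g y)) = ?F"
    by (auto simp: fun_eq_iff indicator_def)
  finally show int: "integrable lborel ?F" .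
  have dot: "?f (r, w) \<bullet> \<theta> = r" for r w
    by (simp add: frame_map_def case_prod_unfold inner_add_left orthonormal3_inner[OF on])
  have meas: "?F \<in> borel_measurable borel" by measurable
  have "integrable (distr lborel borel ?f) ?F"
    unfolding distr_lborel_frame_map[OF on] by (rule int)
  then have "integrable lborel (\<lambda>w. ?F (?f w))"
    by (subst (asm) integrable_distr_eq) (auto intro: meas)
  then have int2: "integrable (lborel \<Otimes>\<^sub>M lborel) (\<lambda>w. ?F (?f w))" by (simp add: lborel_prod)
  have "(LINT y|lborel. ?F y) = (LINT y|(distr lborel borel ?f). ?F y)"
    unfolding distr_lborel_frame_map[OF on] ..
  also have "\<dots> = (LINT w|lborel. ?F (?f w))"
    by (subst integral_distr) (auto intro: meas)
  also have "\<dots> = (LINT w|(lborel \<Otimes>\<^sub>M lborel). ?F (?f w))" by (simp add: lborel_prod)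
  also have "\<dots> = (LINT r|lborel. LINT w|lborel. ?F (?f (r, w)))"
    by (rule lborel_pair.integral_fst'[OF int2, symmetric])
  also have "\<dots> = (LINT r|lborel. LINT w|lborel. indicator T r * exp (s * r) * g (?f (r, w)))"
    unfolding dot by (simp add: mult.assoc)
  also have "\<dots> = (LINT r|lborel. indicator T r * exp (s * r) * radon3 g r \<theta>)"
    by (simp add: radon3_frame_map Cc_borel[OF g])
  finally show "(LINT y|lborel. ?F y) = (LINT r|lborel. indicator T r * exp (s * r) * radon3 g r \<theta>)" .
qed

text \<open>Only \<open>r \<ge> 0\<close> is available, so the half spaces of \<open>\<theta>\<close> and \<open>-\<theta>\<close> are treated separately; this also avoids
  comparing the frames chosen for \<open>\<theta>\<close> and \<open>-\<theta>\<close>.\<close>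

lemma radon3_exp_moment_eq:
  assumes g: "g \<in> Cc" and h: "h \<in> Cc"
    and eq: "\<And>r \<theta>. r \<ge> 0 \<Longrightarrow> norm \<theta> = 1 \<Longrightarrow> radon3 g r \<theta> = radon3 h r \<theta>"
  shows "(LINT y|lborel. exp (\<xi> \<bullet> y) * g y) = (LINT y|lborel. exp (\<xi> \<bullet> y) * h y)"
proof -
  obtain \<theta> s where \<theta>: "norm \<theta> = 1" and \<xi>: "\<xi> = s *\<^sub>R \<theta>"
  proof (cases "\<xi> = 0")
    case True
    then show ?thesis using that[of "axis 1 1" 0] by simp
  next
    case False
    then show ?thesis using that[of "\<xi> /\<^sub>R norm \<xi>" "norm \<xi>"] by simp
  qed
  let ?F = "\<lambda>T \<theta> s g y. indicator T (y \<bullet> \<theta>) * (exp (s * (y \<bullet> \<theta>)) * g y)"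
  let ?A = "\<lambda>g. (LINT y|lborel. ?F {0..} \<theta> s g y) + (LINT y|lborel. ?F {0<..} (-\<theta>) (-s) g y)"
  have split: "(LINT y|lborel. exp (\<xi> \<bullet> y) * g y) = ?A g" if g: "g \<in> Cc" for g
  proof -
    have "?A g = (LINT y|lborel. ?F {0..} \<theta> s g y + ?F {0<..} (-\<theta>) (-s) g y)"
      using \<theta> by (intro Bochner_Integration.integral_add[symmetric] integral_halfspace_radon3(1) g) auto
    also have "\<dots> = (LINT y|lborel. exp (\<xi> \<bullet> y) * g y)"
      by (rule Bochner_Integration.integral_cong) (auto simp: indicator_def \<xi> inner_commute)
    finally show ?thesis by simp
  qed
  have "(LINT y|lborel. ?F {0..} \<theta> s g y) = (LINT y|lborel. ?F {0..} \<theta> s h y)"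
    using \<theta> g h by (simp only: integral_halfspace_radon3(2) borel_closed closed_atLeast)
      (auto intro!: Bochner_Integration.integral_cong simp: eq indicator_def)
  moreover have "(LINT y|lborel. ?F {0<..} (-\<theta>) (-s) g y) = (LINT y|lborel. ?F {0<..} (-\<theta>) (-s) h y)"
    using \<theta> g h by (simp only: integral_halfspace_radon3(2) borel_open open_greaterThan norm_minus_cancel)
      (auto intro!: Bochner_Integration.integral_cong simp: eq indicator_def)
  ultimately show ?thesis using split[OF g] split[OF h] by simp
qed

text \<open>The span of the real exponentials. Orthogonality passes to it by linearity, and closure
  under products makes it the algebra for Stone--Weierstrass. Real exponents are admissible because
  compact support makes every exponential moment finite.\<close>

inductive expsum :: "(real^3 \<Rightarrow> real) \<Rightarrow> bool" where
  exp: "expsum (\<lambda>y. c * exp (\<xi> \<bullet> y))"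
| add: "expsum f \<Longrightarrow> expsum g \<Longrightarrow> expsum (\<lambda>y. f y + g y)"

lemma expsum_continuous: "expsum f \<Longrightarrow> continuous_on S f"
  by (induction rule: expsum.induct) (auto intro!: continuous_intros)

lemma expsum_mult: "expsum f \<Longrightarrow> expsum g \<Longrightarrow> expsum (\<lambda>y. f y * g y)"
proof (induction rule: expsum.induct)
  case (exp c \<xi>)
  from exp show ?case
  proof (induction rule: expsum.induct)
    case (exp c' \<xi>')
    show ?case using expsum.exp[of "c * c'" "\<xi> + \<xi>'"]
      by (simp add: inner_add_left exp_add mult_ac)
  next
    case (add f g)
    then show ?case using expsum.add by (simp add: distrib_left)
  qed
next
  case (add f g')
  then show ?case using expsum.add by (simp add: distrib_right)
qed

lemma nonpos_if_le_small_multiples: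
  fixes a b :: real
  assumes "b \<ge> 0" "\<And>e. e > 0 \<Longrightarrow> a \<le> e * b"
  shows "a \<le> 0"
proof (rule field_le_epsilon)
  fix e :: real assume "e > 0"
  then have "a \<le> (e / (b + 1)) * b" using assms(1) by (intro assms(2)) (auto intro!: divide_pos_pos)
  also have "\<dots> \<le> e" using assms(1) \<open>e > 0\<close> by (simp add: field_simps)
  finally show "a \<le> 0 + e" by simp
qed

lemma radon3_inj:
  assumes g: "g \<in> Cc" and h: "h \<in> Cc"
    and eq: "\<And>r \<theta>. r \<ge> 0 \<Longrightarrow> norm \<theta> = 1 \<Longrightarrow> radon3 g r \<theta> = radon3 h r \<theta>"
  shows "g = h"
proof -
  define S where "S = supp g \<union> supp h"
  define u where "u y = g y - h y" for y
  have S: "compact S" using g h by (auto simp: S_def Cc_def)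
  have u0: "u z = 0" if "z \<notin> S" for z using that by (auto simp: S_def u_def supp_zero)
  have cu: "continuous_on A u" for A
    unfolding u_def by (intro continuous_intros Cc_continuous g h)
  have iu: "integrable lborel (\<lambda>y. p y * u y)" if "continuous_on UNIV p" for p
    by (rule integrable_compact_supp[OF S]) (auto intro!: continuous_intros cu that simp: u0)
  have ex: "(LINT y|lborel. p y * u y) = 0" if "expsum p" for p
    using that
  proof induction
    case (exp c \<xi>)
    have "integrable lborel (\<lambda>y. exp (\<xi> \<bullet> y) * g y)" "integrable lborel (\<lambda>y. exp (\<xi> \<bullet> y) * h y)"
      using Cc_continuous[OF g] Cc_continuous[OF h]
      by (auto intro!: integrable_compact_supp[OF S] continuous_intros simp: S_def supp_zero)
    then have "(LINT y|lborel. exp (\<xi> \<bullet> y) * u y) = 0"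
      using radon3_exp_moment_eq[OF g h eq, of \<xi>] by (simp add: u_def right_diff_distrib)
    then show ?case by (simp add: mult.assoc)
  next
    case (add p q)
    then show ?case by (simp add: distrib_right iu expsum_continuous)
  qed
  have iu2: "integrable lborel (\<lambda>y. u y * u y)" by (rule iu[OF cu])
  have iau: "integrable lborel (\<lambda>y. \<bar>u y\<bar>)" using iu[of "\<lambda>_. 1"] by simp
  let ?I = "LINT y|lborel. \<bar>u y\<bar>"
  have I0: "?I \<ge> 0" by simp
  have le: "(LINT y|lborel. u y * u y) \<le> e * ?I" if "e > 0" for e
  proof -
    interpret function_ring_on "Collect expsum" S
    proof
      show "(\<lambda>_. c) \<in> Collect expsum" for c using expsum.exp[of c 0] by simp
      fix x y :: "real^3" assume "x \<noteq> y"
      \<comment> \<open>The exponent \<open>x - y\<close> separates the two points, since its values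
        there differ by \<open>(x - y) \<bullet> (x - y) > 0\<close>.\<close>
      then have "exp ((x - y) \<bullet> x) \<noteq> exp ((x - y) \<bullet> y)"
        by (metis exp_inj_iff inner_diff_right inner_eq_zero_iff right_minus_eq)
      then show "\<exists>f\<in>Collect expsum. f x \<noteq> f y"
        by (intro bexI[of _ "\<lambda>z. 1 * exp ((x - y) \<bullet> z)"] CollectI expsum.exp) simp
    qed (auto intro: S expsum_continuous expsum_mult expsum.add)
    obtain p where p: "expsum p" "\<And>y. y \<in> S \<Longrightarrow> \<bar>u y - p y\<bar> < e"
      using Stone_Weierstrass_basic[OF cu \<open>e > 0\<close>] by auto
    have ip: "integrable lborel (\<lambda>y. p y * u y)" by (intro iu expsum_continuous p)
    \<comment> \<open>The approximant \<open>p\<close> is orthogonal to \<open>u\<close>, so it may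
      be subtracted; then one factor is smaller than \<open>e\<close> on \<open>S\<close>.\<close>
    have "(LINT y|lborel. u y * u y) = (LINT y|lborel. u y * u y - p y * u y)"
      using ex[OF p(1)] by (simp add: iu2 ip)
    also have "\<dots> \<le> (LINT y|lborel. e * \<bar>u y\<bar>)"
    proof (rule integral_mono)
      fix y
      have "u y * u y - p y * u y \<le> \<bar>u y - p y\<bar> * \<bar>u y\<bar>"
        by (simp add: abs_mult[symmetric] left_diff_distrib[symmetric])
      also have "\<dots> \<le> e * \<bar>u y\<bar>"
        using p(2)[of y] u0[of y] by (cases "y \<in> S") (auto intro!: mult_right_mono)
      finally show "u y * u y - p y * u y \<le> e * \<bar>u y\<bar>" .
    qed (use iu2 ip iau in auto)
    finally show ?thesis by simp
  qed
  have "(LINT y|lborel. u y * u y) \<le> 0"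
    by (rule nonpos_if_le_small_multiples[OF I0 le])
  moreover have "(LINT y|lborel. u y * u y) \<ge> 0" by (intro integral_nonneg_AE) auto
  ultimately have *: "(LINT y|lborel. u y * u y) = 0" by simp
  \<comment> \<open>A vanishing integral gives \<open>u = 0\<close> only almost everywhere; by
    continuity the exceptional set is open, and an open null set is empty.\<close>
  have op: "open {y. u y \<noteq> 0}"
    by (rule open_Collect_neq[OF cu continuous_on_const])
  then have "{y. u y \<noteq> 0} \<in> sets lborel" by simp
  moreover have "AE y in lborel. u y = 0"
    using integral_nonneg_eq_0_iff_AE[OF iu2] * by simp
  ultimately have "{y. u y \<noteq> 0} \<in> null_sets lborel"
    by (intro AE_iff_null_sets[THEN iffD2]) simp_all
  then have "negligible {y. u y \<noteq> 0}"
    by (simp add: negligible_iff_null_sets null_sets_completionI)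
  then have "{y. u y \<noteq> 0} = {}" using op open_not_negligible by blast
  then show ?thesis by (auto simp: u_def fun_eq_iff)
qed

text \<open>Injectivity serves twice: it evaluates the definite description in
  \<open>radon3_inv\<close>, and it supplies the unique existence that \<open>data_exist\<close>
  demands.\<close>

lemma radon3_inv_eqI:
  assumes g: "g \<in> Cc" and m: "\<And>r \<theta>. r \<ge> 0 \<Longrightarrow> norm \<theta> = 1 \<Longrightarrow> radon3 g r \<theta> = m r \<theta>"
  shows "\<exists>!g. g \<in> Cc \<and> (\<forall>r\<ge>0. \<forall>\<theta>\<in>sphere 0 1. radon3 g r \<theta> = m r \<theta>)"
    and "radon3_inv m = g"
proof -
  have P: "g \<in> Cc \<and> (\<forall>r\<ge>0. \<forall>\<theta>\<in>sphere 0 1. radon3 g r \<theta> = m r \<theta>)" using g m by auto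
  have U: "h = g" if "h \<in> Cc \<and> (\<forall>r\<ge>0. \<forall>\<theta>\<in>sphere 0 1. radon3 h r \<theta> = m r \<theta>)" for h
    using that m by (intro radon3_inj g) auto
  show "\<exists>!g. g \<in> Cc \<and> (\<forall>r\<ge>0. \<forall>\<theta>\<in>sphere 0 1. radon3 g r \<theta> = m r \<theta>)"
  proof (rule ex1I[where a = g])
    show "g \<in> Cc \<and> (\<forall>r\<ge>0. \<forall>\<theta>\<in>sphere 0 1. radon3 g r \<theta> = m r \<theta>)" by (rule P)
  qed (rule U)
  show "radon3_inv m = g"
    unfolding radon3_inv_def
  proof (rule the_equality)
    show "g \<in> Cc \<and> (\<forall>r\<ge>0. \<forall>\<theta>\<in>sphere 0 1. radon3 g r \<theta> = m r \<theta>)" by (rule P)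
  qed (rule U)
qed

subsection \<open>Prolate spheroidal coordinates\<close>

text \<open>The point with spheroidal coordinates \<open>(p, v, \<phi>)\<close> for the foci \<open>(-d/2, 0, 0)\<close> and \<open>(d/2, 0, 0)\<close>: its
  distances to them are \<open>(p + d v) / 2\<close> and \<open>(p - d v) / 2\<close>. For \<open>d = 0\<close> these are spherical
  coordinates of radius \<open>p / 2\<close>.\<close>

definition spheroidal :: "real \<Rightarrow> real \<times> real \<times> real \<Rightarrow> real \<times> real \<times> real" where
  "spheroidal d = (\<lambda>(p, v, \<phi>). (p * v / 2,
     sqrt (p\<^sup>2 - d\<^sup>2) * sqrt (1 - v\<^sup>2) / 2 * cos \<phi>, sqrt (p\<^sup>2 - d\<^sup>2) * sqrt (1 - v\<^sup>2) / 2 * sin \<phi>))"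

text \<open>Open, and free of the focal segment (\<open>p = d\<close>), the rest of the axis
  (\<open>v = 1\<close> or \<open>v = -1\<close>) and the half plane of angle 0, so the coordinates
  are smooth and injective on it. Only a negligible set is missed.\<close>

definition spheroidal_dom :: "real \<Rightarrow> (real \<times> real \<times> real) set" where
  "spheroidal_dom d = {d<..} \<times> {-1<..<1} \<times> {0<..<2*pi}"

text \<open>Half the product of the two focal distances \<open>(p + d v) / 2\<close> and
  \<open>(p - d v) / 2\<close>.\<close>

definition spheroidal_jac :: "real \<Rightarrow> real \<times> real \<times> real \<Rightarrow> real" where
  "spheroidal_jac d = (\<lambda>(p, v, \<phi>). (p\<^sup>2 - d\<^sup>2 * v\<^sup>2) / 8)"

lemma continuous_on_spheroidal: "continuous_on S (spheroidal d)"
  unfolding spheroidal_def case_prod_unfold by (intro continuous_intros) auto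

lemma spheroidal_measurable[measurable]: "spheroidal d \<in> borel_measurable borel"
  by (intro borel_measurable_continuous_onI continuous_on_spheroidal)

lemma spheroidal_jac_measurable[measurable]: "spheroidal_jac d \<in> borel_measurable borel"
  unfolding spheroidal_jac_def case_prod_unfold by (intro borel_measurable_continuous_onI continuous_intros) auto

lemma spheroidal_dom_borel[measurable]: "spheroidal_dom d \<in> sets borel"
  unfolding spheroidal_dom_def by (intro borel_open open_Times) auto

lemma spheroidal_dom_pos:
  assumes "(p, v, \<phi>) \<in> spheroidal_dom d" "d \<ge> 0"
  shows "p > 0" "p\<^sup>2 - d\<^sup>2 > 0" "1 - v\<^sup>2 > 0" "p\<^sup>2 - d\<^sup>2 * v\<^sup>2 > 0"
proof -
  have p: "p > d" and v: "\<bar>v\<bar> < 1" using assms by (auto simp: spheroidal_dom_def)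
  show "p > 0" using p assms by simp
  show a: "p\<^sup>2 - d\<^sup>2 > 0" using p assms by (simp add: power_strict_mono)
  show b: "1 - v\<^sup>2 > 0" using v by (simp add: abs_square_less_1)
  have "d\<^sup>2 * v\<^sup>2 \<le> d\<^sup>2 * 1" using b by (intro mult_left_mono) auto
  then show "p\<^sup>2 - d\<^sup>2 * v\<^sup>2 > 0" using a by simp
qed

text \<open>Both identities reduce to \<open>b^2 + c^2 = (p^2 - d^2) (1 - v^2) / 4\<close>. The
  closed ranges include the collapsed shell \<open>p = d\<close> and the points of the axis.\<close>

lemma spheroidal_foci:
  assumes "(p, v, \<phi>) \<in> {d..} \<times> {-1..1} \<times> UNIV" "d \<ge> 0" "spheroidal d (p, v, \<phi>) = (a, b, c)"
  shows "(a + d/2)\<^sup>2 + b\<^sup>2 + c\<^sup>2 = ((p + d * v) / 2)\<^sup>2" "(a - d/2)\<^sup>2 + b\<^sup>2 + c\<^sup>2 = ((p - d * v) / 2)\<^sup>2"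
proof -
  have "p\<^sup>2 - d\<^sup>2 \<ge> 0" "1 - v\<^sup>2 \<ge> 0" using assms by (auto simp: power_mono abs_square_le_1)
  moreover define A B where "A = sqrt (p\<^sup>2 - d\<^sup>2)" and "B = sqrt (1 - v\<^sup>2)"
  ultimately have AB: "A\<^sup>2 = p\<^sup>2 - d\<^sup>2" "B\<^sup>2 = 1 - v\<^sup>2" by simp_all
  have "b = A * B / 2 * cos \<phi>" "c = A * B / 2 * sin \<phi>"
    using assms(3) by (auto simp: spheroidal_def A_def B_def)
  then have "b\<^sup>2 + c\<^sup>2 = A\<^sup>2 * B\<^sup>2 / 4 * ((cos \<phi>)\<^sup>2 + (sin \<phi>)\<^sup>2)"
    by (simp only: power_mult_distrib power_divide distrib_left) simp
  then have bc: "b\<^sup>2 + c\<^sup>2 = (p\<^sup>2 - d\<^sup>2) * (1 - v\<^sup>2) / 4" by (simp add: AB)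
  have a: "a = p * v / 2" using assms(3) by (simp add: spheroidal_def)
  show "(a + d/2)\<^sup>2 + b\<^sup>2 + c\<^sup>2 = ((p + d * v) / 2)\<^sup>2" "(a - d/2)\<^sup>2 + b\<^sup>2 + c\<^sup>2 = ((p - d * v) / 2)\<^sup>2"
    using bc unfolding a by (simp_all add: field_simps power2_eq_square)
qed

lemma inj_on_spheroidal:
  assumes d: "d \<ge> 0"
  shows "inj_on (spheroidal d) (spheroidal_dom d)"
proof (rule inj_onI)
  fix w w'
  assume *: "w \<in> spheroidal_dom d" "w' \<in> spheroidal_dom d" "spheroidal d w = spheroidal d w'"
  obtain p v \<phi> p' v' \<phi>' where ww: "w = (p, v, \<phi>)" "w' = (p', v', \<phi>')"
    by (metis prod_cases3)
  have w: "(p, v, \<phi>) \<in> spheroidal_dom d" and w': "(p', v', \<phi>') \<in> spheroidal_dom d"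
    and eq: "spheroidal d (p, v, \<phi>) = spheroidal d (p', v', \<phi>')"
    using * unfolding ww by auto
  note pos = spheroidal_dom_pos[OF w d] and pos' = spheroidal_dom_pos[OF w' d]
  obtain a b c where abc: "spheroidal d (p, v, \<phi>) = (a, b, c)" by (rule prod_cases3)
  have dv: "\<bar>d * v\<bar> < p" "\<bar>d * v'\<bar> < p'"
    using power2_less_imp_less[of "\<bar>d * v\<bar>" p] power2_less_imp_less[of "\<bar>d * v'\<bar>" p'] pos pos'
    by (simp_all add: power_mult_distrib)
  have dom: "(p, v, \<phi>) \<in> {d..} \<times> {-1..1} \<times> UNIV" "(p', v', \<phi>') \<in> {d..} \<times> {-1..1} \<times> UNIV"
    using w w' by (auto simp: spheroidal_dom_def)
  have "((p + d * v) / 2)\<^sup>2 = ((p' + d * v') / 2)\<^sup>2" "((p - d * v) / 2)\<^sup>2 = ((p' - d * v') / 2)\<^sup>2"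
    using spheroidal_foci[OF dom(1) d abc] spheroidal_foci[OF dom(2) d abc[unfolded eq]] by simp_all
  then have "p + d * v = p' + d * v'" "p - d * v = p' - d * v'"
    using dv by (auto dest!: power2_eq_imp_eq)
  then have p: "p = p'" by simp
  \<comment> \<open>For \<open>d = 0\<close> the focal distances say nothing about \<open>v\<close>;
    the axial coordinate \<open>p * v / 2\<close> determines it in all cases.\<close>
  have v: "v = v'" using eq pos(1) p by (simp add: spheroidal_def)
  have "sqrt (p\<^sup>2 - d\<^sup>2) * sqrt (1 - v\<^sup>2) \<noteq> 0" using pos by simp
  then have cs: "cos \<phi> = cos \<phi>'" "sin \<phi> = sin \<phi>'"
    using eq p v by (auto simp: spheroidal_def)
  have "\<phi> \<in> {0..<2*pi}" "\<phi>' \<in> {0..<2*pi}" using w w' by (auto simp: spheroidal_dom_def)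
  moreover obtain n :: int where n: "\<phi> = \<phi>' + 2 * pi * n"
    using cs sin_cos_eq_iff[of \<phi> \<phi>'] by auto
  ultimately have "2 * pi * n < 2 * pi * 1" "2 * pi * (-1) < 2 * pi * n"
    unfolding atLeastLessThan_iff by linarith+
  then have "real_of_int n < 1" "-1 < real_of_int n"
    using mult_less_cancel_left_pos[of "2 * pi"] pi_gt_zero by (metis mult_pos_pos zero_less_numeral)+
  then have "n = 0" by linarith
  with p v n show "w = w'" unfolding ww by simp
qed

text \<open>With \<open>c \<noteq> 0\<close> the point is off the axis, which forces
  \<open>p > d\<close> and \<open>\<bar>v\<bar> < 1\<close>, and off the half plane of angle 0. This
  removes no more than a hyperplane.\<close>

lemma spheroidal_image:
  assumes d: "d \<ge> 0" and c: "c \<noteq> 0"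
  shows "(a, b, c) \<in> spheroidal d ` spheroidal_dom d"
proof -
  define A where "A = sqrt ((a + d/2)\<^sup>2 + b\<^sup>2 + c\<^sup>2)"
  define B where "B = sqrt ((a - d/2)\<^sup>2 + b\<^sup>2 + c\<^sup>2)"
  define p where "p = A + B"
  \<comment> \<open>Equal to \<open>(A - B) / d\<close> when \<open>d > 0\<close>, but this form
    also makes sense for coincident foci.\<close>
  define v where "v = 2 * a / p"
  have c2: "c\<^sup>2 > 0" using c by simp
  have A2: "A\<^sup>2 = (a + d/2)\<^sup>2 + b\<^sup>2 + c\<^sup>2" and B2: "B\<^sup>2 = (a - d/2)\<^sup>2 + b\<^sup>2 + c\<^sup>2"
    unfolding A_def B_def using c2 by (simp_all add: add_nonneg_nonneg)
  have "\<bar>a + d/2\<bar> < A" unfolding A_def using c2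
    by (intro real_less_rsqrt) (simp add: add_nonneg_pos)
  moreover have "\<bar>a - d/2\<bar> < B" unfolding B_def using c2
    by (intro real_less_rsqrt) (simp add: add_nonneg_pos)
  ultimately have p: "p > d" "p > 0" and a2: "\<bar>2 * a\<bar> < p" unfolding p_def by linarith+
  have v: "\<bar>v\<bar> < 1" unfolding v_def using a2 p by (simp add: field_simps)
  have "(A - B) * p = d * (2 * a)"
    using A2 B2 by (simp add: p_def algebra_simps power2_eq_square)
  then have "A - B = d * v" using p by (simp add: v_def field_simps)
  then have A: "A = (p + d * v) / 2" by (simp add: p_def)
  have av: "a = p * v / 2" using p by (simp add: v_def)
  have bc: "b\<^sup>2 + c\<^sup>2 = (p\<^sup>2 - d\<^sup>2) * (1 - v\<^sup>2) / 4"
    using A2 unfolding A av by (simp add: field_simps power2_eq_square)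
  define R where "R = sqrt (p\<^sup>2 - d\<^sup>2) * sqrt (1 - v\<^sup>2) / 2"
  have nn: "p\<^sup>2 - d\<^sup>2 > 0" "1 - v\<^sup>2 > 0" using p d v by (auto simp: power_strict_mono abs_square_less_1)
  have R: "R > 0" unfolding R_def using nn by simp
  have R2: "R\<^sup>2 = b\<^sup>2 + c\<^sup>2" unfolding bc R_def using nn by (simp add: power_mult_distrib power_divide)
  have "(b / R)\<^sup>2 + (c / R)\<^sup>2 = (b\<^sup>2 + c\<^sup>2) / R\<^sup>2" by (simp add: power_divide add_divide_distrib)
  then have "(b / R)\<^sup>2 + (c / R)\<^sup>2 = 1" using R unfolding R2[symmetric] by simp
  then obtain t where t: "0 \<le> t" "t < 2 * pi" "b / R = cos t" "c / R = sin t"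
    using sincos_total_2pi[of "b / R" "c / R"] by metis
  have "t \<noteq> 0" using t(4) c R by auto
  then have "(p, v, t) \<in> spheroidal_dom d" using p v t by (auto simp: spheroidal_dom_def)
  moreover have "spheroidal d (p, v, t) = (a, b, c)"
  proof -
    have "b = R * cos t" "c = R * sin t" using R t(3,4) by (simp_all add: field_simps)
    then show ?thesis unfolding spheroidal_def by (simp add: av R_def)
  qed
  ultimately show ?thesis by (metis imageI)
qed

text \<open>Two models of space are in use: the change of variables with a determinant works on
  \<open>real^3\<close>, Fubini on triples.\<close>

definition vec3 :: "real \<times> real \<times> real \<Rightarrow> real^3" where "vec3 = (\<lambda>(a, b, c). vector [a, b, c])"
definition tup3 :: "real^3 \<Rightarrow> real \<times> real \<times> real" where "tup3 w = (w$1, w$2, w$3)"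

lemma tup3_vec3[simp]: "tup3 (vec3 w) = w"
  by (cases w) (simp add: tup3_def vec3_def)

lemma vec3_tup3[simp]: "vec3 (tup3 w) = w"
  by (simp add: tup3_def vec3_def vec_eq_iff forall_3)

lemma vec3_measurable[measurable]: "vec3 \<in> borel_measurable borel"
  unfolding vec3_def by (intro borel_measurable_continuous_onI continuous_on_vector3)

lemma tup3_measurable[measurable]: "tup3 \<in> borel_measurable borel"
  unfolding tup3_def by (intro borel_measurable_continuous_onI continuous_intros)

lemma distr_vec3: "distr lborel borel vec3 = lborel"
  unfolding vec3_def by (rule distr_lborel_vector3)

lemma has_derivative_spheroidal:
  fixes w :: "real^3"
  assumes w: "tup3 w \<in> spheroidal_dom d" and d: "d \<ge> 0"
  obtains g' where "((\<lambda>w. vec3 (spheroidal d (tup3 w))) has_derivative g') (at w)"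
    "\<bar>det (matrix g')\<bar> = spheroidal_jac d (tup3 w)"
proof -
  let ?p = "w$1" and ?v = "w$2" and ?f = "w$3"
  have w': "(?p, ?v, ?f) \<in> spheroidal_dom d" using w by (simp add: tup3_def)
  note pos = spheroidal_dom_pos[OF w' d]
  define A where "A = sqrt (?p\<^sup>2 - d\<^sup>2)"
  define B where "B = sqrt (1 - ?v\<^sup>2)"
  have A: "A > 0" "A\<^sup>2 = ?p\<^sup>2 - d\<^sup>2" and B: "B > 0" "B\<^sup>2 = 1 - ?v\<^sup>2"
    using pos by (auto simp: A_def B_def)
  let ?c = "cos ?f" and ?s = "sin ?f"
  define g1 where "g1 h = (h$1 * ?v + ?p * h$2) / 2" for h :: "real^3"
  define g2 where "g2 h = (?p / A * B * ?c * h$1 - A * (?v / B) * ?c * h$2 - A * B * ?s * h$3) / 2" for h :: "real^3"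
  define g3 where "g3 h = (?p / A * B * ?s * h$1 - A * (?v / B) * ?s * h$2 + A * B * ?c * h$3) / 2" for h :: "real^3"
  define g' :: "real^3 \<Rightarrow> real^3" where "g' h = g1 h *\<^sub>R axis 1 1 + g2 h *\<^sub>R axis 2 1 + g3 h *\<^sub>R axis 3 (1::real)" for h
  have eq: "(\<lambda>w::real^3. vec3 (spheroidal d (tup3 w))) = (\<lambda>w. (w$1 * w$2 / 2) *\<^sub>R axis 1 1
      + (sqrt ((w$1)\<^sup>2 - d\<^sup>2) * sqrt (1 - (w$2)\<^sup>2) * cos (w$3) / 2) *\<^sub>R axis 2 1
      + (sqrt ((w$1)\<^sup>2 - d\<^sup>2) * sqrt (1 - (w$2)\<^sup>2) * sin (w$3) / 2) *\<^sub>R axis 3 1)"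
    by (auto simp: fun_eq_iff vec_eq_iff forall_3 axis_def vec3_def tup3_def spheroidal_def)
  have vn: "((\<lambda>w::real^3. w$i) has_derivative (\<lambda>h. h$i)) (at w)" for i
    by (rule bounded_linear_imp_has_derivative[OF bounded_linear_vec_nth])
  have dA: "((\<lambda>w::real^3. sqrt ((w$1)\<^sup>2 - d\<^sup>2)) has_derivative (\<lambda>h. ?p / A * h$1)) (at w)"
    using pos A_def by (auto intro!: derivative_eq_intros vn simp: field_simps)
  have dB: "((\<lambda>w::real^3. sqrt (1 - (w$2)\<^sup>2)) has_derivative (\<lambda>h. - (?v / B) * h$2)) (at w)"
    using pos B_def by (auto intro!: derivative_eq_intros vn simp: field_simps)
  have dC: "((\<lambda>w::real^3. cos (w$3)) has_derivative (\<lambda>h. - ?s * h$3)) (at w)"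
    by (auto intro!: derivative_eq_intros vn simp: fun_eq_iff)
  have dS: "((\<lambda>w::real^3. sin (w$3)) has_derivative (\<lambda>h. ?c * h$3)) (at w)"
    by (auto intro!: derivative_eq_intros vn simp: fun_eq_iff)
  have "((\<lambda>w. vec3 (spheroidal d (tup3 w))) has_derivative g') (at w)"
    unfolding eq g'_def
  proof (intro has_derivative_add has_derivative_scaleR_left)
    show "((\<lambda>w::real^3. w$1 * w$2 / 2) has_derivative g1) (at w)"
      unfolding g1_def by (auto intro!: derivative_eq_intros vn simp: field_simps)
    show "((\<lambda>w::real^3. sqrt ((w$1)\<^sup>2 - d\<^sup>2) * sqrt (1 - (w$2)\<^sup>2) * cos (w$3) / 2) has_derivative g2) (at w)"
      unfolding g2_def
      by (rule has_derivative_eq_rhs[OF bounded_linear.has_derivative[OF bounded_linear_divide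
            has_derivative_mult[OF has_derivative_mult[OF dA dB] dC]]])
        (simp add: A_def[symmetric] B_def[symmetric] fun_eq_iff algebra_simps)
    show "((\<lambda>w::real^3. sqrt ((w$1)\<^sup>2 - d\<^sup>2) * sqrt (1 - (w$2)\<^sup>2) * sin (w$3) / 2) has_derivative g3) (at w)"
      unfolding g3_def
      by (rule has_derivative_eq_rhs[OF bounded_linear.has_derivative[OF bounded_linear_divide
            has_derivative_mult[OF has_derivative_mult[OF dA dB] dS]]])
        (simp add: A_def[symmetric] B_def[symmetric] fun_eq_iff algebra_simps)
  qed
  moreover have "\<bar>det (matrix g')\<bar> = spheroidal_jac d (tup3 w)"
  proof -
    define c where "c = ?c"
    define s where "s = ?s"
    have cs: "c\<^sup>2 + s\<^sup>2 = 1" by (simp add: c_def s_def)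
    \<comment> \<open>The determinant collapses through
      \<open>v^2 (p^2 - d^2) + p^2 (1 - v^2) = p^2 - d^2 v^2\<close>. Its negative sign means that
      the coordinates reverse orientation.\<close>
    have "det (matrix g') = - (1/8) * (?v\<^sup>2 * A\<^sup>2 + ?p\<^sup>2 * B\<^sup>2) * (c\<^sup>2 + s\<^sup>2)"
      using A(1) B(1)
      by (simp add: det_3 matrix_def g'_def g1_def g2_def g3_def axis_def flip: c_def s_def)
        (simp add: field_simps power2_eq_square)
    also have "\<dots> = - spheroidal_jac d (tup3 w)"
      unfolding cs A B by (simp add: spheroidal_jac_def tup3_def field_simps)
    finally show ?thesis using pos by (simp add: spheroidal_jac_def tup3_def)
  qed
  ultimately show ?thesis using that by blast
qed

lemma spheroidal_image_vec3:
  assumes "d \<ge> 0"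
  shows "negligible (- ((\<lambda>w. vec3 (spheroidal d (tup3 w))) ` (tup3 -` spheroidal_dom d)))"
proof (rule negligible_subset)
  show "negligible {w::real^3. w $ 3 = 0}"
    by (rule negligible_standard_hyperplane_cart)
  show "- ((\<lambda>w. vec3 (spheroidal d (tup3 w))) ` (tup3 -` spheroidal_dom d)) \<subseteq> {w. w $ 3 = 0}"
  proof (rule subsetI, rule ccontr)
    fix w :: "real^3"
    assume w: "w \<in> - ((\<lambda>w. vec3 (spheroidal d (tup3 w))) ` (tup3 -` spheroidal_dom d))" "w \<notin> {w. w $ 3 = 0}"
    then have "tup3 w \<in> spheroidal d ` spheroidal_dom d"
      unfolding tup3_def by (intro spheroidal_image[OF assms]) simp
    then obtain t where t: "t \<in> spheroidal_dom d" "tup3 w = spheroidal d t" by blast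
    have "w = vec3 (spheroidal d (tup3 (vec3 t)))" by (simp flip: t(2))
    then show False using w(1) t(1) by (metis (no_types, lifting) ComplD image_eqI tup3_vec3 vimageI)
  qed
qed

text \<open>Boxes determine \<open>lborel\<close>, and the part of a box reached by the coordinates
  differs from the box by a negligible set. The change of variables is phrased as an identity of
  measures so that integrals, integrability and null sets can all be transported by it.\<close>

lemma distr_spheroidal_vec3:
  assumes d: "d \<ge> 0"
  shows "distr (density lborel (\<lambda>w. ennreal (indicator (spheroidal_dom d) (tup3 w) * spheroidal_jac d (tup3 w))))
    borel (\<lambda>w. vec3 (spheroidal d (tup3 w))) = lborel"
proof (rule lborel_eqI[symmetric])
  fix l u :: "real^3"
  assume le: "\<And>b. b \<in> Basis \<Longrightarrow> l \<bullet> b \<le> u \<bullet> b"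
  let ?g = "\<lambda>w. vec3 (spheroidal d (tup3 w))"
  let ?J = "\<lambda>w. indicator (spheroidal_dom d) (tup3 w) * spheroidal_jac d (tup3 w)"
  have [measurable]: "?g \<in> borel_measurable borel" by measurable
  define S where "S = tup3 -` spheroidal_dom d \<inter> ?g -` box l u"
  have Sb[measurable]: "S \<in> sets borel"
    unfolding S_def using measurable_sets[of tup3 borel borel "spheroidal_dom d"]
      measurable_sets[of ?g borel borel "box l u"] by simp
  have "\<exists>g'. (?g has_derivative g') (at w) \<and> \<bar>det (matrix g')\<bar> = spheroidal_jac d (tup3 w)" if "w \<in> S" for w
    using has_derivative_spheroidal[of w d] that d unfolding S_def by blast
  then obtain g' where g': "\<And>w. w \<in> S \<Longrightarrow> (?g has_derivative g' w) (at w)"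
      "\<And>w. w \<in> S \<Longrightarrow> \<bar>det (matrix (g' w))\<bar> = spheroidal_jac d (tup3 w)"
    by metis
  have SL: "S \<in> sets lebesgue" using Sb by simp
  have inj: "inj_on ?g S"
  proof (rule inj_onI)
    fix w w' assume w: "w \<in> S" "w' \<in> S" "?g w = ?g w'"
    then have "spheroidal d (tup3 w) = spheroidal d (tup3 w')" by (metis tup3_vec3)
    then have "tup3 w = tup3 w'" using inj_onD[OF inj_on_spheroidal[OF d]] w by (auto simp: S_def)
    then show "w = w'" by (metis vec3_tup3)
  qed
  note im = has_measure_differentiable_image[of S ?g g', OF SL has_derivative_at_withinI[OF g'(1)] inj]
  have sub: "?g ` S \<subseteq> box l u" by (auto simp: S_def)
  have neg: "negligible (box l u - ?g ` S)"
    by (rule negligible_subset[OF spheroidal_image_vec3[OF d]]) (auto simp: S_def)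
  have sd: "box l u - ?g ` S \<union> (?g ` S - box l u) = box l u - ?g ` S" using sub by auto
  have "?g ` S \<in> lmeasurable"
    by (rule lmeasurable_negligible_symdiff[of "box l u"]) (simp_all add: sd neg)
  moreover have "measure lebesgue (?g ` S) = measure lebesgue (box l u)"
    by (rule measure_negligible_symdiff) (simp_all add: sd neg)
  ultimately have "((\<lambda>w. \<bar>det (matrix (g' w))\<bar>) has_integral measure lebesgue (box l u)) S"
    by (intro im[THEN iffD1] conjI)
  then have "(spheroidal_jac d \<circ> tup3 has_integral measure lebesgue (box l u)) S"
    by (rule has_integral_eq[rotated]) (simp add: g'(2))
  then have nn: "integral\<^sup>N lborel (\<lambda>w. ennreal ((spheroidal_jac d \<circ> tup3) w) * indicator S w) = ennreal (measure lebesgue (box l u))"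
    by (rule nn_integral_has_integral_lebesgue'[rotated])
      (auto simp: S_def tup3_def spheroidal_jac_def dest!: spheroidal_dom_pos(4)[OF _ d])
  have "emeasure (distr (density lborel ?J) borel ?g) (box l u) = emeasure (density lborel ?J) (?g -` box l u)"
    by (simp add: emeasure_distr)
  also have "\<dots> = (\<integral>\<^sup>+w. ennreal (?J w) * indicator (?g -` box l u) w \<partial>lborel)"
    using measurable_sets[of ?g borel borel "box l u"] by (intro emeasure_density) simp_all
  also have "\<dots> = (\<integral>\<^sup>+w. ennreal ((spheroidal_jac d \<circ> tup3) w) * indicator S w \<partial>lborel)"
    by (rule nn_integral_cong) (auto simp: S_def indicator_def)
  also have "\<dots> = ennreal (measure lebesgue (box l u))" by (rule nn)
  also have "\<dots> = (\<Prod>b\<in>Basis. (u - l) \<bullet> b)"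
    by (subst measure_completion) (simp_all add: measure_lborel_box le)
  finally show "emeasure (distr (density lborel ?J) borel ?g) (box l u) = (\<Prod>b\<in>Basis. (u - l) \<bullet> b)" .
qed simp

lemma distr_spheroidal:
  assumes d: "d \<ge> 0" and e: "orthonormal3 e1 e2 e3"
  shows "distr (density lborel (\<lambda>w. ennreal (indicator (spheroidal_dom d) w * spheroidal_jac d w)))
    borel (\<lambda>w. frame_map c e1 e2 e3 (spheroidal d w)) = lborel" (is "distr (density lborel ?J) _ _ = _")
proof -
  let ?g = "\<lambda>w. vec3 (spheroidal d (tup3 w))"
  let ?J' = "\<lambda>w. ennreal (indicator (spheroidal_dom d) (tup3 w) * spheroidal_jac d (tup3 w))"
  have [measurable]: "?J \<in> borel_measurable borel" "?J' \<in> borel_measurable borel"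
    by (measurable)
  have "density (lborel :: (real^3) measure) ?J' = density (distr lborel borel vec3) ?J'"
    by (simp only: distr_vec3)
  also have "\<dots> = distr (density lborel (\<lambda>w. ?J' (vec3 w))) borel vec3"
    by (rule density_distr) simp_all
  finally have dens: "density (lborel :: (real^3) measure) ?J' = distr (density lborel ?J) borel vec3"
    by simp
  have "lborel = distr (lborel :: (real \<times> real \<times> real) measure) borel (frame_map c e1 e2 e3)"
    by (rule distr_lborel_frame_map[OF e, symmetric])
  also have "(lborel :: (real \<times> real \<times> real) measure) = distr (distr lborel borel vec3) borel tup3"
    by (subst distr_distr) (simp_all add: comp_def, simp add: distr_id2)
  also have "distr lborel borel vec3 = distr (distr (density lborel ?J) borel vec3) borel ?g"
    unfolding distr_vec3 dens[symmetric] by (rule distr_spheroidal_vec3[OF d, symmetric])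
  also have "distr (distr (distr (distr (density lborel ?J) borel vec3) borel ?g) borel tup3) borel (frame_map c e1 e2 e3)
     = distr (density lborel ?J) borel (frame_map c e1 e2 e3 \<circ> (tup3 \<circ> (?g \<circ> vec3)))"
    by (subst distr_distr, measurable)+ (simp add: comp_assoc)
  also have "frame_map c e1 e2 e3 \<circ> (tup3 \<circ> (?g \<circ> vec3)) = (\<lambda>w. frame_map c e1 e2 e3 (spheroidal d w))"
    by (simp add: fun_eq_iff)
  finally show ?thesis ..
qed

section \<open>Means over confocal shells\<close>

definition Qbox :: "(real \<times> real) set" where
  "Qbox = cbox (-1, 0) (1, 2 * pi)"

lemma Qbox_iff: "(v, \<phi>) \<in> Qbox \<longleftrightarrow> -1 \<le> v \<and> v \<le> 1 \<and> 0 \<le> \<phi> \<and> \<phi> \<le> 2 * pi"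
  by (auto simp: Qbox_def cbox_Pair_eq)

lemma compact_Qbox[simp, intro]: "compact Qbox"
  by (simp add: Qbox_def)

lemma Qbox_borel[simp, intro, measurable]: "Qbox \<in> sets borel"
  by (simp add: Qbox_def)

text \<open>The change of variables yields the open angular box, while shell means use the closed
  one, whose compactness gives integrability and continuity in the parameter \<open>p\<close>. The
  two differ by a null set.\<close>

lemma AE_Qbox: "AE w in lborel. indicator Qbox w = (indicator ({-1<..<1} \<times> {0<..<2*pi}) w :: real)"
proof -
  have eq: "{-1<..<1} \<times> {0<..<2*pi} = box (-1::real, 0::real) (1, 2 * pi)"
    by (auto simp: box_def Basis_prod_def)
  have "negligible (Qbox - {-1<..<1} \<times> {0<..<2*pi})"
    unfolding eq Qbox_def by (rule negligible_frontier_interval)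
  moreover have "Qbox - {-1<..<1} \<times> {0<..<2*pi} \<in> sets borel"
    unfolding eq by auto
  ultimately have "Qbox - {-1<..<1} \<times> {0<..<2*pi} \<in> null_sets lborel"
    by (simp add: negligible_iff_null_sets null_sets_completion_iff)
  then have "AE w in lborel. w \<notin> Qbox - {-1<..<1} \<times> {0<..<2*pi}" by (rule AE_not_in)
  then show ?thesis
    by eventually_elim (auto simp: indicator_def Qbox_iff)
qed

lemma set_integrable_Qbox:
  fixes h :: "real \<times> real \<Rightarrow> real"
  assumes "continuous_on Qbox h"
  shows "set_integrable lborel Qbox h" "(LINT w:Qbox|lborel. h w) = integral Qbox h"
proof -
  show "set_integrable lborel Qbox h"
    unfolding set_integrable_def using assms by (intro borel_integrable_compact) auto
  then show "(LINT w:Qbox|lborel. h w) = integral Qbox h"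
    by (rule set_borel_integral_eq_integral)
qed

locale focal_frame =
  fixes x y e1 e2 e3 :: "real^3" and d :: real
  assumes d_nonneg: "d \<ge> 0" and foci: "y - x = d *\<^sub>R e1" and frame: "orthonormal3 e1 e2 e3"
begin

definition Z :: "real \<Rightarrow> real \<times> real \<Rightarrow> real^3" where
  "Z p w = frame_map (x + (d / 2) *\<^sub>R e1) e1 e2 e3 (spheroidal d (p, w))"

text \<open>Not normalised: the total weight is \<open>4 * pi\<close>.\<close>

definition shell_mean :: "(real^3 \<Rightarrow> real) \<Rightarrow> real \<Rightarrow> real" where
  "shell_mean G p = (LINT w:Qbox|lborel. G (Z p w))"

lemma Z_eq: "Z p (v, \<phi>) = x + (d / 2) *\<^sub>R e1 + (p * v / 2) *\<^sub>R e1
    + (sqrt (p\<^sup>2 - d\<^sup>2) * sqrt (1 - v\<^sup>2) / 2) *\<^sub>R (cos \<phi> *\<^sub>R e2 + sin \<phi> *\<^sub>R e3)"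
  by (simp add: Z_def frame_map_def spheroidal_def scaleR_add_right)

lemma continuous_on_Z: "continuous_on S (\<lambda>(p, w). Z p w)"
proof -
  have "continuous_on S (\<lambda>q. frame_map (x + (d / 2) *\<^sub>R e1) e1 e2 e3 (spheroidal d q))"
    unfolding frame_map_def case_prod_unfold
    by (intro continuous_intros continuous_on_spheroidal)
  then show ?thesis by (simp add: Z_def case_prod_unfold)
qed

lemma Z_measurable[measurable]: "Z p \<in> borel_measurable borel"
proof -
  have "continuous_on UNIV ((\<lambda>(p, w). Z p w) \<circ> Pair p)"
    by (intro continuous_on_compose continuous_on_Z continuous_intros)
  then show ?thesis by (intro borel_measurable_continuous_onI) (simp add: comp_def)
qed

lemma Z_measurable2[measurable]: "(\<lambda>(p, w). Z p w) \<in> borel_measurable borel"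
  by (intro borel_measurable_continuous_onI continuous_on_Z)

lemma norm_frame: "(norm (a *\<^sub>R e1 + b *\<^sub>R e2 + c *\<^sub>R e3))\<^sup>2 = a\<^sup>2 + b\<^sup>2 + c\<^sup>2"
  unfolding power2_norm_eq_inner
  by (simp add: inner_add_left inner_add_right orthonormal3_inner[OF frame] power2_eq_square)

lemma norm_Z:
  assumes "p \<ge> d" "w \<in> Qbox"
  shows "norm (Z p w - x) = (p + d * fst w) / 2" "norm (Z p w - y) = (p - d * fst w) / 2"
proof -
  obtain v \<phi> where w: "w = (v, \<phi>)" by (cases w)
  obtain a b c where abc: "spheroidal d (p, v, \<phi>) = (a, b, c)" by (rule prod_cases3)
  have v: "\<bar>v\<bar> \<le> 1" using assms by (auto simp: w Qbox_iff)
  have dom: "(p, v, \<phi>) \<in> {d..} \<times> {-1..1} \<times> UNIV" using assms v by (auto simp: w)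
  have "\<bar>d * v\<bar> \<le> d * 1" unfolding abs_mult using d_nonneg v by (intro mult_mono) auto
  then have dv: "p + d * v \<ge> 0" "p - d * v \<ge> 0" using assms by auto
  have y: "y = x + d *\<^sub>R e1" using foci by (simp add: algebra_simps)
  have "Z p w - x = (a + d / 2) *\<^sub>R e1 + b *\<^sub>R e2 + c *\<^sub>R e3"
    by (simp add: Z_def frame_map_def w abc algebra_simps)
  then have "(norm (Z p w - x))\<^sup>2 = ((p + d * v) / 2)\<^sup>2"
    using spheroidal_foci[OF dom d_nonneg abc] by (simp add: norm_frame)
  then show "norm (Z p w - x) = (p + d * fst w) / 2" using dv by (auto simp: w dest: power2_eq_imp_eq)
  have "Z p w - y = (a + d / 2 - d) *\<^sub>R e1 + b *\<^sub>R e2 + c *\<^sub>R e3"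
    unfolding y scaleR_left_diff_distrib
    by (simp add: Z_def frame_map_def w abc algebra_simps)
  moreover have "a + d / 2 - d = a - d / 2" by simp
  ultimately have "(norm (Z p w - y))\<^sup>2 = ((p - d * v) / 2)\<^sup>2"
    using spheroidal_foci[OF dom d_nonneg abc] by (simp only: norm_frame)
  then show "norm (Z p w - y) = (p - d * fst w) / 2" using dv by (auto simp: w dest: power2_eq_imp_eq)
qed

lemma distr_Z:
  "distr (density lborel (\<lambda>q. ennreal (indicator (spheroidal_dom d) q * spheroidal_jac d q)))
    borel (\<lambda>(p, w). Z p w) = lborel"
  using distr_spheroidal[OF d_nonneg frame, of "x + (d / 2) *\<^sub>R e1"]
  by (simp add: Z_def case_prod_unfold)

lemma jac_nonneg: "indicator (spheroidal_dom d) q * spheroidal_jac d q \<ge> 0"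
  by (cases q) (auto simp: indicator_def spheroidal_jac_def dest!: spheroidal_dom_pos(4)[OF _ d_nonneg])

lemma integral_Z:
  fixes F :: "real^3 \<Rightarrow> real"
  assumes [measurable]: "F \<in> borel_measurable borel"
  defines "h \<equiv> \<lambda>(p, w). indicator (spheroidal_dom d) (p, w) * spheroidal_jac d (p, w) * F (Z p w)"
  shows "integrable lborel F \<longleftrightarrow> integrable lborel h"
    and "(LINT z|lborel. F z) = (LINT q|lborel. h q)"
proof -
  let ?J = "\<lambda>q. indicator (spheroidal_dom d) q * spheroidal_jac d q"
  let ?M = "density lborel (\<lambda>q. ennreal (?J q))"
  have [measurable]: "?J \<in> borel_measurable borel" by measurable
  have FZ[measurable]: "(\<lambda>q. F ((\<lambda>(p, w). Z p w) q)) \<in> borel_measurable borel" by measurable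
  have "integrable lborel F \<longleftrightarrow> integrable (distr ?M borel (\<lambda>(p, w). Z p w)) F"
    unfolding distr_Z ..
  also have "\<dots> \<longleftrightarrow> integrable ?M (\<lambda>q. F ((\<lambda>(p, w). Z p w) q))"
    by (rule integrable_distr_eq) simp_all
  also have "\<dots> \<longleftrightarrow> integrable lborel (\<lambda>q. ?J q *\<^sub>R F ((\<lambda>(p, w). Z p w) q))"
    by (rule integrable_density) (simp_all add: jac_nonneg)
  also have "(\<lambda>q. ?J q *\<^sub>R F ((\<lambda>(p, w). Z p w) q)) = h" by (auto simp: h_def)
  finally show "integrable lborel F \<longleftrightarrow> integrable lborel h" .
  have "(LINT z|lborel. F z) = (LINT z|(distr ?M borel (\<lambda>(p, w). Z p w)). F z)"
    unfolding distr_Z ..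
  also have "\<dots> = (LINT q|?M. F ((\<lambda>(p, w). Z p w) q))"
    by (rule integral_distr) simp_all
  also have "\<dots> = (LINT q|lborel. ?J q *\<^sub>R F ((\<lambda>(p, w). Z p w) q))"
    by (rule integral_density) (simp_all add: jac_nonneg)
  also have "(\<lambda>q. ?J q *\<^sub>R F ((\<lambda>(p, w). Z p w) q)) = h" by (auto simp: h_def)
  finally show "(LINT z|lborel. F z) = (LINT q|lborel. h q)" .
qed

lemma AE_Z:
  assumes [measurable]: "Measurable.pred borel P" and "AE q in lborel. q \<in> spheroidal_dom d \<longrightarrow> P (Z (fst q) (snd q))"
  shows "AE z in lborel. P z"
proof -
  have [measurable]: "(\<lambda>q. ennreal (indicator (spheroidal_dom d) q * spheroidal_jac d q)) \<in> borel_measurable lborel"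
    by measurable
  have "AE q in density lborel (\<lambda>q. ennreal (indicator (spheroidal_dom d) q * spheroidal_jac d q)). P ((\<lambda>(p, w). Z p w) q)"
    unfolding AE_density[OF \<open>_ \<in> borel_measurable lborel\<close>]
    using assms(2) by eventually_elim (auto simp: indicator_def case_prod_unfold split: if_splits)
  then have "AE z in distr (density lborel (\<lambda>q. ennreal (indicator (spheroidal_dom d) q * spheroidal_jac d q)))
    borel (\<lambda>(p, w). Z p w). P z"
    by (subst AE_distr_iff) simp_all
  then show ?thesis unfolding distr_Z .
qed

text \<open>The path length is the coordinate \<open>p\<close>, and a single value of
  \<open>p\<close> is null. Hence ellipsoids have null boundary, which yields continuity of the
  kernel in \<open>y\<close> and its vanishing at the exact arrival time.\<close>

lemma AE_path_length_neq: "AE z in lborel. norm (z - x) + norm (z - y) \<noteq> t"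
proof (rule AE_Z)
  have "AE p in lborel. p \<noteq> t" by (rule AE_lborel_singleton)
  then have "AE q in lborel \<Otimes>\<^sub>M lborel. fst (q :: real \<times> real \<times> real) \<noteq> t"
    by (intro lborel_pair.AE_pair_measure) (measurable, erule eventually_mono, simp)
  then have "AE q in lborel. fst (q :: real \<times> real \<times> real) \<noteq> t" unfolding lborel_prod .
  then show "AE q in lborel. q \<in> spheroidal_dom d \<longrightarrow> norm (Z (fst q) (snd q) - x) + norm (Z (fst q) (snd q) - y) \<noteq> t"
  proof eventually_elim
    case (elim q)
    show ?case
    proof
      assume "q \<in> spheroidal_dom d"
      then have "fst q \<ge> d" "snd q \<in> Qbox" by (auto simp: spheroidal_dom_def Qbox_def cbox_Pair_eq)
      from norm_Z[OF this] elim show "norm (Z (fst q) (snd q) - x) + norm (Z (fst q) (snd q) - y) \<noteq> t"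
        by (simp add: field_simps)
    qed
  qed
qed measurable

lemma shell_integral:
  assumes [measurable]: "G \<in> borel_measurable borel"
    and int: "integrable lborel (\<lambda>z. G z / (norm (z - x) * norm (z - y)))"
  shows "integrable lborel (\<lambda>p. indicator {d<..} p * shell_mean G p)"
    and "(LINT z|lborel. G z / (norm (z - x) * norm (z - y))) = 1/2 * (LINT p|lborel. indicator {d<..} p * shell_mean G p)"
proof -
  let ?F = "\<lambda>z. G z / (norm (z - x) * norm (z - y))"
  let ?h = "\<lambda>q. indicator {d<..} (fst q) * (indicator ({-1<..<1} \<times> {0<..<2*pi}) (snd q) * G (Z (fst q) (snd q)))"
  have [measurable]: "?F \<in> borel_measurable borel" by measurable
  have GZ[measurable]: "(\<lambda>w. G (Z p w)) \<in> borel_measurable borel" for p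
    by (rule measurable_compose[OF Z_measurable assms(1)])
  have h: "indicator (spheroidal_dom d) (p, w) * spheroidal_jac d (p, w) * ?F (Z p w) = 1/2 * ?h (p, w)" for p w
  proof (cases "(p, w) \<in> spheroidal_dom d")
    case True
    then have "p \<ge> d" "w \<in> Qbox" by (auto simp: spheroidal_dom_def Qbox_def cbox_Pair_eq)
    note n = norm_Z[OF this]
    obtain v \<phi> where w: "w = (v, \<phi>)" by (cases w)
    have pos: "p\<^sup>2 - d\<^sup>2 * v\<^sup>2 > 0" using True spheroidal_dom_pos d_nonneg by (auto simp: w)
    have "norm (Z p w - x) * norm (Z p w - y) = (p\<^sup>2 - d\<^sup>2 * v\<^sup>2) / 4"
      unfolding n by (simp add: w field_simps power2_eq_square)
    then have "spheroidal_jac d (p, w) * ?F (Z p w) = 1/2 * G (Z p w)"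
      using pos by (simp only: w spheroidal_jac_def prod.case) (simp add: field_simps)
    then show ?thesis using True by (auto simp: spheroidal_dom_def)
  qed (auto simp: spheroidal_dom_def)
  have h': "(\<lambda>(p, w). indicator (spheroidal_dom d) (p, w) * spheroidal_jac d (p, w) * ?F (Z p w)) = (\<lambda>q. 1/2 * ?h q)"
    by (simp only: h case_prod_unfold prod.collapse)
  have "integrable lborel (\<lambda>q. 2 * (1/2 * ?h q))"
    using int unfolding integral_Z(1)[OF \<open>?F \<in> _\<close>] h' by (rule integrable_mult_right)
  then have ih: "integrable (lborel \<Otimes>\<^sub>M lborel) ?h" by (simp add: lborel_prod)
  have inner: "(LINT w|lborel. ?h (p, w)) = indicator {d<..} p * shell_mean G p" for p
  proof -
    have "(LINT w|lborel. ?h (p, w)) = indicator {d<..} p * (LINT w|lborel. indicator ({-1<..<1} \<times> {0<..<2*pi}) w * G (Z p w))"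
      by simp
    also have "(LINT w|lborel. indicator ({-1<..<1} \<times> {0<..<2*pi}) w * G (Z p w)) = shell_mean G p"
      unfolding shell_mean_def set_lebesgue_integral_def
    proof (rule integral_cong_AE)
      show "AE w in lborel. indicator ({-1<..<1} \<times> {0<..<2*pi}) w * G (Z p w) = indicat_real Qbox w *\<^sub>R G (Z p w)"
        using AE_Qbox by eventually_elim simp
      have "{-1<..<1} \<times> {0<..<2*pi} \<in> sets (borel :: (real \<times> real) measure)"
        by (intro borel_open open_Times) auto
      then show "(\<lambda>w. indicator ({-1<..<1} \<times> {0<..<2*pi}) w * G (Z p w)) \<in> borel_measurable lborel"
        by measurable
    qed measurable
    finally show ?thesis .
  qed
  show "integrable lborel (\<lambda>p. indicator {d<..} p * shell_mean G p)"
    using lborel_pair.integrable_fst'[OF ih] unfolding inner .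
  have "(LINT z|lborel. ?F z) = (LINT q|lborel. 1/2 * ?h q)"
    unfolding integral_Z(2)[OF \<open>?F \<in> _\<close>] h' ..
  also have "\<dots> = 1/2 * (LINT q|(lborel \<Otimes>\<^sub>M lborel). ?h q)" unfolding lborel_prod by simp
  also have "\<dots> = 1/2 * (LINT p|lborel. LINT w|lborel. ?h (p, w))"
    unfolding lborel_pair.integral_fst'[OF ih] ..
  finally show "(LINT z|lborel. ?F z) = 1/2 * (LINT p|lborel. indicator {d<..} p * shell_mean G p)"
    unfolding inner .
qed

end

subsection \<open>Continuity of the kernel\<close>

text \<open>With coincident foci the Jacobian \<open>p^2 / 8\<close> cancels the pole
  \<open>(p / 2)^2\<close>, leaving the constant 1/2 on a bounded set of coordinates.\<close>

lemma integrable_inverse_square_cball: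
  fixes x :: "real^3"
  shows "integrable lborel (\<lambda>z. indicator (cball x R) z / (norm (z - x))\<^sup>2)"
proof -
  have "norm (axis 1 1 :: real^3) = 1" by simp
  from orthonormal3_plane_frame[OF this] obtain e2 e3 :: "real^3" where "orthonormal3 (axis 1 1) e2 e3" by blast
  then interpret focal_frame x x "axis 1 1" e2 e3 0 by unfold_locales simp_all
  have [measurable]: "cball x R \<in> sets borel" by simp
  have meas: "(\<lambda>z. indicator (cball x R) z / (norm (z - x))\<^sup>2) \<in> borel_measurable borel" by measurable
  define B where "B = {0<..2*R} \<times> {-1<..<1::real} \<times> {0<..<2*pi}"
  have Bb: "B \<in> sets borel"
    unfolding B_def by (simp add: borel_prod[symmetric] pair_measureI)
  have "bounded B" unfolding B_def by (intro bounded_Times) auto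
  then have "emeasure lborel B < \<infinity>" by (rule emeasure_bounded_finite)
  then have "integrable lborel (\<lambda>q. 1/2 * indicator B q :: real)"
    using Bb by (intro integrable_mult_right integrable_real_indicator) auto
  moreover have "(\<lambda>(p, w). indicator (spheroidal_dom 0) (p, w) * spheroidal_jac 0 (p, w) *
      (indicator (cball x R) (Z p w) / (norm (Z p w - x))\<^sup>2)) = (\<lambda>q. 1/2 * indicator B q)"
  proof (rule ext, clarify)
    fix p v \<phi> :: real
    show "indicator (spheroidal_dom 0) (p, v, \<phi>) * spheroidal_jac 0 (p, v, \<phi>) *
      (indicator (cball x R) (Z p (v, \<phi>)) / (norm (Z p (v, \<phi>) - x))\<^sup>2) = 1/2 * indicator B (p, v, \<phi>)"
    proof (cases "(p, v, \<phi>) \<in> spheroidal_dom 0")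
      case True
      then have p: "p > 0" and "(v, \<phi>) \<in> Qbox" by (auto simp: spheroidal_dom_def Qbox_iff)
      with norm_Z(1)[of p "(v, \<phi>)"] have n: "norm (Z p (v, \<phi>) - x) = p / 2" by simp
      then have "Z p (v, \<phi>) \<in> cball x R \<longleftrightarrow> p \<le> 2 * R" by (simp add: dist_norm norm_minus_commute) linarith
      then have "indicator (cball x R) (Z p (v, \<phi>)) = (indicator B (p, v, \<phi>) :: real)"
        using True by (auto simp: indicator_def B_def spheroidal_dom_def)
      then show ?thesis using True p unfolding n by (simp add: spheroidal_jac_def power2_eq_square)
    qed (auto simp: spheroidal_dom_def B_def indicator_def)
  qed
  ultimately show ?thesis using integral_Z(1)[OF meas] by simp
qed

text \<open>Common majorant, up to constants, of all kernel integrands; inverse squares are locally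
  integrable in dimension three.\<close>

definition poles :: "real^3 \<Rightarrow> real^3 \<Rightarrow> real^3 \<Rightarrow> real" where
  "poles x y z = 1 / (norm (z - x))\<^sup>2 + 1 / (norm (z - y))\<^sup>2"

lemma bounded_imp_subset_cball: "bounded S \<Longrightarrow> \<exists>R. S \<subseteq> cball a R"
  unfolding bounded_any_center[where a = a] by (auto simp: subset_iff)

lemma integrable_two_poles:
  fixes x y :: "real^3" and F :: "real^3 \<Rightarrow> real"
  assumes F: "F \<in> borel_measurable borel"
    and bd: "\<And>z. z \<noteq> x \<Longrightarrow> z \<noteq> y \<Longrightarrow> \<bar>F z\<bar> \<le> C * poles x y z"
    and S: "bounded S" "\<And>z. z \<notin> S \<Longrightarrow> F z = 0"
  shows "integrable lborel F"
proof -
  obtain R where R: "S \<subseteq> cball x R" using bounded_imp_subset_cball[OF S(1)] by blast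
  obtain R' where R': "S \<subseteq> cball y R'" using bounded_imp_subset_cball[OF S(1)] by blast
  let ?g = "\<lambda>z. C * (indicator (cball x R) z / (norm (z - x))\<^sup>2 + indicator (cball y R') z / (norm (z - y))\<^sup>2)"
  have "integrable lborel ?g"
    by (intro integrable_mult_right Bochner_Integration.integrable_add integrable_inverse_square_cball)
  moreover have "AE z in lborel. norm (F z) \<le> norm (?g z)"
    using AE_lborel_singleton[of x] AE_lborel_singleton[of y]
  proof eventually_elim
    case (elim z)
    show ?case
    proof (cases "z \<in> S")
      case True
      then have "z \<in> cball x R" "z \<in> cball y R'" using R R' by auto
      then show ?thesis using bd[OF elim] by (simp add: indicator_def poles_def)
    qed (simp add: S)
  qed
  ultimately show ?thesis using F by (intro Bochner_Integration.integrable_bound[of lborel ?g F]) auto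
qed

lemma inverse_le_poles:
  assumes "z \<noteq> x" "z \<noteq> y"
  shows "1 / (norm (z - x) * norm (z - y)) \<le> poles x y z"
proof -
  let ?a = "norm (z - x)" and ?b = "norm (z - y)"
  have "0 \<le> (1 / ?a - 1 / ?b)\<^sup>2 + (1 / ?a)\<^sup>2 + (1 / ?b)\<^sup>2" by simp
  then show ?thesis using assms by (simp add: poles_def power2_eq_square field_simps)
qed

text \<open>One of the two distances is at least \<open>d / 2\<close>. Bounding that factor leaves
  either a double pole at \<open>y\<close> or a product of simple poles.\<close>

lemma inverse_square_le_poles:
  assumes "z \<noteq> x" "z \<noteq> y" "norm (z - x) + norm (z - y) \<ge> d" "d > 0"
  shows "1 / (norm (z - x) * (norm (z - y))\<^sup>2) \<le> 2 / d * poles x y z"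
proof (cases "norm (z - x) \<ge> d / 2")
  case True
  then have "1 / norm (z - x) \<le> 2 / d" using assms by (simp add: field_simps)
  then have "1 / norm (z - x) * (1 / (norm (z - y))\<^sup>2) \<le> 2 / d * poles x y z"
    using assms by (intro mult_mono) (auto simp: poles_def)
  then show ?thesis by simp
next
  case False
  then have "1 / norm (z - y) \<le> 2 / d" using assms by (simp add: field_simps)
  then have "1 / norm (z - y) * (1 / (norm (z - x) * norm (z - y))) \<le> 2 / d * poles x y z"
    using assms by (intro mult_mono inverse_le_poles) auto
  then show ?thesis by (simp add: power2_eq_square mult_ac)
qed

text \<open>The integrand is split by the weights \<open>|z - y|^2\<close> and \<open>|z - x|^2\<close>, normalised to sum 1, each of which
  cancels one pole. The part with the moving pole \<open>y\<close> is translated so that the pole sits at 0; then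
  dominated convergence applies to both parts.\<close>

lemma isCont_integral_moving_pole:
  fixes x y0 :: "real^3" and H :: "real^3 \<Rightarrow> real^3 \<Rightarrow> real"
  assumes U: "open U" "y0 \<in> U" "x \<notin> U" and C: "C \<ge> 0"
    and meas: "\<And>y. y \<in> U \<Longrightarrow> H y \<in> borel_measurable borel"
    and bd: "\<And>y z. y \<in> U \<Longrightarrow> z \<noteq> x \<Longrightarrow> z \<noteq> y \<Longrightarrow> \<bar>H y z\<bar> \<le> C * poles x y z"
    and S: "bounded S" "\<And>y z. y \<in> U \<Longrightarrow> z \<notin> S \<Longrightarrow> H y z = 0"
    and N: "N \<in> null_sets lborel" and cont: "\<And>z. z \<notin> N \<Longrightarrow> isCont (\<lambda>q. H (fst q) (snd q)) (y0, z)"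
  shows "isCont (\<lambda>y. LINT z|lborel. H y z) y0"
proof -
  \<comment> \<open>Boundedness keeps all translated supports, the differences \<open>z - y\<close>
    with \<open>z\<close> in \<open>S\<close> and \<open>y\<close> in \<open>U'\<close>, inside one
    ball \<open>cball 0 R2\<close>, so a single majorant works.\<close>
  obtain U' where U': "bounded U'" "open U'" "y0 \<in> U'" "U' \<subseteq> U"
    using U open_contains_ball by (metis bounded_ball centre_in_ball open_ball)
  define w1 where "w1 y z = (norm (z - y))\<^sup>2 / ((norm (z - x))\<^sup>2 + (norm (z - y))\<^sup>2)" for y z :: "real^3"
  define w2 where "w2 y z = (norm (z - x))\<^sup>2 / ((norm (z - x))\<^sup>2 + (norm (z - y))\<^sup>2)" for y z :: "real^3"
  obtain R1 where R1: "S \<subseteq> cball x R1" using bounded_imp_subset_cball[OF S(1)] by blast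
  have "bounded ((\<lambda>(z, y). z - y) ` (S \<times> U'))"
    using bounded_minus_comp[of fst "S \<times> U'" snd] S(1) U'(1) by (simp add: case_prod_unfold bounded_Times)
  from bounded_imp_subset_cball[OF this] obtain R2
    where R2: "(\<lambda>(z, y). z - y) ` (S \<times> U') \<subseteq> cball 0 R2" by blast
  have [measurable]: "w1 y \<in> borel_measurable borel" "w2 y \<in> borel_measurable borel" for y
    unfolding w1_def w2_def by measurable
  have wpos: "(norm (z - x))\<^sup>2 + (norm (z - y))\<^sup>2 > 0" if "y \<in> U" for y z
    using that U(3) by (metis add_pos_nonneg add_nonneg_pos eq_iff_diff_eq_0 zero_le_power2 zero_less_norm_iff zero_less_power)
  have wsum: "w1 y z + w2 y z = 1" if "y \<in> U" for y z
  proof -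
    have "x \<noteq> y" using that U(3) by auto
    then show ?thesis
      using wpos[OF that, of z] by (simp add: w1_def w2_def add_divide_distrib[symmetric] add.commute)
  qed
  \<comment> \<open>The weight turns the two-pole bound into a single pole with the same constant
    \<open>C\<close>.\<close>
  have key: "C * (1 / A\<^sup>2 + 1 / B\<^sup>2) * (B\<^sup>2 / (A\<^sup>2 + B\<^sup>2)) = C / A\<^sup>2" if "A > 0" "B > 0" for A B :: real
  proof -
    have "A\<^sup>2 + B\<^sup>2 > 0" using that by (simp add: add_pos_pos)
    moreover have "1 / A\<^sup>2 + 1 / B\<^sup>2 = (A\<^sup>2 + B\<^sup>2) / (A\<^sup>2 * B\<^sup>2)" using that by (simp add: field_simps)
    ultimately show ?thesis using that by simp
  qed
  have b1: "\<bar>H y z * w1 y z\<bar> \<le> C * (indicator (cball x R1) z / (norm (z - x))\<^sup>2)"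
    if "y \<in> U" "z \<noteq> x" "z \<noteq> y" for y z
  proof (cases "z \<in> S")
    case True
    have "\<bar>H y z * w1 y z\<bar> = \<bar>H y z\<bar> * w1 y z" by (simp add: abs_mult w1_def)
    also have "\<dots> \<le> C * poles x y z * w1 y z"
      using bd[OF that] by (intro mult_right_mono) (auto simp: w1_def)
    also have "\<dots> = C / (norm (z - x))\<^sup>2" unfolding w1_def poles_def using that by (intro key) auto
    finally show ?thesis using True R1 by (auto simp: indicator_def)
  qed (use S(2)[OF that(1)] C in simp)
  have b2: "\<bar>H y (y + w) * w2 y (y + w)\<bar> \<le> C * (indicator (cball 0 R2) w / (norm (w - 0))\<^sup>2)"
    if "y \<in> U'" "w \<noteq> 0" "y + w \<noteq> x" for y w
  proof (cases "y + w \<in> S")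
    case True
    have yU: "y \<in> U" using that U' by auto
    have "\<bar>H y (y + w) * w2 y (y + w)\<bar> = \<bar>H y (y + w)\<bar> * w2 y (y + w)" by (simp add: abs_mult w2_def)
    also have "\<dots> \<le> C * poles x y (y + w) * w2 y (y + w)"
      using bd[OF yU, of "y + w"] that by (intro mult_right_mono) (auto simp: w2_def)
    also have "\<dots> = C / (norm w)\<^sup>2" using key[of "norm w" "norm (y + w - x)"] that
      by (simp add: w2_def poles_def add.commute)
    finally show ?thesis using True R2 \<open>y \<in> U'\<close> by (force simp: indicator_def)
  qed (use S(2)[of y] that U' C in auto)
  have int1: "integrable lborel (\<lambda>z. C * (indicator (cball x R1) z / (norm (z - x))\<^sup>2))"
    by (intro integrable_mult_right integrable_inverse_square_cball)
  have int2: "integrable lborel (\<lambda>z. C * (indicator (cball 0 R2) z / (norm (z - 0 :: real^3))\<^sup>2))"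
    by (intro integrable_mult_right integrable_inverse_square_cball)
  have ii: "integrable lborel (H y)" if "y \<in> U" for y
    using meas[OF that] bd[OF that] S(1) S(2)[OF that] by (rule integrable_two_poles)
  have split: "(LINT z|lborel. H y z) = (LINT z|lborel. H y z * w1 y z) + (LINT w|lborel. H y (y + w) * w2 y (y + w))"
    if "y \<in> U" for y
  proof -
    note [measurable] = meas[OF that]
    have w01: "\<bar>w1 y z\<bar> \<le> 1" "\<bar>w2 y z\<bar> \<le> 1" for z
      using wpos[OF that, of z] by (auto simp: w1_def w2_def divide_le_eq_1)
    have i1: "integrable lborel (\<lambda>z. H y z * w1 y z)"
      by (rule Bochner_Integration.integrable_bound[OF ii[OF that]])
        (auto simp: abs_mult w01 intro!: mult_left_le)
    have i2: "integrable lborel (\<lambda>z. H y z * w2 y z)"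
      by (rule Bochner_Integration.integrable_bound[OF ii[OF that]])
        (auto simp: abs_mult w01 intro!: mult_left_le)
    have "(LINT w|lborel. H y (y + w) * w2 y (y + w)) = (LINT z|(distr lborel borel ((+) y)). H y z * w2 y z)"
      by (subst integral_distr) simp_all
    also have "\<dots> = (LINT z|lborel. H y z * w2 y z)" unfolding lborel_distr_plus ..
    finally show ?thesis using i1 i2 wsum[OF that]
      by (simp flip: Bochner_Integration.integral_add distrib_left)
  qed
  have w1c: "isCont (\<lambda>q. w1 (fst q) (snd q)) (y0, z)" for z
    unfolding w1_def using wpos[OF U(2), of z] by (intro continuous_intros) auto
  have w2c: "isCont (\<lambda>q. w2 (fst q) (snd q)) (y0, z)" for z
    unfolding w2_def using wpos[OF U(2), of z] by (intro continuous_intros) auto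
  have "continuous (at y0 within U') (\<lambda>y. LINT z|lborel. H y z)"
    unfolding continuous_within_sequentially
  proof (intro allI impI, elim conjE)
    fix Y :: "nat \<Rightarrow> real^3" assume Y: "\<forall>n. Y n \<in> U'" "Y \<longlonglongrightarrow> y0"
    then have YU: "Y n \<in> U" for n using U' by auto
    have 1: "(\<lambda>n. LINT z|lborel. H (Y n) z * w1 (Y n) z) \<longlonglongrightarrow> (LINT z|lborel. H y0 z * w1 y0 z)"
    proof (rule integral_dominated_convergence[OF _ _ int1])
      show "(\<lambda>z. H y0 z * w1 y0 z) \<in> borel_measurable lborel" using meas[OF U(2)] by simp
      show "(\<lambda>z. H (Y n) z * w1 (Y n) z) \<in> borel_measurable lborel" for n using meas[OF YU] by simp
      show "AE z in lborel. (\<lambda>n. H (Y n) z * w1 (Y n) z) \<longlonglongrightarrow> H y0 z * w1 y0 z"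
        using AE_not_in[OF N]
      proof eventually_elim
        case (elim z)
        have "isCont (\<lambda>q. H (fst q) (snd q) * w1 (fst q) (snd q)) (y0, z)"
          by (intro continuous_intros cont elim w1c)
        moreover have "(\<lambda>n. (Y n, z)) \<longlonglongrightarrow> (y0, z)" by (intro tendsto_intros Y)
        ultimately show ?case using isCont_tendsto_compose by fastforce
      qed
      show "AE z in lborel. norm (H (Y n) z * w1 (Y n) z) \<le> C * (indicator (cball x R1) z / (norm (z - x))\<^sup>2)" for n
        using AE_lborel_singleton[of x] AE_lborel_singleton[of "Y n"]
        by eventually_elim (use b1[OF YU] in auto)
    qed
    have 2: "(\<lambda>n. LINT w|lborel. H (Y n) (Y n + w) * w2 (Y n) (Y n + w)) \<longlonglongrightarrow> (LINT w|lborel. H y0 (y0 + w) * w2 y0 (y0 + w))"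
    proof (rule integral_dominated_convergence[OF _ _ int2])
      have m: "(\<lambda>w. H y (y + w) * w2 y (y + w)) \<in> borel_measurable lborel" if "y \<in> U" for y
      proof -
        note [measurable] = meas[OF that]
        show ?thesis by measurable
      qed
      show "(\<lambda>w. H y0 (y0 + w) * w2 y0 (y0 + w)) \<in> borel_measurable lborel" by (rule m[OF U(2)])
      show "(\<lambda>w. H (Y n) (Y n + w) * w2 (Y n) (Y n + w)) \<in> borel_measurable lborel" for n by (rule m[OF YU])
      have "{w. w - (- y0) \<in> N} \<in> null_sets lborel" by (rule null_sets_translation[OF N])
      then have "AE w in lborel. w \<notin> {w. w - (- y0) \<in> N}" by (rule AE_not_in)
      then show "AE w in lborel. (\<lambda>n. H (Y n) (Y n + w) * w2 (Y n) (Y n + w)) \<longlonglongrightarrow> H y0 (y0 + w) * w2 y0 (y0 + w)"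
      proof eventually_elim
        case (elim w)
        then have "y0 + w \<notin> N" by (simp add: add.commute)
        then have "isCont (\<lambda>q. H (fst q) (snd q) * w2 (fst q) (snd q)) (y0, y0 + w)"
          by (intro continuous_intros cont w2c)
        moreover have "(\<lambda>n. (Y n, Y n + w)) \<longlonglongrightarrow> (y0, y0 + w)" by (intro tendsto_intros Y)
        ultimately show ?case using isCont_tendsto_compose by fastforce
      qed
      show "AE w in lborel. norm (H (Y n) (Y n + w) * w2 (Y n) (Y n + w)) \<le> C * (indicator (cball 0 R2) w / (norm (w - 0))\<^sup>2)" for n
        using AE_lborel_singleton[of 0] AE_lborel_singleton[of "x - Y n"]
      proof eventually_elim
        case (elim w)
        then have "Y n + w \<noteq> x" by auto
        with elim b2[of "Y n" w] Y(1) show ?case by simp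
      qed
    qed
    show "((\<lambda>y. LINT z|lborel. H y z) \<circ> Y) \<longlonglongrightarrow> (LINT z|lborel. H y0 z)"
      using tendsto_add[OF 1 2] by (simp add: comp_def split[OF YU] split[OF U(2)])
  qed
  then show ?thesis using U'(2,3) continuous_within_open by blast
qed

section \<open>Gradients of compactly supported functions and the weights of the kernel
  integrals\<close>

lemma C1_has_derivative:
  assumes "g \<in> C1"
  shows "(g has_derivative (\<lambda>h. grad g z \<bullet> h)) (at z)"
proof -
  have "g differentiable at z" using assms by (simp add: C1_def)
  then have fd: "(g has_derivative frechet_derivative g (at z)) (at z)" by (simp add: frechet_derivative_works)
  then have lin: "linear (frechet_derivative g (at z))" by (rule has_derivative_linear)
  have "frechet_derivative g (at z) h = grad g z \<bullet> h" for h
  proof -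
    have h: "h = (h$1) *\<^sub>R axis 1 1 + (h$2) *\<^sub>R axis 2 1 + (h$3) *\<^sub>R axis 3 1"
      by (auto simp: vec_eq_iff forall_3 axis_def)
    have "frechet_derivative g (at z) h = (h$1) * partial 1 g z + (h$2) * partial 2 g z + (h$3) * partial 3 g z"
      by (subst h) (simp add: linear_add[OF lin] linear_cmul[OF lin] partial_def)
    then show ?thesis by (simp add: grad_def inner_vec_def sum_3 mult.commute)
  qed
  then have "frechet_derivative g (at z) = (\<lambda>h. grad g z \<bullet> h)" by (rule ext)
  then show ?thesis using fd by metis
qed

lemma C1_continuous: "g \<in> C1 \<Longrightarrow> continuous_on S g"
  by (auto intro!: continuous_at_imp_continuous_on has_derivative_continuous C1_has_derivative)

lemma grad_continuous: "g \<in> C1 \<Longrightarrow> continuous_on S (grad g)"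
  unfolding grad_def by (intro continuous_on_vec_lambda) (auto simp: C1_def intro: continuous_on_subset)

lemma grad_eq_0:
  assumes "z \<notin> supp g"
  shows "grad g z = 0"
proof -
  have "open (- supp g)" unfolding supp_def by (intro open_Compl closed_closure)
  moreover have "((\<lambda>_. 0) has_derivative (\<lambda>_. 0)) (at z)" by simp
  ultimately have "(g has_derivative (\<lambda>_. 0)) (at z)"
    using assms by (rule_tac has_derivative_transform_within_open[of "\<lambda>_. 0" _ z UNIV "- supp g"]) (auto simp: supp_zero)
  then have "frechet_derivative g (at z) = (\<lambda>_. 0)" by (rule frechet_derivative_at[symmetric])
  then show ?thesis by (simp add: grad_def partial_def vec_eq_iff)
qed

lemma bounded_compact_support:
  fixes h :: "real^3 \<Rightarrow> 'b::real_normed_vector"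
  assumes "continuous_on UNIV h" "compact S" "\<And>z. z \<notin> S \<Longrightarrow> h z = 0"
  obtains M where "M \<ge> 0" "\<And>z. norm (h z) \<le> M"
proof -
  have "compact (h ` S)" using assms by (intro compact_continuous_image) (auto intro: continuous_on_subset)
  then obtain M where M: "\<And>v. v \<in> h ` S \<Longrightarrow> norm v \<le> M" using compact_imp_bounded bounded_iff by metis
  show ?thesis
  proof (rule that[of "max 0 M"])
    show "norm (h z) \<le> max 0 M" for z
      using M[of "h z"] assms(3)[of z] by (cases "z \<in> S") auto
  qed simp
qed

lemma abs_inner_direction_le:
  fixes v w :: "real^3"
  assumes "norm v \<le> Mb"
  shows "\<bar>v \<bullet> (w /\<^sub>R norm w)\<bar> \<le> Mb"
proof -
  have "\<bar>v \<bullet> (w /\<^sub>R norm w)\<bar> \<le> norm v * norm (w /\<^sub>R norm w)"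
    by (rule Cauchy_Schwarz_ineq2)
  also have "norm (w /\<^sub>R norm w) \<le> 1" by (cases "w = 0") auto
  then have "norm v * norm (w /\<^sub>R norm w) \<le> norm v * 1" by (intro mult_left_mono) auto
  finally show ?thesis using assms by simp
qed

lemma focal_frame_exists:
  fixes x y :: "real^3"
  assumes "x \<noteq> y"
  obtains e1 e2 e3 where "focal_frame x y e1 e2 e3 (norm (y - x))"
proof -
  let ?e = "(y - x) /\<^sub>R norm (y - x)"
  have "norm ?e = 1" using assms by simp
  from orthonormal3_plane_frame[OF this] show ?thesis
    using assms by (intro that[of ?e "plane_frame ?e" "cross3 ?e (plane_frame ?e)"]) (simp add: focal_frame_def)
qed

lemma ellipsoid_borel[measurable]: "ellipsoid t x y \<in> sets borel"
  unfolding ellipsoid_def by (intro borel_closed closed_Collect_le continuous_intros)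

text \<open>Off the null boundary the indicator of the ellipsoid is locally constant jointly in
  \<open>(y, z)\<close>, so only the integrand itself matters. The bound is demanded for
  \<open>y\<close> at least half as far from \<open>x\<close> as \<open>y0\<close>, because the pole
  estimates degenerate as the foci merge.\<close>

lemma isCont_ellipsoid_integral:
  fixes T :: "real^3 \<Rightarrow> real^3 \<Rightarrow> real"
  assumes xy: "x \<noteq> y0" and C: "C \<ge> 0"
    and meas: "\<And>y. T y \<in> borel_measurable borel"
    and bd: "\<And>y z. norm (y - x) \<ge> norm (y0 - x) / 2 \<Longrightarrow> z \<in> ellipsoid t x y \<Longrightarrow> z \<noteq> x \<Longrightarrow> z \<noteq> y \<Longrightarrow>
      \<bar>T y z\<bar> \<le> C * poles x y z"
    and S: "bounded S" "\<And>y z. z \<notin> S \<Longrightarrow> T y z = 0"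
    and cont: "\<And>z. z \<noteq> x \<Longrightarrow> z \<noteq> y0 \<Longrightarrow> isCont (\<lambda>q. T (fst q) (snd q)) (y0, z)"
  shows "isCont (\<lambda>y. LINT z:ellipsoid t x y|lborel. T y z) y0"
  unfolding set_lebesgue_integral_def
proof (rule isCont_integral_moving_pole[where x = x and U = "ball y0 (norm (y0 - x) / 2)" and C = C
      and N = "{z. norm (z - x) + norm (z - y0) = t} \<union> {x, y0}" and S = S])
  have d: "norm (y0 - x) > 0" using xy by simp
  show "y0 \<in> ball y0 (norm (y0 - x) / 2)" using d by simp
  show "x \<notin> ball y0 (norm (y0 - x) / 2)" using d by (simp add: dist_norm)
  show "(\<lambda>z. indicator (ellipsoid t x y) z *\<^sub>R T y z) \<in> borel_measurable borel" for y
  proof -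
    note [measurable] = meas[of y]
    show ?thesis by measurable
  qed
  show "\<bar>indicator (ellipsoid t x y) z *\<^sub>R T y z\<bar> \<le> C * poles x y z"
    if "y \<in> ball y0 (norm (y0 - x) / 2)" "z \<noteq> x" "z \<noteq> y" for y z
  proof (cases "z \<in> ellipsoid t x y")
    case True
    have "norm (y0 - x) \<le> norm (y0 - y) + norm (y - x)" using norm_triangle_ineq[of "y0 - y" "y - x"] by simp
    then have "norm (y - x) \<ge> norm (y0 - x) / 2" using that(1) by (simp add: dist_norm)
    from bd[OF this True that(2,3)] show ?thesis using True by simp
  qed (use C in \<open>simp add: poles_def\<close>)
  show "indicator (ellipsoid t x y) z *\<^sub>R T y z = 0" if "z \<notin> S" for y z using S(2)[OF that] by simp
  obtain e1 e2 e3 where "focal_frame x y0 e1 e2 e3 (norm (y0 - x))" using focal_frame_exists[OF xy] .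
  then interpret focal_frame x y0 e1 e2 e3 "norm (y0 - x)" .
  have "{z. norm (z - x) + norm (z - y0) = t} \<in> sets lborel"
    unfolding sets_lborel by (intro borel_closed closed_Collect_eq continuous_intros)
  then have "{z. norm (z - x) + norm (z - y0) = t} \<in> null_sets lborel"
    by (rule AE_iff_null_sets[THEN iffD2]) (use AE_path_length_neq[of t] in simp)
  moreover have "{x, y0} \<in> null_sets lborel" by (intro finite_imp_null_set_lborel) simp
  ultimately show "{z. norm (z - x) + norm (z - y0) = t} \<union> {x, y0} \<in> null_sets lborel" by (rule null_sets.Un)
  show "isCont (\<lambda>q. indicator (ellipsoid t x (fst q)) (snd q) *\<^sub>R T (fst q) (snd q)) (y0, z)"
    if z: "z \<notin> {z. norm (z - x) + norm (z - y0) = t} \<union> {x, y0}" for z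
  proof -
    have cT: "isCont (\<lambda>q. T (fst q) (snd q)) (y0, z)" using z by (intro cont) auto
    let ?n = "\<lambda>q. norm (snd q - x) + norm (snd q - fst q)"
    have cn: "continuous_on UNIV ?n" by (intro continuous_intros)
    consider "?n (y0, z) < t" | "?n (y0, z) > t" using z by fastforce
    then show ?thesis
    proof cases
      case 1
      have "open {q. ?n q < t}" by (intro open_Collect_less cn continuous_intros)
      from eventually_nhds_in_open[OF this, of "(y0, z)"] 1
      have "\<forall>\<^sub>F q in nhds (y0, z). ?n q < t" by simp
      then have "\<forall>\<^sub>F q in nhds (y0, z). indicator (ellipsoid t x (fst q)) (snd q) *\<^sub>R T (fst q) (snd q) = T (fst q) (snd q)"
        by eventually_elim (auto simp: ellipsoid_def)
      from isCont_cong[OF this] show ?thesis using cT by (rule iffD2)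
    next
      case 2
      have "open {q. ?n q > t}" by (intro open_Collect_less cn continuous_intros)
      from eventually_nhds_in_open[OF this, of "(y0, z)"] 2
      have "\<forall>\<^sub>F q in nhds (y0, z). ?n q > t" by simp
      then have "\<forall>\<^sub>F q in nhds (y0, z). indicator (ellipsoid t x (fst q)) (snd q) *\<^sub>R T (fst q) (snd q) = 0"
        by eventually_elim (auto simp: ellipsoid_def)
      from isCont_cong[OF this] show ?thesis by (rule iffD2) simp
    qed
  qed
qed (use C S in auto)

text \<open>Derivative of \<rho> along the ray issuing from \<open>y\<close>. It is bounded but in
  general has no limit at \<open>z = y\<close>, where division by zero sets it to 0.\<close>

definition radial :: "(real^3 \<Rightarrow> real) \<Rightarrow> real^3 \<Rightarrow> real^3 \<Rightarrow> real" where
  "radial \<rho> y z = grad \<rho> z \<bullet> ((z - y) /\<^sub>R norm (z - y))"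

lemma radial_eq_0: "z \<notin> supp \<rho> \<Longrightarrow> radial \<rho> y z = 0"
  by (simp add: radial_def grad_eq_0)

lemma radial_borel: "\<rho> \<in> C1 \<Longrightarrow> radial \<rho> y \<in> borel_measurable borel"
proof -
  assume "\<rho> \<in> C1"
  then have [measurable]: "grad \<rho> \<in> borel_measurable borel"
    by (intro borel_measurable_continuous_onI grad_continuous)
  show ?thesis unfolding radial_def[abs_def] by measurable
qed

lemma radial_bounded:
  assumes "\<rho> \<in> C1" "compact (supp \<rho>)"
  obtains B where "B \<ge> 0" "\<And>y z. \<bar>radial \<rho> y z\<bar> \<le> B"
proof -
  obtain B where B: "B \<ge> 0" "\<And>z. norm (grad \<rho> z) \<le> B"
    using bounded_compact_support[OF grad_continuous[OF assms(1)] assms(2) grad_eq_0[of _ \<rho>]] by metis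
  have "\<bar>radial \<rho> y z\<bar> \<le> B" for y z
    unfolding radial_def by (rule abs_inner_direction_le[OF B(2)])
  then show ?thesis using that[OF B(1)] by blast
qed

lemma radial_isCont:
  assumes "\<rho> \<in> C1" "z \<noteq> y"
  shows "isCont (\<lambda>q. radial \<rho> (fst q) (snd q)) (y, z)"
proof -
  have cg: "isCont (grad \<rho>) z" for z
    using grad_continuous[OF assms(1), of UNIV] continuous_on_eq_continuous_at by blast
  have "isCont (\<lambda>q. grad \<rho> (snd q)) (y, z)"
    by (rule isCont_o2[OF _ cg]) (intro continuous_intros)
  then show ?thesis unfolding radial_def using assms(2) by (intro continuous_intros) auto
qed

text \<open>\<open>k\<close> counts the inverse powers of the distance to \<open>y\<close>,
  \<open>j\<close> is the order of the time weight. The kernel uses the pairs \<open>(k, j)\<close>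
  equal to (1, 0), (1, 1) and (2, 2).\<close>

definition ellipsoid_integral :: "nat \<Rightarrow> nat \<Rightarrow> (real^3 \<Rightarrow> real) \<Rightarrow> real \<Rightarrow> real^3 \<Rightarrow> real^3 \<Rightarrow> real" where
  "ellipsoid_integral k j g t x y = (LINT z:ellipsoid t x y|lborel.
     (t - norm (z - x) - norm (z - y)) ^ j * g z / (norm (z - x) * norm (z - y) ^ k))"

text \<open>With the maximum, the formula also holds before the first arrival, where the ellipsoid is empty.\<close>

lemma K_ellipsoid_integrals:
  assumes "x \<noteq> y"
  shows "K \<epsilon> \<alpha> \<rho> t x y = (max 0 (t - norm (y - x)))\<^sup>2 / (8 * pi * norm (y - x)) * (1 - \<epsilon> * \<alpha> y)
     + \<epsilon> / (16 * pi\<^sup>2) * ellipsoid_integral 1 0 \<alpha> t x y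
     + \<epsilon> / (16 * pi\<^sup>2) * ellipsoid_integral 1 1 (radial \<rho> y) t x y
     + \<epsilon> / (32 * pi\<^sup>2) * ellipsoid_integral 2 2 (radial \<rho> y) t x y"
proof (cases "t < norm (y - x)")
  case True
  have "norm (y - x) \<le> norm (z - x) + norm (z - y)" for z
    using norm_triangle_ineq[of "z - x" "y - z"] by (simp add: norm_minus_commute)
  then have "\<not> norm (z - x) + norm (z - y) \<le> t" for z using True by (meson less_le_trans not_le)
  then have "ellipsoid t x y = {}" by (simp add: ellipsoid_def)
  then show ?thesis using True by (simp add: K_def ellipsoid_integral_def set_lebesgue_integral_def)
next
  case False
  then show ?thesis
    unfolding K_def ellipsoid_integral_def radial_def[symmetric] set_integral_mult_right[symmetric]
    by (simp add: mult_ac)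
qed

lemma isCont_ellipsoid_integral_weight:
  assumes xy: "x \<noteq> y0" and t: "t \<ge> 0" and k: "k = 1 \<or> k = 2"
    and g: "\<And>y. g y \<in> borel_measurable borel" "\<And>y z. \<bar>g y z\<bar> \<le> B" "bounded S" "\<And>y z. z \<notin> S \<Longrightarrow> g y z = 0"
    and cont: "\<And>z. z \<noteq> y0 \<Longrightarrow> isCont (\<lambda>q. g (fst q) (snd q)) (y0, z)"
  shows "isCont (\<lambda>y. ellipsoid_integral k j (g y) t x y) y0"
  unfolding ellipsoid_integral_def
proof (rule isCont_ellipsoid_integral[OF xy _ _ _ g(3)])
  define \<delta> where "\<delta> = norm (y0 - x) / 2"
  have \<delta>: "\<delta> > 0" using xy by (simp add: \<delta>_def)
  have B: "B \<ge> 0" using g(2)[of undefined undefined] by linarith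
  \<comment> \<open>The factor \<open>1 + 2 / \<delta>\<close> serves both exponents: 1 comes from
    \<open>inverse_le_poles\<close>, \<open>2 / \<delta>\<close> from
    \<open>inverse_square_le_poles\<close>.\<close>
  show "t ^ j * B * (1 + 2 / \<delta>) \<ge> 0" using t B \<delta> by simp
  fix y z assume y: "norm (y - x) \<ge> norm (y0 - x) / 2" and e: "z \<in> ellipsoid t x y" and z: "z \<noteq> x" "z \<noteq> y"
  let ?s = "t - norm (z - x) - norm (z - y)"
  have "norm (z - x) + norm (z - y) \<ge> \<delta>"
    using y norm_triangle_ineq[of "z - x" "y - z"] by (simp add: norm_minus_commute \<delta>_def)
  note 2 = inverse_square_le_poles[OF z this \<delta>]
  have "poles x y z \<ge> 0" by (simp add: poles_def)
  then have "1 * poles x y z \<le> (1 + 2 / \<delta>) * poles x y z" "2 / \<delta> * poles x y z \<le> (1 + 2 / \<delta>) * poles x y z"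
    using \<delta> by (intro mult_right_mono; simp)+
  with 2 inverse_le_poles[OF z]
  have p: "1 / (norm (z - x) * norm (z - y) ^ k) \<le> (1 + 2 / \<delta>) * poles x y z" using k by (elim disjE) simp_all
  have s: "0 \<le> ?s" "?s \<le> t"
    using e norm_ge_zero[of "z - x"] norm_ge_zero[of "z - y"]
    unfolding ellipsoid_def mem_Collect_eq by linarith+
  then have sj: "?s ^ j \<le> t ^ j" by (intro power_mono)
  have "\<bar>?s ^ j * g y z / (norm (z - x) * norm (z - y) ^ k)\<bar> = ?s ^ j * \<bar>g y z\<bar> * (1 / (norm (z - x) * norm (z - y) ^ k))"
    using s(1) by (simp add: abs_mult)
  also have "\<dots> \<le> t ^ j * B * ((1 + 2 / \<delta>) * poles x y z)"
    using s sj g(2)[of y z] t B p by (intro mult_mono) auto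
  finally show "\<bar>?s ^ j * g y z / (norm (z - x) * norm (z - y) ^ k)\<bar> \<le> t ^ j * B * (1 + 2 / \<delta>) * poles x y z"
    by (simp only: mult.assoc)
next
  fix y
  note [measurable] = g(1)[of y]
  show "(\<lambda>z. (t - norm (z - x) - norm (z - y)) ^ j * g y z / (norm (z - x) * norm (z - y) ^ k)) \<in> borel_measurable borel"
    by measurable
next
  fix z assume "z \<noteq> x" "z \<noteq> y0"
  then show "isCont (\<lambda>q. (t - norm (snd q - x) - norm (snd q - fst q)) ^ j * g (fst q) (snd q)
      / (norm (snd q - x) * norm (snd q - fst q) ^ k)) (y0, z)"
    by (intro continuous_intros cont) auto
qed (simp add: g(4))

lemma isCont_K:
  assumes xy: "x \<noteq> y" and t: "t \<ge> 0"
    and \<alpha>: "\<alpha> \<in> C1" "compact (supp \<alpha>)" and \<rho>: "\<rho> \<in> C1" "compact (supp \<rho>)"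
  shows "isCont (K \<epsilon> \<alpha> \<rho> t x) y"
proof -
  obtain Ma where "Ma \<ge> 0" and "\<And>z. norm (\<alpha> z) \<le> Ma"
    using bounded_compact_support[OF C1_continuous[OF \<alpha>(1)] \<alpha>(2) supp_zero[of _ \<alpha>]] by blast
  then have Ma: "\<bar>\<alpha> z\<bar> \<le> Ma" for z by simp
  obtain Mr where "Mr \<ge> 0" and Mr: "\<And>y z. \<bar>radial \<rho> y z\<bar> \<le> Mr" using radial_bounded[OF \<rho>] by blast
  have ca: "isCont \<alpha> z" for z using C1_continuous[OF \<alpha>(1), of UNIV] continuous_on_eq_continuous_at by blast
  have cas: "isCont (\<lambda>q. \<alpha> (snd q)) q" for q :: "(real^3) \<times> (real^3)"
    by (rule isCont_o2[OF _ ca]) (intro continuous_intros)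
  have am: "\<alpha> \<in> borel_measurable borel" by (intro borel_measurable_continuous_onI C1_continuous \<alpha>)
  have 1: "isCont (\<lambda>y. ellipsoid_integral 1 0 \<alpha> t x y) y"
    by (rule isCont_ellipsoid_integral_weight[OF xy t _ am Ma compact_imp_bounded[OF \<alpha>(2)]]) (auto simp: supp_zero cas)
  have 2: "isCont (\<lambda>y. ellipsoid_integral k j (radial \<rho> y) t x y) y" if "k = 1 \<or> k = 2" for k j
    by (rule isCont_ellipsoid_integral_weight[OF xy t that radial_borel[OF \<rho>(1)] Mr compact_imp_bounded[OF \<rho>(2)]
          radial_eq_0 radial_isCont[OF \<rho>(1)]])
  have 0: "isCont (\<lambda>y. (max 0 (t - norm (y - x)))\<^sup>2 / (8 * pi * norm (y - x)) * (1 - \<epsilon> * \<alpha> y)) y"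
    using xy by (intro continuous_intros ca) auto
  have c: "isCont (\<lambda>y. (max 0 (t - norm (y - x)))\<^sup>2 / (8 * pi * norm (y - x)) * (1 - \<epsilon> * \<alpha> y)
     + \<epsilon> / (16 * pi\<^sup>2) * ellipsoid_integral 1 0 \<alpha> t x y
     + \<epsilon> / (16 * pi\<^sup>2) * ellipsoid_integral 1 1 (radial \<rho> y) t x y
     + \<epsilon> / (32 * pi\<^sup>2) * ellipsoid_integral 2 2 (radial \<rho> y) t x y) y"
    by (intro isCont_add isCont_mult 0 1 2 continuous_const) auto
  have "open (- {x})" by (intro open_Compl closed_singleton)
  from eventually_nhds_in_open[OF this, of y] xy
  have "\<forall>\<^sub>F y' in nhds y. y' \<in> - {x}" by simp
  then show ?thesis
    by (rule isCont_cong[THEN iffD2, OF eventually_mono]) (use c in \<open>auto simp: K_ellipsoid_integrals\<close>)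
qed

lemma K_times_source_Cc:
  assumes t: "t \<ge> 0"
    and \<alpha>: "\<alpha> \<in> C1" "compact (supp \<alpha>)" and \<rho>: "\<rho> \<in> C1" "compact (supp \<rho>)"
    and f: "f \<in> Cc" and x: "x \<notin> supp f"
  shows "(\<lambda>y. K \<epsilon> \<alpha> \<rho> t x y * f y) \<in> Cc"
  unfolding Cc_def mem_Collect_eq
proof
  have fc: "continuous_on UNIV f" and fs: "compact (supp f)" using f by (auto simp: Cc_def)
  have "isCont (\<lambda>y. K \<epsilon> \<alpha> \<rho> t x y * f y) y" for y
  proof (cases "y = x")
    case True
    \<comment> \<open>At \<open>y = x\<close> the value of the kernel is meaningless, but
      \<open>f\<close> vanishes in a whole neighbourhood of that point.\<close>
    have "open (- supp f)" unfolding supp_def by (intro open_Compl closed_closure)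
    from eventually_nhds_in_open[OF this, of y] x True
    have "\<forall>\<^sub>F y' in nhds y. y' \<in> - supp f" by simp
    then have "\<forall>\<^sub>F y' in nhds y. K \<epsilon> \<alpha> \<rho> t x y' * f y' = 0" by eventually_elim (simp add: supp_zero)
    from isCont_cong[OF this] show ?thesis by (rule iffD2) simp
  next
    case False
    have "isCont f y" using fc continuous_on_eq_continuous_at by blast
    then show ?thesis using isCont_K[OF _ t \<alpha> \<rho>] False by (intro continuous_mult) auto
  qed
  then show "continuous_on UNIV (\<lambda>y. K \<epsilon> \<alpha> \<rho> t x y * f y)"
    by (intro continuous_at_imp_continuous_on) auto
  let ?h = "\<lambda>y. K \<epsilon> \<alpha> \<rho> t x y * f y"
  have "supp ?h \<subseteq> supp f"
    unfolding supp_def by (intro closure_mono) auto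
  moreover have "compact (supp f \<inter> supp ?h)"
    by (rule compact_Int_closed[OF fs]) (simp add: supp_def)
  ultimately show "compact (supp ?h)" by (simp only: Int_absorb1)
qed

subsection \<open>Integrals over confocal shells\<close>

lemma integral_has_derivative_upper:
  fixes h :: "real \<Rightarrow> real"
  assumes int: "\<And>T. h integrable_on {d..T}" and t: "d < t" and c: "isCont h t"
  shows "((\<lambda>t. integral {d..t} h) has_real_derivative h t) (at t)"
proof -
  have "((\<lambda>u. integral {d..u} h) has_vector_derivative h t) (at t within ({d..t + 1} - {}))"
    using t c by (intro integral_has_vector_derivative_continuous_at int) (auto intro: continuous_at_imp_continuous_at_within)
  moreover have "at t within ({d..t + 1} - {}) = at t"
    using t by (simp add: at_within_Icc_at)
  ultimately show ?thesis by (simp add: has_real_derivative_iff_has_vector_derivative)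
qed

lemma set_integrable_power_mult:
  fixes k :: "real \<Rightarrow> real"
  assumes "integrable lborel k"
  shows "set_integrable lborel {d..T} (\<lambda>p. p ^ j * k p)"
  unfolding set_integrable_def
proof (rule Bochner_Integration.integrable_bound)
  show "integrable lborel (\<lambda>p. (max \<bar>d\<bar> \<bar>T\<bar>) ^ j * k p)" using assms by (rule integrable_mult_right)
  have [measurable]: "k \<in> borel_measurable borel" using assms by auto
  show "(\<lambda>p. indicator {d..T} p *\<^sub>R (p ^ j * k p)) \<in> borel_measurable lborel" by measurable
  have "\<bar>p\<bar> ^ j * \<bar>k p\<bar> \<le> (max \<bar>d\<bar> \<bar>T\<bar>) ^ j * \<bar>k p\<bar>" if "p \<in> {d..T}" for p
    using that by (intro mult_right_mono power_mono) auto
  then show "AE p in lborel. norm (indicator {d..T} p *\<^sub>R (p ^ j * k p)) \<le> norm ((max \<bar>d\<bar> \<bar>T\<bar>) ^ j * k p)"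
    by (intro AE_I2) (auto simp: indicator_def abs_mult power_abs)
qed

lemma power_mult_integrable_on:
  fixes k :: "real \<Rightarrow> real"
  assumes "integrable lborel k"
  shows "(\<lambda>p. p ^ j * k p) integrable_on {d..T}"
  by (rule set_borel_integral_eq_integral(1)[OF set_integrable_power_mult[OF assms]])

lemma integral_moment1:
  fixes k :: "real \<Rightarrow> real"
  assumes "integrable lborel k"
  shows "integral {d..T} (\<lambda>p. (t - p) * k p) = t * integral {d..T} k - integral {d..T} (\<lambda>p. p * k p)"
  using power_mult_integrable_on[OF assms, of 0 d T] power_mult_integrable_on[OF assms, of 1 d T]
  by (simp add: left_diff_distrib Henstock_Kurzweil_Integration.integral_diff integrable_on_mult_right)

lemma integral_moment2:
  fixes k :: "real \<Rightarrow> real"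
  assumes "integrable lborel k"
  shows "integral {d..T} (\<lambda>p. (t - p)\<^sup>2 * k p) =
    t\<^sup>2 * integral {d..T} k - 2 * t * integral {d..T} (\<lambda>p. p * k p) + integral {d..T} (\<lambda>p. p\<^sup>2 * k p)"
proof -
  note i = power_mult_integrable_on[OF assms, of 0 d T, simplified]
    power_mult_integrable_on[OF assms, of 1 d T, simplified] power_mult_integrable_on[OF assms, of 2 d T]
  have "(\<lambda>p. (t - p)\<^sup>2 * k p) = (\<lambda>p. t\<^sup>2 * k p - 2 * t * (p * k p) + p\<^sup>2 * k p)"
    by (auto simp: fun_eq_iff power2_eq_square algebra_simps)
  then show ?thesis using i
    by (simp add: Henstock_Kurzweil_Integration.integral_diff Henstock_Kurzweil_Integration.integral_add
        integrable_on_mult_right integrable_add integrable_diff)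
qed

text \<open>Expanding the powers of \<open>t - p\<close> leaves integrals whose integrands do not
  depend on \<open>t\<close>. The boundary terms cancel because the weight vanishes at
  \<open>p = t\<close>. Continuity is asked only at \<open>t\<close>, as a profile may jump at
  \<open>d\<close>.\<close>

lemma moment_derivatives:
  fixes k :: "real \<Rightarrow> real"
  assumes k: "integrable lborel k" and c: "isCont k t" and t: "d < t"
  shows "((\<lambda>t. integral {d..t} k) has_real_derivative k t) (at t)"
    and "((\<lambda>t. integral {d..t} (\<lambda>p. (t - p) * k p)) has_real_derivative integral {d..t} k) (at t)"
    and "((\<lambda>t. integral {d..t} (\<lambda>p. (t - p)\<^sup>2 * k p)) has_real_derivative
      2 * integral {d..t} (\<lambda>p. (t - p) * k p)) (at t)"
proof -
  have d0: "((\<lambda>t. integral {d..t} k) has_real_derivative k t) (at t)"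
    using power_mult_integrable_on[OF k, of 0] by (intro integral_has_derivative_upper t c) simp
  have d1: "((\<lambda>t. integral {d..t} (\<lambda>p. p * k p)) has_real_derivative t * k t) (at t)"
    using power_mult_integrable_on[OF k, of 1]
    by (intro integral_has_derivative_upper t continuous_intros c) simp
  have d2: "((\<lambda>t. integral {d..t} (\<lambda>p. p\<^sup>2 * k p)) has_real_derivative t\<^sup>2 * k t) (at t)"
    by (intro integral_has_derivative_upper t continuous_intros c power_mult_integrable_on k)
  show "((\<lambda>t. integral {d..t} k) has_real_derivative k t) (at t)" by (rule d0)
  show "((\<lambda>t. integral {d..t} (\<lambda>p. (t - p) * k p)) has_real_derivative integral {d..t} k) (at t)"
    unfolding integral_moment1[OF k] by (rule derivative_eq_intros d0 d1 refl)+ simp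
  show "((\<lambda>t. integral {d..t} (\<lambda>p. (t - p)\<^sup>2 * k p)) has_real_derivative
      2 * integral {d..t} (\<lambda>p. (t - p) * k p)) (at t)"
    unfolding integral_moment1[OF k] integral_moment2[OF k]
    by (rule derivative_eq_intros d0 d1 d2 refl)+ (simp add: algebra_simps power2_eq_square)
qed

lemma tendsto_integral_dominated:
  fixes F :: "real \<Rightarrow> 'b::euclidean_space \<Rightarrow> real"
  assumes "\<And>p. p \<in> S \<Longrightarrow> F p \<in> borel_measurable lborel" "F0 \<in> borel_measurable lborel"
    and "integrable lborel g" "\<And>p w. p \<in> S \<Longrightarrow> \<bar>F p w\<bar> \<le> g w"
    and "AE w in lborel. ((\<lambda>p. F p w) \<longlongrightarrow> F0 w) (at a within S)"
  shows "((\<lambda>p. LINT w|lborel. F p w) \<longlongrightarrow> (LINT w|lborel. F0 w)) (at a within S)"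
  unfolding tendsto_at_iff_sequentially
proof (intro allI impI)
  fix X :: "nat \<Rightarrow> real" assume X: "\<forall>i. X i \<in> S - {a}" "X \<longlonglongrightarrow> a"
  have "(\<lambda>i. LINT w|lborel. F (X i) w) \<longlonglongrightarrow> (LINT w|lborel. F0 w)"
  proof (rule integral_dominated_convergence[where w = g])
    show "AE w in lborel. (\<lambda>i. F (X i) w) \<longlonglongrightarrow> F0 w"
      using assms(5)
    proof eventually_elim
      case (elim w)
      then show ?case using X unfolding tendsto_at_iff_sequentially by (auto simp: comp_def)
    qed
  qed (use X assms in auto)
  then show "((\<lambda>p. LINT w|lborel. F p w) \<circ> X) \<longlonglongrightarrow> (LINT w|lborel. F0 w)" by (simp add: comp_def)
qed

context focal_frame
begin

lemma triangle: "d \<le> norm (z - x) + norm (z - y)"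
proof -
  have "norm (y - x) = d" using d_nonneg frame by (simp add: foci orthonormal3_def)
  then show ?thesis using norm_triangle_ineq[of "z - x" "y - z"] by (simp add: norm_minus_commute)
qed

text \<open>Extended by 0 to the whole line, so that integrability over any \<open>{d..t}\<close>
  follows from one global statement.\<close>

definition profile :: "(real^3 \<Rightarrow> real) \<Rightarrow> real \<Rightarrow> real" where
  "profile g p = indicator {d<..} p * shell_mean g p"

text \<open>On a shell the path length is constantly \<open>p\<close>, so the time weight and the
  indicator of the ellipsoid leave the shell mean; a one-dimensional moment over
  \<open>{d..t}\<close> remains.\<close>

lemma ellipsoid_moment:
  assumes g[measurable]: "g \<in> borel_measurable borel"
    and int: "integrable lborel (\<lambda>z. g z / (norm (z - x) * norm (z - y)))"
  shows "integrable lborel (profile g)"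
    and "set_integrable lborel (ellipsoid t x y) (\<lambda>z. (t - norm (z - x) - norm (z - y)) ^ j * g z / (norm (z - x) * norm (z - y)))"
    and "ellipsoid_integral 1 j g t x y = 1/2 * integral {d..t} (\<lambda>p. (t - p) ^ j * profile g p)"
proof -
  show ik: "integrable lborel (profile g)" unfolding profile_def[abs_def] by (rule shell_integral(1)[OF g int])
  define G where "G z = indicator (ellipsoid t x y) z * ((t - norm (z - x) - norm (z - y)) ^ j * g z)" for z
  have G[measurable]: "G \<in> borel_measurable borel" unfolding G_def by measurable
  have eq: "(\<lambda>z. G z / (norm (z - x) * norm (z - y))) = (\<lambda>z. indicator (ellipsoid t x y) z *\<^sub>R ((t - norm (z - x) - norm (z - y)) ^ j * g z / (norm (z - x) * norm (z - y))))"
    by (auto simp: G_def fun_eq_iff)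
  have iG: "integrable lborel (\<lambda>z. G z / (norm (z - x) * norm (z - y)))"
  proof (rule Bochner_Integration.integrable_bound[OF integrable_mult_right[OF int, of "\<bar>t\<bar> ^ j"]])
    show "AE z in lborel. norm (G z / (norm (z - x) * norm (z - y))) \<le> norm (\<bar>t\<bar> ^ j * (g z / (norm (z - x) * norm (z - y))))"
    proof (rule AE_I2)
      fix z
      show "norm (G z / (norm (z - x) * norm (z - y))) \<le> norm (\<bar>t\<bar> ^ j * (g z / (norm (z - x) * norm (z - y))))"
      proof (cases "z \<in> ellipsoid t x y")
        case True
        then have "\<bar>t - norm (z - x) - norm (z - y)\<bar> ^ j \<le> \<bar>t\<bar> ^ j"
          using norm_ge_zero[of "z - x"] norm_ge_zero[of "z - y"]
          unfolding ellipsoid_def mem_Collect_eq by (intro power_mono) linarith+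
        then have "\<bar>t - norm (z - x) - norm (z - y)\<bar> ^ j * \<bar>g z / (norm (z - x) * norm (z - y))\<bar> \<le> \<bar>t\<bar> ^ j * \<bar>g z / (norm (z - x) * norm (z - y))\<bar>"
          by (intro mult_right_mono) auto
        then show ?thesis using True by (simp add: G_def abs_mult power_abs)
      qed (simp add: G_def)
    qed
  qed measurable
  then show "set_integrable lborel (ellipsoid t x y) (\<lambda>z. (t - norm (z - x) - norm (z - y)) ^ j * g z / (norm (z - x) * norm (z - y)))"
    unfolding set_integrable_def eq .
  have mean: "indicator {d<..} p * shell_mean G p = indicator {d..t} p *\<^sub>R ((t - p) ^ j * profile g p)" for p
  proof (cases "p > d")
    case True
    have mw: "indicator Qbox w *\<^sub>R G (Z p w) = (indicator {..t} p * (t - p) ^ j) * (indicator Qbox w *\<^sub>R g (Z p w))" for w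
    proof (cases "w \<in> Qbox")
      case w: True
      from norm_Z[of p, OF _ w] True have n: "norm (Z p w - x) + norm (Z p w - y) = p" by (simp add: field_simps)
      then have n': "t - norm (Z p w - x) - norm (Z p w - y) = t - p" by simp
      show ?thesis unfolding G_def n' by (simp add: ellipsoid_def indicator_def n)
    qed simp
    have "shell_mean G p = (indicator {..t} p * (t - p) ^ j) * shell_mean g p"
      unfolding shell_mean_def set_lebesgue_integral_def mw by (rule integral_mult_right_zero)
    then show ?thesis using True by (simp add: profile_def indicator_def)
  qed (simp add: profile_def)
  have "set_integrable lborel {d..t} (\<lambda>p. (t - p) ^ j * profile g p)"
    using shell_integral(1)[OF G iG] unfolding mean set_integrable_def .
  from set_borel_integral_eq_integral(2)[OF this]
  have "(LINT p|lborel. indicator {d<..} p * shell_mean G p) = integral {d..t} (\<lambda>p. (t - p) ^ j * profile g p)"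
    unfolding mean set_lebesgue_integral_def .
  then show "ellipsoid_integral 1 j g t x y = 1/2 * integral {d..t} (\<lambda>p. (t - p) ^ j * profile g p)"
    using shell_integral(2)[OF G iG] unfolding eq ellipsoid_integral_def set_lebesgue_integral_def by simp
qed

lemma shell_mean_continuous_on:
  assumes "continuous_on (U \<times> Qbox) (\<lambda>(p, w). g (Z p w))"
  shows "continuous_on U (shell_mean g)"
proof -
  have "continuous_on U (\<lambda>p. integral Qbox (\<lambda>w. g (Z p w)))"
    unfolding Qbox_def by (rule integral_continuous_on_param) (use assms in \<open>simp add: Qbox_def\<close>)
  moreover have "shell_mean g p = integral Qbox (\<lambda>w. g (Z p w))" if "p \<in> U" for p
    unfolding shell_mean_def
  proof (rule set_integrable_Qbox(2))
    have "continuous_on Qbox ((\<lambda>(p, w). g (Z p w)) \<circ> Pair p)"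
      by (rule continuous_on_compose) (auto intro!: continuous_intros continuous_on_subset[OF assms] that)
    then show "continuous_on Qbox (\<lambda>w. g (Z p w))" by (simp add: comp_def)
  qed
  ultimately show ?thesis by (metis (no_types, lifting) continuous_on_cong)
qed

definition dZ :: "real \<Rightarrow> real \<times> real \<Rightarrow> real^3" where
  "dZ p w = (fst w / 2) *\<^sub>R e1
    + (p / sqrt (p\<^sup>2 - d\<^sup>2) * sqrt (1 - (fst w)\<^sup>2) / 2) *\<^sub>R (cos (snd w) *\<^sub>R e2 + sin (snd w) *\<^sub>R e3)"

lemma Z_has_derivative:
  assumes "p > d"
  shows "((\<lambda>p. Z p w) has_vector_derivative dZ p w) (at p)"
proof -
  have pos: "p\<^sup>2 - d\<^sup>2 > 0" using assms d_nonneg by (simp add: power_strict_mono)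
  have 1: "((\<lambda>p. sqrt (p\<^sup>2 - d\<^sup>2) * sqrt (1 - (fst w)\<^sup>2) / 2) has_real_derivative
      p / sqrt (p\<^sup>2 - d\<^sup>2) * sqrt (1 - (fst w)\<^sup>2) / 2) (at p)"
    using pos by (auto intro!: derivative_eq_intros simp: field_simps)
  have 2: "((\<lambda>p. p * fst w / 2) has_real_derivative fst w / 2) (at p)"
    by (auto intro!: derivative_eq_intros)
  have eq: "(\<lambda>p. Z p w) = (\<lambda>p. x + (d / 2) *\<^sub>R e1 + (p * fst w / 2) *\<^sub>R e1
    + (sqrt (p\<^sup>2 - d\<^sup>2) * sqrt (1 - (fst w)\<^sup>2) / 2) *\<^sub>R (cos (snd w) *\<^sub>R e2 + sin (snd w) *\<^sub>R e3))"
    by (cases w) (simp add: Z_eq)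
  show ?thesis unfolding eq dZ_def
    by (rule derivative_eq_intros has_vector_derivative_scaleR[OF 1 has_vector_derivative_const]
        has_vector_derivative_scaleR[OF 2 has_vector_derivative_const] refl)+ simp
qed

lemma continuous_on_dZ: "continuous_on ({d<..} \<times> Qbox) (\<lambda>(p, w). dZ p w)"
proof -
  have "sqrt (p\<^sup>2 - d\<^sup>2) \<noteq> 0" if "p > d" for p
    using that d_nonneg by (simp add: power2_eq_iff)
  then show ?thesis unfolding dZ_def case_prod_unfold by (intro continuous_intros) auto
qed

text \<open>The velocity \<open>dZ\<close> is continuous, up to the boundary of \<open>Qbox\<close>,
  for \<open>p > d\<close>, so the Leibniz rule is applied on that open half line. The behaviour at
  \<open>d\<close> needs the separate argument of
  \<open>shell_mean_derivative_limit\<close>.\<close>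

lemma shell_mean_has_derivative:
  assumes g: "g \<in> C1" and p: "p > d"
  shows "(shell_mean g has_real_derivative integral Qbox (\<lambda>w. grad g (Z p w) \<bullet> dZ p w)) (at p)"
proof -
  have cgZ: "continuous_on A (\<lambda>q. g ((\<lambda>(p, w). Z p w) q))" for A
    by (rule continuous_on_compose2[OF C1_continuous[OF g, of UNIV] continuous_on_Z]) auto
  have cG: "continuous_on A (\<lambda>q. grad g ((\<lambda>(p, w). Z p w) q))" for A
    by (rule continuous_on_compose2[OF grad_continuous[OF g, of UNIV] continuous_on_Z]) auto
  have cw: "continuous_on Qbox (\<lambda>w. g (Z p w))" for p
  proof -
    have "continuous_on Qbox ((\<lambda>q. g ((\<lambda>(p, w). Z p w) q)) \<circ> Pair p)"
      by (rule continuous_on_compose) (auto intro!: continuous_intros cgZ)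
    then show ?thesis by (simp add: comp_def)
  qed
  have "((\<lambda>p. integral Qbox (\<lambda>w. g (Z p w))) has_field_derivative integral Qbox (\<lambda>w. grad g (Z p w) \<bullet> dZ p w)) (at p within {d<..})"
    unfolding Qbox_def
  proof (rule leibniz_rule_field_derivative)
    fix q w assume q: "q \<in> {d<..}"
    have "((\<lambda>p. g (Z p w)) has_derivative (\<lambda>h. grad g (Z q w) \<bullet> (h *\<^sub>R dZ q w))) (at q)"
      using has_derivative_compose[OF Z_has_derivative[unfolded has_vector_derivative_def] C1_has_derivative[OF g]] q by simp
    then have "((\<lambda>p. g (Z p w)) has_field_derivative grad g (Z q w) \<bullet> dZ q w) (at q)"
      by (simp add: has_field_derivative_def mult_commute_abs)
    then show "((\<lambda>p. g (Z p w)) has_field_derivative grad g (Z q w) \<bullet> dZ q w) (at q within {d<..})"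
      by (rule has_field_derivative_at_within)
  next
    fix q
    show "(\<lambda>w. g (Z q w)) integrable_on cbox (- 1, 0) (1, 2 * pi)"
      by (rule integrable_continuous) (use cw in \<open>simp add: Qbox_def\<close>)
  next
    show "continuous_on ({d<..} \<times> cbox (- 1, 0) (1, 2 * pi)) (\<lambda>(p, w). grad g (Z p w) \<bullet> dZ p w)"
      using continuous_on_inner[OF cG continuous_on_dZ] by (simp add: case_prod_unfold Qbox_def)
  qed (use p in auto)
  moreover have "(\<lambda>p. integral Qbox (\<lambda>w. g (Z p w))) = shell_mean g"
    using set_integrable_Qbox(2)[OF cw] by (simp add: shell_mean_def fun_eq_iff)
  moreover have "at p within {d<..} = at p" by (rule at_within_open) (use p in auto)
  ultimately show ?thesis by (simp only:)
qed

end

text \<open>On spheres about \<open>y\<close> the integrand is a radial derivative, so the integral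
  telescopes from the spherical mean \<open>4 * pi * \<rho> y\<close> at radius 0 to 0 beyond the
  support. Equivalently, the inverse distance is a multiple of the fundamental solution of the
  Laplacian.\<close>

lemma integral_radial_derivative:
  fixes y :: "real^3"
  assumes \<rho>: "\<rho> \<in> C1" "compact (supp \<rho>)"
  shows "(LINT z|lborel. radial \<rho> y z / (norm (z - y))\<^sup>2) = - 4 * pi * \<rho> y"
proof -
  have "norm (axis 1 1 :: real^3) = 1" by simp
  from orthonormal3_plane_frame[OF this] obtain e2 e3 :: "real^3" where "orthonormal3 (axis 1 1) e2 e3" by blast
  then interpret focal_frame y y "axis 1 1" e2 e3 0 by unfold_locales simp_all
  define G where "G = radial \<rho> y"
  have G[measurable]: "G \<in> borel_measurable borel" unfolding G_def by (rule radial_borel[OF \<rho>(1)])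
  obtain Mr where Mr: "Mr \<ge> 0" "\<And>y z. \<bar>radial \<rho> y z\<bar> \<le> Mr" using radial_bounded[OF \<rho>] by blast
  then have Gb: "\<bar>G z\<bar> \<le> Mr" for z by (simp add: G_def)
  have int: "integrable lborel (\<lambda>z. G z / (norm (z - y) * norm (z - y)))"
  proof (rule integrable_two_poles[where C = Mr and S = "supp \<rho>"])
    fix z
    have "\<bar>G z / (norm (z - y) * norm (z - y))\<bar> = \<bar>G z\<bar> * (1 / (norm (z - y))\<^sup>2)"
      by (simp add: abs_mult power2_eq_square)
    also have "\<dots> \<le> Mr * poles y y z" using Gb Mr(1) by (intro mult_mono) (auto simp: poles_def intro!: divide_right_mono)
    finally show "\<bar>G z / (norm (z - y) * norm (z - y))\<bar> \<le> Mr * poles y y z" .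
    show "(\<lambda>z. G z / (norm (z - y) * norm (z - y))) \<in> borel_measurable borel" by measurable
  qed (use \<rho>(2) in \<open>auto simp: G_def radial_eq_0 compact_imp_bounded\<close>)
  obtain R where R: "supp \<rho> \<subseteq> cball y R" using bounded_imp_subset_cball[OF compact_imp_bounded[OF \<rho>(2)]] by blast
  define T where "T = 2 * max 0 R + 1"
  have T: "T > 0" by (simp add: T_def)
  have far: "Z p w \<notin> supp \<rho>" if "p \<ge> T" "w \<in> Qbox" for p w
  proof -
    have "norm (Z p w - y) = p / 2" using norm_Z(1)[of p w] that T by simp
    moreover have "p / 2 > R" using that(1) unfolding T_def by simp
    ultimately have "Z p w \<notin> cball y R" by (simp add: dist_norm norm_minus_commute)
    then show ?thesis using R by blast
  qed
  \<comment> \<open>With coincident foci the velocity is radial. As the radius is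
    \<open>p / 2\<close>, the unit radial vector is twice \<open>dZ p w\<close>, hence the factor 2
    in \<open>mean\<close>.\<close>
  have Z0: "Z p w - y = p *\<^sub>R dZ p w" if "p \<ge> 0" for p w
    using that by (cases w) (simp add: Z_eq dZ_def scaleR_add_right mult.assoc)
  have mean: "shell_mean G p = 2 * integral Qbox (\<lambda>w. grad \<rho> (Z p w) \<bullet> dZ p w)" if p: "p > 0" for p
  proof -
    have "continuous_on Qbox ((\<lambda>q. grad \<rho> ((\<lambda>(p, w). Z p w) q)) \<circ> Pair p)"
      by (intro continuous_on_compose continuous_intros
        continuous_on_compose2[OF grad_continuous[OF \<rho>(1), of UNIV] continuous_on_Z]) auto
    moreover have "continuous_on Qbox ((\<lambda>(p, w). dZ p w) \<circ> Pair p)"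
      by (rule continuous_on_compose) (auto intro!: continuous_intros continuous_on_subset[OF continuous_on_dZ] p)
    ultimately have c: "continuous_on Qbox (\<lambda>w. grad \<rho> (Z p w) \<bullet> dZ p w)"
      by (simp add: comp_def continuous_on_inner)
    have "shell_mean G p = (LINT w:Qbox|lborel. 2 * (grad \<rho> (Z p w) \<bullet> dZ p w))"
      unfolding shell_mean_def
    proof (rule set_lebesgue_integral_cong)
      show "\<forall>w. w \<in> Qbox \<longrightarrow> G (Z p w) = 2 * (grad \<rho> (Z p w) \<bullet> dZ p w)"
      proof (intro allI impI)
        fix w assume "w \<in> Qbox"
        then have n: "norm (Z p w - y) = p / 2" using norm_Z(1)[of p w] p by simp
        show "G (Z p w) = 2 * (grad \<rho> (Z p w) \<bullet> dZ p w)"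
          unfolding G_def radial_def n unfolding Z0[OF less_imp_le[OF p]] using p by (simp add: field_simps)
      qed
    qed simp
    also have "\<dots> = 2 * integral Qbox (\<lambda>w. grad \<rho> (Z p w) \<bullet> dZ p w)"
      using set_integrable_Qbox(2)[OF c] by simp
    finally show ?thesis .
  qed
  have "continuous_on {0..T} (shell_mean \<rho>)"
  proof (rule shell_mean_continuous_on)
    show "continuous_on ({0..T} \<times> Qbox) (\<lambda>(p, w). \<rho> (Z p w))"
      using continuous_on_compose2[OF C1_continuous[OF \<rho>(1), of UNIV] continuous_on_Z] by (simp add: case_prod_unfold)
  qed
  then have "((\<lambda>p. integral Qbox (\<lambda>w. grad \<rho> (Z p w) \<bullet> dZ p w)) has_integral (shell_mean \<rho> T - shell_mean \<rho> 0)) {0..T}"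
    using T shell_mean_has_derivative[OF \<rho>(1)]
    by (intro fundamental_theorem_of_calculus_interior)
      (auto simp: has_real_derivative_iff_has_vector_derivative[symmetric])
  moreover have "shell_mean \<rho> T = 0"
    unfolding shell_mean_def set_lebesgue_integral_def
    by (rule integral_eq_zero_AE, rule AE_I2) (use far[of T] in \<open>auto simp: indicator_def supp_zero\<close>)
  moreover have "shell_mean \<rho> 0 = 4 * pi * \<rho> y"
  proof -
    have "shell_mean \<rho> 0 = integral Qbox (\<lambda>w. \<rho> (Z 0 w))"
      unfolding shell_mean_def using Z0[of 0] by (intro set_integrable_Qbox) simp
    also have "\<dots> = 4 * pi * \<rho> y" using Z0[of 0] by (simp add: Qbox_def content_Pair)
    finally show ?thesis .
  qed
  ultimately have "((\<lambda>p. 2 * integral Qbox (\<lambda>w. grad \<rho> (Z p w) \<bullet> dZ p w)) has_integral 2 * (0 - 4 * pi * \<rho> y)) {0..T}"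
    by (intro has_integral_mult_right) simp
  then have "((\<lambda>p. indicator {0<..} p * shell_mean G p) has_integral 2 * (0 - 4 * pi * \<rho> y)) {0..T}"
    by (rule has_integral_spike[of "{0}", rotated 2]) (auto simp: mean)
  then have "((\<lambda>p. indicator {0<..} p * shell_mean G p) has_integral 2 * (0 - 4 * pi * \<rho> y)) UNIV"
  proof (rule has_integral_on_superset)
    fix p :: real assume "p \<notin> {0..T}"
    then have "p < 0 \<or> p > T" by auto
    then show "indicator {0<..} p * shell_mean G p = 0"
    proof
      assume p: "p > T"
      have "shell_mean G p = 0"
        unfolding shell_mean_def set_lebesgue_integral_def
        by (rule integral_eq_zero_AE, rule AE_I2) (use far[of p] p in \<open>auto simp: indicator_def G_def radial_eq_0\<close>)
      then show ?thesis by simp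
    qed simp
  qed simp
  then have "(LINT p|lborel. indicator {0<..} p * shell_mean G p) = 2 * (0 - 4 * pi * \<rho> y)"
    using has_integral_integral_lborel[OF shell_integral(1)[OF G int]] by (rule has_integral_unique[rotated])
  then have "(LINT z|lborel. G z / (norm (z - y) * norm (z - y))) = - 4 * pi * \<rho> y"
    using shell_integral(2)[OF G int] by simp
  then show ?thesis unfolding G_def power2_eq_square .
qed

section \<open>Second derivatives, the Laplacian and its weighted mean on a segment\<close>

definition hess :: "(real^3 \<Rightarrow> real) \<Rightarrow> real^3 \<Rightarrow> real^3 \<Rightarrow> real^3 \<Rightarrow> real" where
  "hess \<alpha> z h u = (\<Sum>i\<in>UNIV. u $ i * (grad (partial i \<alpha>) z \<bullet> h))"

lemma C2_C1: "\<alpha> \<in> C2 \<Longrightarrow> \<alpha> \<in> C1" "\<alpha> \<in> C2 \<Longrightarrow> partial i \<alpha> \<in> C1"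
  by (auto simp: C2_def)

lemma grad_inner_has_derivative:
  assumes "\<alpha> \<in> C2"
  shows "((\<lambda>z. grad \<alpha> z \<bullet> u) has_derivative (\<lambda>h. hess \<alpha> z h u)) (at z)"
proof -
  have "(\<lambda>z. grad \<alpha> z \<bullet> u) = (\<lambda>z. \<Sum>i\<in>UNIV. u $ i * partial i \<alpha> z)"
    by (auto simp: grad_def inner_vec_def mult.commute fun_eq_iff)
  then show ?thesis unfolding hess_def
    by (auto intro!: has_derivative_sum has_derivative_mult_right C1_has_derivative C2_C1 assms)
qed

lemma hess_continuous:
  assumes "\<alpha> \<in> C2" "continuous_on S f" "continuous_on S h" "continuous_on S u"
  shows "continuous_on S (\<lambda>q. hess \<alpha> (f q) (h q) (u q))"
  unfolding hess_def
  by (intro continuous_intros assms continuous_on_compose2[OF grad_continuous[OF C2_C1(2)[OF assms(1)], of UNIV]]) auto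

lemma supp_partial_subset: "supp (partial i \<alpha>) \<subseteq> supp \<alpha>"
proof -
  have "{z. partial i \<alpha> z \<noteq> 0} \<subseteq> supp \<alpha>"
    using grad_eq_0[of _ \<alpha>] by (auto simp: grad_def vec_eq_iff)
  then show ?thesis unfolding supp_def by (intro closure_minimal) auto
qed

lemma compact_supp_partial:
  assumes "compact (supp \<alpha>)"
  shows "compact (supp (partial i \<alpha>))"
proof -
  have "compact (supp \<alpha> \<inter> supp (partial i \<alpha>))"
    by (rule compact_Int_closed[OF assms]) (simp add: supp_def)
  then show ?thesis using supp_partial_subset by (simp only: Int_absorb1)
qed

lemma hess_bounded:
  assumes "\<alpha> \<in> C2" "compact (supp \<alpha>)"
  obtains M where "M \<ge> 0" "\<And>z h u. norm h \<le> 1 \<Longrightarrow> norm u \<le> 1 \<Longrightarrow> \<bar>hess \<alpha> z h u\<bar> \<le> M"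
proof -
  have "\<exists>M. M \<ge> 0 \<and> (\<forall>z. norm (grad (partial i \<alpha>) z) \<le> M)" for i
    using bounded_compact_support[OF grad_continuous[OF C2_C1(2)[OF assms(1)]] compact_supp_partial[OF assms(2)]
        grad_eq_0[of _ "partial i \<alpha>"]] by metis
  then obtain M where M: "\<And>i. M i \<ge> 0" "\<And>i z. norm (grad (partial i \<alpha>) z) \<le> M i" by metis
  show ?thesis
  proof (rule that[of "\<Sum>i\<in>UNIV. M i"])
    show "(\<Sum>i\<in>UNIV. M i) \<ge> 0" by (intro sum_nonneg M)
    fix z h u :: "real^3" assume hu: "norm h \<le> 1" "norm u \<le> 1"
    have "\<bar>u $ i * (grad (partial i \<alpha>) z \<bullet> h)\<bar> \<le> M i" for i
    proof -
      have "\<bar>u $ i\<bar> \<le> 1" using component_le_norm_cart[of u i] hu by simp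
      moreover have "\<bar>grad (partial i \<alpha>) z \<bullet> h\<bar> \<le> M i * 1"
        using hu M by (intro order_trans[OF Cauchy_Schwarz_ineq2] mult_mono) auto
      ultimately have "\<bar>u $ i\<bar> * \<bar>grad (partial i \<alpha>) z \<bullet> h\<bar> \<le> 1 * M i"
        by (intro mult_mono) auto
      then show ?thesis by (simp add: abs_mult)
    qed
    then show "\<bar>hess \<alpha> z h u\<bar> \<le> (\<Sum>i\<in>UNIV. M i)"
      unfolding hess_def by (intro order_trans[OF sum_abs] sum_mono) auto
  qed
qed

lemma laplacian_grad: "laplacian \<alpha> z = (\<Sum>i\<in>UNIV. grad (partial i \<alpha>) z $ i)"
  by (simp add: laplacian_def grad_def)

lemma laplacian_continuous:
  assumes "\<alpha> \<in> C2"
  shows "continuous_on S (laplacian \<alpha>)"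
  unfolding laplacian_grad[abs_def] by (intro continuous_intros grad_continuous C2_C1 assms)

text \<open>The line integral of the theorem in the parameter \<open>s = |z - x| / d\<close>: its
  weight is \<open>d s (1 - s)\<close> and arc length contributes another \<open>d\<close>, so that
  integral is \<open>\<epsilon> * d^2\<close> times this mean
  (\<open>segment_integral_laplacian\<close>).\<close>

definition segment_mean :: "(real^3 \<Rightarrow> real) \<Rightarrow> real^3 \<Rightarrow> real^3 \<Rightarrow> real" where
  "segment_mean \<alpha> x y = integral {0..1} (\<lambda>s. s * (1 - s) * laplacian \<alpha> (x + s *\<^sub>R (y - x)))"

text \<open>The trace of a bilinear form is the same in every orthonormal basis; the completeness
  relation used is \<open>orthonormal3_expand\<close> read off componentwise.\<close>

lemma hess_trace:
  assumes "orthonormal3 e1 e2 e3"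
  shows "hess \<alpha> z e1 e1 + hess \<alpha> z e2 e2 + hess \<alpha> z e3 e3 = laplacian \<alpha> z"
proof -
  have "e1 $ i * (v \<bullet> e1) + e2 $ i * (v \<bullet> e2) + e3 $ i * (v \<bullet> e3) = v $ i" for i and v :: "real^3"
    using arg_cong[OF orthonormal3_expand[OF assms, of v], of "\<lambda>w. w $ i"] by (simp add: mult.commute)
  then show ?thesis
    unfolding hess_def laplacian_grad by (simp flip: sum.distrib)
qed

lemma integral_trig_period:
  "((\<lambda>\<phi>. a * cos \<phi> + b * sin \<phi>) has_integral 0) {0..2*pi}"
  "((\<lambda>\<phi>. c + (a * (cos \<phi>)\<^sup>2 + b * (sin \<phi>)\<^sup>2 + e * (cos \<phi> * sin \<phi>))) has_integral (2 * pi * c + pi * (a + b))) {0..2*pi}"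
proof -
  have "((\<lambda>\<phi>. a * cos \<phi> + b * sin \<phi>) has_integral ((a * sin (2*pi) - b * cos (2*pi)) - (a * sin 0 - b * cos 0))) {0..2*pi}"
    by (rule fundamental_theorem_of_calculus)
      (auto intro!: derivative_eq_intros simp flip: has_real_derivative_iff_has_vector_derivative)
  then show "((\<lambda>\<phi>. a * cos \<phi> + b * sin \<phi>) has_integral 0) {0..2*pi}" by simp
  define F where "F \<phi> = c * \<phi> + a * (\<phi> + sin \<phi> * cos \<phi>) / 2 + b * (\<phi> - sin \<phi> * cos \<phi>) / 2 + e * (sin \<phi>)\<^sup>2 / 2" for \<phi>
  have cs: "(cos \<phi>)\<^sup>2 = 1 - (sin \<phi>)\<^sup>2" for \<phi> :: real by (rule cos_squared_eq)
  have "(F has_real_derivative c + (a * (cos \<phi>)\<^sup>2 + b * (sin \<phi>)\<^sup>2 + e * (cos \<phi> * sin \<phi>))) (at \<phi> within A)" for \<phi> A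
    unfolding F_def
    by (rule derivative_eq_intros refl | simp)+
      (simp add: cs field_simps flip: power2_eq_square)
  then have "((\<lambda>\<phi>. c + (a * (cos \<phi>)\<^sup>2 + b * (sin \<phi>)\<^sup>2 + e * (cos \<phi> * sin \<phi>))) has_integral (F (2*pi) - F 0)) {0..2*pi}"
    by (intro fundamental_theorem_of_calculus) (auto simp flip: has_real_derivative_iff_has_vector_derivative)
  moreover have "F (2*pi) - F 0 = 2 * pi * c + pi * (a + b)" by (simp add: F_def field_simps)
  ultimately show "((\<lambda>\<phi>. c + (a * (cos \<phi>)\<^sup>2 + b * (sin \<phi>)\<^sup>2 + e * (cos \<phi> * sin \<phi>))) has_integral (2 * pi * c + pi * (a + b))) {0..2*pi}"
    by simp
qed

lemma integral_Qbox_iterated: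
  fixes h :: "real \<times> real \<Rightarrow> real"
  assumes "continuous_on Qbox h" "\<And>v. v \<in> {-1..1} \<Longrightarrow> ((\<lambda>\<phi>. h (v, \<phi>)) has_integral g v) {0..2*pi}"
  shows "integral Qbox h = integral {-1..1} g"
proof -
  have "integral Qbox h = integral (cbox (-1) 1) (\<lambda>v. integral (cbox 0 (2 * pi)) (\<lambda>\<phi>. h (v, \<phi>)))"
    using assms(1) unfolding Qbox_def by (rule integral_prod_continuous)
  also have "\<dots> = integral {-1..1} g"
    unfolding cbox_interval by (intro Henstock_Kurzweil_Integration.integral_cong integral_unique assms(2))
  finally show ?thesis .
qed

section \<open>Collapse of the shells onto the segment\<close>

context focal_frame
begin

text \<open>The limit of \<open>Z p (v, \<phi>)\<close> as \<open>p\<close> decreases to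
  \<open>d\<close>: the angle disappears and \<open>v\<close> becomes an affine parameter, with
  \<open>x\<close> at -1 and \<open>y\<close> at 1.\<close>

definition axis_pt :: "real \<Rightarrow> real^3" where
  "axis_pt v = x + ((1 + v) / 2) *\<^sub>R (y - x)"

lemma axis_pt_eq: "axis_pt v = x + (d / 2) *\<^sub>R e1 + (d * v / 2) *\<^sub>R e1"
  unfolding axis_pt_def foci by (simp add: algebra_simps add_divide_distrib)

lemma e1_norm: "norm e1 = 1"
  using frame by (simp add: orthonormal3_def)

lemma continuous_on_axis_pt: "continuous_on S axis_pt"
  unfolding axis_pt_def by (intro continuous_intros) auto

lemma axis_pt_deriv:
  assumes "g \<in> C1"
  shows "((\<lambda>v. g (axis_pt v)) has_real_derivative (d / 2) * (grad g (axis_pt v) \<bullet> e1)) (at v within S)"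
proof -
  have "(axis_pt has_derivative (\<lambda>h. (h * (d / 2)) *\<^sub>R e1)) (at v)"
    unfolding axis_pt_eq[abs_def] by (auto intro!: derivative_eq_intros simp: fun_eq_iff)
  from has_derivative_compose[OF this C1_has_derivative[OF assms]]
  have "((\<lambda>v. g (axis_pt v)) has_derivative (\<lambda>h. grad g (axis_pt v) \<bullet> ((h * (d / 2)) *\<^sub>R e1))) (at v)" .
  then have "((\<lambda>v. g (axis_pt v)) has_real_derivative (d / 2) * (grad g (axis_pt v) \<bullet> e1)) (at v)"
    unfolding has_field_derivative_def by (rule has_derivative_eq_rhs) (simp add: fun_eq_iff)
  then show ?thesis by (rule has_field_derivative_at_within)
qed

lemma grad_axis_pt_deriv:
  assumes "\<alpha> \<in> C2"
  shows "((\<lambda>v. grad \<alpha> (axis_pt v) \<bullet> e1) has_real_derivative (d / 2) * hess \<alpha> (axis_pt v) e1 e1) (at v within S)"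
proof -
  have "(axis_pt has_derivative (\<lambda>h. (h * (d / 2)) *\<^sub>R e1)) (at v)"
    unfolding axis_pt_eq[abs_def] by (auto intro!: derivative_eq_intros simp: fun_eq_iff)
  from has_derivative_compose[OF this grad_inner_has_derivative[OF assms]]
  have "((\<lambda>v. grad \<alpha> (axis_pt v) \<bullet> e1) has_derivative (\<lambda>h. hess \<alpha> (axis_pt v) ((h * (d / 2)) *\<^sub>R e1) e1)) (at v)" .
  moreover have h: "hess \<alpha> z (c *\<^sub>R e1) e1 = c * hess \<alpha> z e1 e1" for z c
    by (simp add: hess_def sum_distrib_left mult_ac)
  ultimately have "((\<lambda>v. grad \<alpha> (axis_pt v) \<bullet> e1) has_real_derivative (d / 2) * hess \<alpha> (axis_pt v) e1 e1) (at v)"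
    unfolding has_field_derivative_def by (rule_tac has_derivative_eq_rhs) (auto simp: fun_eq_iff h)
  then show ?thesis by (rule has_field_derivative_at_within)
qed

lemma Z_tendsto_axis: "((\<lambda>p. Z p (v, \<phi>)) \<longlongrightarrow> axis_pt v) (at d within S)"
proof -
  have "((\<lambda>p. Z p (v, \<phi>)) \<longlongrightarrow> Z d (v, \<phi>)) (at d within S)"
    unfolding Z_eq by (intro tendsto_intros) auto
  moreover have "Z d (v, \<phi>) = axis_pt v" by (simp add: Z_eq axis_pt_eq)
  ultimately show ?thesis by simp
qed

text \<open>Seen from \<open>y\<close>, every other point of the segment lies in direction
  \<open>- e1\<close>, so the limit integrand is minus the tangential derivative of \<rho>. The
  constant \<open>4 * pi / d\<close> is \<open>2 * pi\<close> from the angle times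
  \<open>2 / d\<close> from differentiating in \<open>v\<close> instead of arc length.\<close>

lemma radial_shell_mean_limit:
  assumes d: "d > 0" and \<rho>: "\<rho> \<in> C1" "compact (supp \<rho>)"
  shows "(shell_mean (radial \<rho> y) \<longlongrightarrow> - (4 * pi / d) * (\<rho> y - \<rho> x)) (at_right d)"
proof -
  define n where "n = radial \<rho> y"
  obtain Mr where Mr: "Mr \<ge> 0" "\<And>y z. \<bar>radial \<rho> y z\<bar> \<le> Mr" using radial_bounded[OF \<rho>] by blast
  then have nb: "\<bar>n z\<bar> \<le> Mr" for z by (simp add: n_def)
  have n[measurable]: "n \<in> borel_measurable borel" unfolding n_def by (rule radial_borel[OF \<rho>(1)])
  have nZ[measurable]: "(\<lambda>w. n (Z p w)) \<in> borel_measurable borel" for p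
    by (rule measurable_compose[OF Z_measurable n])
  have cg: "continuous_on S (\<lambda>w. grad \<rho> (axis_pt (fst w)) \<bullet> e1)" for S :: "(real \<times> real) set"
    by (intro continuous_intros continuous_on_compose2[OF grad_continuous[OF \<rho>(1), of UNIV]]
        continuous_on_compose2[OF continuous_on_axis_pt[of UNIV]]) auto
  have [measurable]: "(\<lambda>w. grad \<rho> (axis_pt (fst w)) \<bullet> e1) \<in> borel_measurable (borel :: (real \<times> real) measure)"
    by (intro borel_measurable_continuous_onI cg)
  have "((\<lambda>p. LINT w|lborel. indicator Qbox w *\<^sub>R n (Z p w)) \<longlongrightarrow>
      (LINT w|lborel. indicator Qbox w *\<^sub>R (- (grad \<rho> (axis_pt (fst w)) \<bullet> e1)))) (at_right d)"
  proof (rule tendsto_integral_dominated[where g = "\<lambda>w. indicator Qbox w * Mr"])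
    show "integrable lborel (\<lambda>w. indicator Qbox w * Mr)"
      using set_integrable_Qbox(1)[of "\<lambda>_. Mr"] by (simp add: set_integrable_def)
    show "\<bar>indicator Qbox w *\<^sub>R n (Z p w)\<bar> \<le> indicator Qbox w * Mr" for p w
      using nb[of "Z p w"] by (auto simp: indicator_def)
    show "AE w in lborel. ((\<lambda>p. indicator Qbox w *\<^sub>R n (Z p w)) \<longlongrightarrow> indicator Qbox w *\<^sub>R - (grad \<rho> (axis_pt (fst w)) \<bullet> e1)) (at_right d)"
      \<comment> \<open>Needed to discard \<open>v = 1\<close>, where the limit point is
        \<open>y\<close> itself and \<open>radial\<close> is discontinuous.\<close>
      using AE_Qbox
    proof eventually_elim
      case (elim w)
      obtain v \<phi> where w: "w = (v, \<phi>)" by (cases w)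
      show ?case
      proof (cases "w \<in> Qbox")
        case True
        with elim have v: "v < 1" by (auto simp: w indicator_def split: if_splits)
        have ay: "axis_pt v - y = ((v - 1) * d / 2) *\<^sub>R e1"
        proof -
          have "axis_pt v - y = ((1 + v) / 2 - 1) *\<^sub>R (y - x)"
          proof -
            have "x + A - y = A - (y - x)" for A :: "real^3" by (simp add: algebra_simps)
            then show ?thesis unfolding axis_pt_def scaleR_left_diff_distrib by simp
          qed
          also have "\<dots> = ((v - 1) * d / 2) *\<^sub>R e1" unfolding foci by (simp add: field_simps)
          finally show ?thesis .
        qed
        have na: "norm (axis_pt v - y) = (1 - v) * d / 2" 
        proof -
          have "\<bar>(v - 1) * d\<bar> = (1 - v) * d" using v d by (simp add: abs_mult)
          then show ?thesis unfolding ay by (simp add: e1_norm)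
        qed
        have ne: "norm (axis_pt v - y) \<noteq> 0" unfolding na using v d by simp
        have "isCont n (axis_pt v)"
        proof -
          have "isCont (\<lambda>q. radial \<rho> (fst q) (snd q)) (y, axis_pt v)"
            using ne by (intro radial_isCont \<rho>(1)) auto
          moreover have "isCont (\<lambda>z. (y, z)) (axis_pt v)" by (intro continuous_intros)
          ultimately show ?thesis unfolding n_def using isCont_o2[of "axis_pt v" "\<lambda>z. (y, z)"] by fastforce
        qed
        from isCont_tendsto_compose[OF this Z_tendsto_axis]
        have "((\<lambda>p. n (Z p w)) \<longlongrightarrow> n (axis_pt v)) (at_right d)" unfolding w .
        moreover have "(axis_pt v - y) /\<^sub>R norm (axis_pt v - y) = - e1"
        proof -
          have "inverse ((1 - v) * d / 2) * ((v - 1) * d / 2) = -1" using v d by (simp add: field_simps)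
          then show ?thesis unfolding na unfolding ay scaleR_scaleR by (simp only: scaleR_minus1_left)
        qed
        then have "n (axis_pt v) = - (grad \<rho> (axis_pt v) \<bullet> e1)" by (simp add: n_def radial_def)
        ultimately show ?thesis using True by (simp add: w)
      qed simp
    qed
  qed measurable
  moreover have "(LINT w|lborel. indicator Qbox w *\<^sub>R (- (grad \<rho> (axis_pt (fst w)) \<bullet> e1))) = - (4 * pi / d) * (\<rho> y - \<rho> x)"
  proof -
    have "(LINT w|lborel. indicator Qbox w *\<^sub>R (- (grad \<rho> (axis_pt (fst w)) \<bullet> e1))) = integral Qbox (\<lambda>w. - (grad \<rho> (axis_pt (fst w)) \<bullet> e1))"
      using set_integrable_Qbox(2)[of "\<lambda>w. - (grad \<rho> (axis_pt (fst w)) \<bullet> e1)"] cg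
      by (simp add: set_lebesgue_integral_def continuous_on_minus)
    also have "\<dots> = integral {-1..1} (\<lambda>v. 2 * pi * (- (grad \<rho> (axis_pt v) \<bullet> e1)))"
    proof (rule integral_Qbox_iterated)
      show "((\<lambda>\<phi>. - (grad \<rho> (axis_pt (fst (v, \<phi>))) \<bullet> e1)) has_integral 2 * pi * - (grad \<rho> (axis_pt v) \<bullet> e1)) {0..2 * pi}" for v
        using has_integral_const_real[of "- (grad \<rho> (axis_pt v) \<bullet> e1)" 0 "2 * pi"] by simp
    qed (intro continuous_on_minus cg)
    also have "\<dots> = - (4 * pi / d) * (\<rho> y - \<rho> x)"
    proof (rule integral_unique)
      have "((\<lambda>v. (d / 2) * (grad \<rho> (axis_pt v) \<bullet> e1)) has_integral (\<rho> (axis_pt 1) - \<rho> (axis_pt (-1)))) {-1..1}"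
      proof (rule fundamental_theorem_of_calculus)
        show "((\<lambda>v. \<rho> (axis_pt v)) has_vector_derivative (d / 2) * (grad \<rho> (axis_pt v) \<bullet> e1)) (at v within {-1..1})" for v
          by (rule axis_pt_deriv[OF \<rho>(1), unfolded has_real_derivative_iff_has_vector_derivative])
      qed simp
      then have "((\<lambda>v. - (4 * pi / d) * ((d / 2) * (grad \<rho> (axis_pt v) \<bullet> e1))) has_integral - (4 * pi / d) * (\<rho> (axis_pt 1) - \<rho> (axis_pt (-1)))) {-1..1}"
        by (rule has_integral_mult_right)
      moreover have "axis_pt 1 = y" "axis_pt (-1) = x" by (simp_all add: axis_pt_def)
      moreover have "- (4 * pi / d) * ((d / 2) * X) = 2 * pi * (- X)" for X using d by (simp add: field_simps)
      ultimately show "((\<lambda>v. 2 * pi * (- (grad \<rho> (axis_pt v) \<bullet> e1))) has_integral - (4 * pi / d) * (\<rho> y - \<rho> x)) {-1..1}"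
        by (simp only:)
    qed
    finally show ?thesis .
  qed
  ultimately show ?thesis
    unfolding shell_mean_def[abs_def] set_lebesgue_integral_def n_def by simp
qed


definition omega :: "real \<Rightarrow> real^3" where
  "omega \<phi> = cos \<phi> *\<^sub>R e2 + sin \<phi> *\<^sub>R e3"

definition rad :: "real \<Rightarrow> real \<Rightarrow> real" where
  "rad p v = sqrt (p\<^sup>2 - d\<^sup>2) * sqrt (1 - v\<^sup>2) / 2"

text \<open>Centre of the circle of radius \<open>rad p v\<close> described by
  \<open>Z p (v, \<phi>)\<close> as \<phi> varies. It lies on the axis, displaced from
  \<open>axis_pt v\<close> by \<open>(p - d) * v / 2\<close> along \<open>e1\<close>.\<close>

definition mid :: "real \<Rightarrow> real \<Rightarrow> real^3" where
  "mid p v = x + (d / 2) *\<^sub>R e1 + (p * v / 2) *\<^sub>R e1"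

lemma Z_mid: "Z p (v, \<phi>) = mid p v + rad p v *\<^sub>R omega \<phi>"
  by (simp add: Z_eq mid_def rad_def omega_def)

lemma norm_omega: "norm (omega \<phi>) = 1"
proof -
  have "(norm (omega \<phi>))\<^sup>2 = 1"
    using norm_frame[of 0 "cos \<phi>" "sin \<phi>"] by (simp add: omega_def)
  then show ?thesis using norm_ge_zero[of "omega \<phi>"] by (simp add: power2_eq_1_iff)
qed

text \<open>The two mixed terms stay separate instead of being identified by symmetry; their common
  factor \<open>cos \<phi> * sin \<phi>\<close> has mean 0 over the circle.\<close>

lemma hess_omega: "hess \<alpha> z (omega \<phi>) (omega \<phi>) = hess \<alpha> z e2 e2 * (cos \<phi>)\<^sup>2 + hess \<alpha> z e3 e3 * (sin \<phi>)\<^sup>2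
    + (hess \<alpha> z e2 e3 + hess \<alpha> z e3 e2) * (cos \<phi> * sin \<phi>)"
  unfolding hess_def omega_def
  by (simp add: inner_add_right sum_3 algebra_simps power2_eq_square)

lemma mvt_omega:
  assumes \<alpha>: "\<alpha> \<in> C2" and k: "k \<ge> 0"
  shows "\<exists>\<xi>. 0 \<le> \<xi> \<and> \<xi> \<le> k \<and> (grad \<alpha> (c + k *\<^sub>R omega \<phi>) - grad \<alpha> c) \<bullet> omega \<phi> =
    k * hess \<alpha> (c + \<xi> *\<^sub>R omega \<phi>) (omega \<phi>) (omega \<phi>)"
proof (cases "k = 0")
  case False
  then have "0 < k" using k by simp
  have h: "hess \<alpha> z (s *\<^sub>R u) w = s * hess \<alpha> z u w" for z s u w
    by (simp add: hess_def sum_distrib_left mult_ac)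
  have der: "((\<lambda>s. grad \<alpha> (c + s *\<^sub>R omega \<phi>) \<bullet> omega \<phi>) has_real_derivative
      hess \<alpha> (c + s *\<^sub>R omega \<phi>) (omega \<phi>) (omega \<phi>)) (at s)" for s
  proof -
    have "((\<lambda>s. c + s *\<^sub>R omega \<phi>) has_derivative (\<lambda>h. h *\<^sub>R omega \<phi>)) (at s)"
      by (auto intro!: derivative_eq_intros)
    from has_derivative_compose[OF this grad_inner_has_derivative[OF \<alpha>]]
    show ?thesis unfolding has_field_derivative_def
      by (rule has_derivative_eq_rhs) (auto simp: fun_eq_iff h)
  qed
  obtain \<xi> where "0 < \<xi>" "\<xi> < k" "grad \<alpha> (c + k *\<^sub>R omega \<phi>) \<bullet> omega \<phi> - grad \<alpha> (c + 0 *\<^sub>R omega \<phi>) \<bullet> omega \<phi>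
      = (k - 0) * hess \<alpha> (c + \<xi> *\<^sub>R omega \<phi>) (omega \<phi>) (omega \<phi>)"
    using MVT2[OF \<open>0 < k\<close> der] by blast
  then show ?thesis by (intro exI[of _ \<xi>]) (simp add: inner_diff_left)
qed auto

lemma integral_perp_zero:
  assumes c: "continuous_on {-1..1} a" "continuous_on {-1..1} b"
  shows "integral Qbox (\<lambda>w. a (fst w) * cos (snd w) + b (fst w) * sin (snd w)) = (0::real)"
proof -
  have "fst ` Qbox \<subseteq> {-1..1}" by (auto simp: Qbox_iff)
  then have "continuous_on Qbox (\<lambda>w. a (fst w) * cos (snd w) + b (fst w) * sin (snd w))"
    by (intro continuous_intros continuous_on_compose2[OF c(1)] continuous_on_compose2[OF c(2)]) auto
  then have "integral Qbox (\<lambda>w. a (fst w) * cos (snd w) + b (fst w) * sin (snd w)) = integral {-1..1} (\<lambda>v::real. 0)"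
    by (rule integral_Qbox_iterated) (simp add: integral_trig_period(1))
  then show ?thesis by simp
qed

text \<open>As \<open>p\<close> decreases to \<open>d\<close>, the derivative of the shell radius blows up like \<open>(p^2 - d^2) powr (-1/2)\<close>.
  Subtracting the gradient on the axis, whose component along \<open>omega \<phi>\<close> has mean 0 over the circle,
  leaves a difference that the mean value theorem turns into a bounded second derivative. The
  remaining first order term is integrated by parts along the axis, which completes the transversal
  second derivatives to the Laplacian.\<close>

lemma shell_mean_derivative_limit:
  assumes d: "d > 0" and \<alpha>: "\<alpha> \<in> C2" "compact (supp \<alpha>)"
  shows "((\<lambda>p. integral Qbox (\<lambda>w. grad \<alpha> (Z p w) \<bullet> dZ p w)) \<longlongrightarrow>
    2 * pi * d * segment_mean \<alpha> x y) (at_right d)"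
proof -
  note \<alpha>1 = C2_C1(1)[OF \<alpha>(1)]
  obtain Mg where Mg: "Mg \<ge> 0" "\<And>z. norm (grad \<alpha> z) \<le> Mg"
    using bounded_compact_support[OF grad_continuous[OF \<alpha>1] \<alpha>(2) grad_eq_0[of _ \<alpha>]] by metis
  obtain Mh where Mh: "Mh \<ge> 0" "\<And>z h u. norm h \<le> 1 \<Longrightarrow> norm u \<le> 1 \<Longrightarrow> \<bar>hess \<alpha> z h u\<bar> \<le> Mh"
    using hess_bounded[OF \<alpha>] by blast
  \<comment> \<open>\<open>E\<close> is the integrand with its singular part of mean 0 (the
    \<open>G\<close> below) removed; \<open>E0\<close> is its pointwise limit on the
    segment.\<close>
  define E where "E p w = (fst w / 2) * (grad \<alpha> (Z p w) \<bullet> e1) +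
      p / sqrt (p\<^sup>2 - d\<^sup>2) * sqrt (1 - (fst w)\<^sup>2) / 2 * ((grad \<alpha> (Z p w) - grad \<alpha> (mid p (fst w))) \<bullet> omega (snd w))" for p w
  define E0 where "E0 w = (fst w / 2) * (grad \<alpha> (axis_pt (fst w)) \<bullet> e1) +
      d * (1 - (fst w)\<^sup>2) / 4 * hess \<alpha> (axis_pt (fst w)) (omega (snd w)) (omega (snd w))" for w
  have cgr: "continuous_on S f \<Longrightarrow> continuous_on S (\<lambda>q. grad \<alpha> (f q))" for S :: "(real \<times> real) set" and f
    by (rule continuous_on_compose2[OF grad_continuous[OF \<alpha>1, of UNIV]]) auto
  have cZ: "continuous_on S (Z p)" for S p
  proof -
    have "continuous_on S ((\<lambda>(p, w). Z p w) \<circ> Pair p)"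
      by (intro continuous_on_compose continuous_on_Z continuous_intros)
    then show ?thesis by (simp add: comp_def)
  qed
  have co: "continuous_on S (\<lambda>w. omega (snd w))" for S :: "(real \<times> real) set"
    unfolding omega_def by (intro continuous_intros)
  have cm: "continuous_on S (\<lambda>w. mid p (fst w))" for S :: "(real \<times> real) set" and p
    unfolding mid_def by (intro continuous_intros) auto
  have ca: "continuous_on S (\<lambda>w. axis_pt (fst w))" for S :: "(real \<times> real) set"
    by (intro continuous_on_compose2[OF continuous_on_axis_pt[of UNIV]] continuous_intros) auto
  have cE: "continuous_on S (E p)" if "p > d" for S p
  proof -
    have "sqrt (p\<^sup>2 - d\<^sup>2) \<noteq> 0" using that d by (simp add: power2_eq_iff)
    then show ?thesis unfolding E_def[abs_def] by (intro continuous_intros cgr cZ co cm) auto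
  qed
  have cE0: "continuous_on S E0" for S
    unfolding E0_def[abs_def] by (intro continuous_intros cgr ca co hess_continuous[OF \<alpha>(1)]) auto
  have eq: "integral Qbox (\<lambda>w. grad \<alpha> (Z p w) \<bullet> dZ p w) = (LINT w|lborel. indicator Qbox w *\<^sub>R E p w)" if p: "p > d" for p
  proof -
    have s: "sqrt (p\<^sup>2 - d\<^sup>2) \<noteq> 0" using p d by (simp add: power2_eq_iff)
    define q where "q v = p / sqrt (p\<^sup>2 - d\<^sup>2) * sqrt (1 - v\<^sup>2) / 2" for v
    define G where "G w = (q (fst w) * (grad \<alpha> (mid p (fst w)) \<bullet> e2)) * cos (snd w)
        + (q (fst w) * (grad \<alpha> (mid p (fst w)) \<bullet> e3)) * sin (snd w)" for w
    have cq: "continuous_on S q" for S unfolding q_def using s by (intro continuous_intros) auto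
    have cmid: "continuous_on S (\<lambda>v. grad \<alpha> (mid p v))" for S
    proof (rule continuous_on_compose2[OF grad_continuous[OF \<alpha>1, of UNIV]])
      show "continuous_on S (mid p)" unfolding mid_def[abs_def] by (intro continuous_intros) auto
    qed auto
    have G0: "integral Qbox G = 0" unfolding G_def[abs_def]
      by (intro integral_perp_zero[of "\<lambda>v. q v * (grad \<alpha> (mid p v) \<bullet> e2)" "\<lambda>v. q v * (grad \<alpha> (mid p v) \<bullet> e3)"]
          continuous_intros cq cmid)
    have cG: "continuous_on Qbox G" unfolding G_def
      by (intro continuous_intros continuous_on_compose2[OF cq[of UNIV]] continuous_on_compose2[OF cmid[of UNIV]]) auto
    have "grad \<alpha> (Z p w) \<bullet> dZ p w = E p w + G w" for w
    proof -
      have "dZ p w = (fst w / 2) *\<^sub>R e1 + q (fst w) *\<^sub>R omega (snd w)" by (simp add: dZ_def q_def omega_def)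
      moreover have "E p w = (fst w / 2) * (grad \<alpha> (Z p w) \<bullet> e1) + q (fst w) * ((grad \<alpha> (Z p w) - grad \<alpha> (mid p (fst w))) \<bullet> omega (snd w))"
        by (simp add: E_def q_def)
      moreover have "G w = q (fst w) * (grad \<alpha> (mid p (fst w)) \<bullet> omega (snd w))"
        by (simp add: G_def omega_def inner_add_right algebra_simps)
      ultimately show ?thesis by (simp add: inner_add_right inner_diff_left right_diff_distrib)
    qed
    then have "integral Qbox (\<lambda>w. grad \<alpha> (Z p w) \<bullet> dZ p w) = integral Qbox (\<lambda>w. E p w + G w)" by simp
    also have "\<dots> = integral Qbox (E p) + integral Qbox G"
      using cE[OF p, of Qbox] cG unfolding Qbox_def
      by (intro Henstock_Kurzweil_Integration.integral_add integrable_continuous)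
    also have "\<dots> = (LINT w|lborel. indicator Qbox w *\<^sub>R E p w)"
      using set_integrable_Qbox(2)[OF cE[OF p]] by (simp add: G0 set_lebesgue_integral_def)
    finally show ?thesis .
  qed
  have "\<exists>\<xi>. 0 \<le> \<xi> \<and> \<xi> \<le> rad p v \<and> (grad \<alpha> (Z p (v, \<phi>)) - grad \<alpha> (mid p v)) \<bullet> omega \<phi> =
    rad p v * hess \<alpha> (mid p v + \<xi> *\<^sub>R omega \<phi>) (omega \<phi>) (omega \<phi>)" if "p > d" "\<bar>v\<bar> \<le> 1" for p v \<phi>
  proof -
    have "p\<^sup>2 - d\<^sup>2 \<ge> 0" "1 - v\<^sup>2 \<ge> 0" using that d by (auto simp: power_mono abs_square_le_1)
    then have "rad p v \<ge> 0" unfolding rad_def by simp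
    from mvt_omega[OF \<alpha>(1) this] show ?thesis unfolding Z_mid .
  qed
  then obtain \<xi> where \<xi>: "\<And>p v \<phi>. p > d \<Longrightarrow> \<bar>v\<bar> \<le> 1 \<Longrightarrow> 0 \<le> \<xi> p v \<phi> \<and> \<xi> p v \<phi> \<le> rad p v \<and>
      (grad \<alpha> (Z p (v, \<phi>)) - grad \<alpha> (mid p v)) \<bullet> omega \<phi> =
      rad p v * hess \<alpha> (mid p v + \<xi> p v \<phi> *\<^sub>R omega \<phi>) (omega \<phi>) (omega \<phi>)"
    by metis
  have E\<xi>: "E p (v, \<phi>) = (v / 2) * (grad \<alpha> (Z p (v, \<phi>)) \<bullet> e1) +
      p * (1 - v\<^sup>2) / 4 * hess \<alpha> (mid p v + \<xi> p v \<phi> *\<^sub>R omega \<phi>) (omega \<phi>) (omega \<phi>)"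
    if p: "p > d" and v: "\<bar>v\<bar> \<le> 1" for p v \<phi>
  proof -
    have "sqrt (p\<^sup>2 - d\<^sup>2) \<noteq> 0" using p d by (simp add: power2_eq_iff)
    moreover have "sqrt (1 - v\<^sup>2) * sqrt (1 - v\<^sup>2) = 1 - v\<^sup>2" using v by (simp add: abs_square_le_1)
    \<comment> \<open>The radius contains exactly the factor by which the velocity is singular, so
      the product stays bounded.\<close>
    ultimately have "p / sqrt (p\<^sup>2 - d\<^sup>2) * sqrt (1 - v\<^sup>2) / 2 * rad p v = p * (1 - v\<^sup>2) / 4"
      unfolding rad_def by (simp add: field_simps)
    moreover have "E p (v, \<phi>) = (v / 2) * (grad \<alpha> (Z p (v, \<phi>)) \<bullet> e1) +
      p / sqrt (p\<^sup>2 - d\<^sup>2) * sqrt (1 - v\<^sup>2) / 2 * (rad p v * hess \<alpha> (mid p v + \<xi> p v \<phi> *\<^sub>R omega \<phi>) (omega \<phi>) (omega \<phi>))"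
      using \<xi>[OF p v, of \<phi>] unfolding E_def by simp
    ultimately show ?thesis by (simp only: mult.assoc[symmetric])
  qed
  let ?B = "1/2 * Mg + (d + 1) / 4 * Mh"
  \<comment> \<open>The window of length 1 only bounds \<open>p\<close> by \<open>d + 1\<close> in
    the majorant; it does not change the right-hand limit.\<close>
  have "((\<lambda>p. LINT w|lborel. indicator Qbox w *\<^sub>R E p w) \<longlongrightarrow> (LINT w|lborel. indicator Qbox w *\<^sub>R E0 w)) (at d within {d<..<d+1})"
  proof (rule tendsto_integral_dominated[where g = "\<lambda>w. indicator Qbox w * ?B"])
    show "integrable lborel (\<lambda>w. indicator Qbox w * ?B)"
      using set_integrable_Qbox(1)[of "\<lambda>_. ?B"] by (simp add: set_integrable_def)
    show "(\<lambda>w. indicator Qbox w *\<^sub>R E p w) \<in> borel_measurable lborel" if "p \<in> {d<..<d+1}" for p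
    proof -
      have [measurable]: "E p \<in> borel_measurable borel"
        using that by (intro borel_measurable_continuous_onI cE) auto
      show ?thesis by measurable
    qed
    have [measurable]: "E0 \<in> borel_measurable borel" by (intro borel_measurable_continuous_onI cE0)
    show "(\<lambda>w. indicator Qbox w *\<^sub>R E0 w) \<in> borel_measurable lborel" by measurable
    show "\<bar>indicator Qbox w *\<^sub>R E p w\<bar> \<le> indicator Qbox w * ?B" if "p \<in> {d<..<d+1}" for p w
    proof (cases "w \<in> Qbox")
      case True
      obtain v \<phi> where w: "w = (v, \<phi>)" by (cases w)
      have v: "\<bar>v\<bar> \<le> 1" using True by (auto simp: w Qbox_iff)
      have p: "p > d" "p \<le> d + 1" using that by auto
      have "\<bar>grad \<alpha> (Z p w) \<bullet> e1\<bar> \<le> Mg * 1"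
        using Mg e1_norm by (intro order_trans[OF Cauchy_Schwarz_ineq2] mult_mono) auto
      then have 1: "\<bar>v / 2 * (grad \<alpha> (Z p w) \<bullet> e1)\<bar> \<le> 1/2 * Mg"
        unfolding abs_mult using v by (intro mult_mono) auto
      have "0 \<le> 1 - v\<^sup>2" "1 - v\<^sup>2 \<le> 1" using v by (auto simp: abs_square_le_1)
      then have "p * (1 - v\<^sup>2) \<le> (d + 1) * 1" using p d by (intro mult_mono) auto
      moreover have "0 \<le> p * (1 - v\<^sup>2)" using \<open>0 \<le> 1 - v\<^sup>2\<close> p d by simp
      ultimately have "\<bar>p * (1 - v\<^sup>2) / 4\<bar> \<le> (d + 1) / 4" by simp
      then have "\<bar>p * (1 - v\<^sup>2) / 4 * hess \<alpha> (mid p v + \<xi> p v \<phi> *\<^sub>R omega \<phi>) (omega \<phi>) (omega \<phi>)\<bar> \<le> (d + 1) / 4 * Mh"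
        unfolding abs_mult[of "p * (1 - v\<^sup>2) / 4"] using Mh(2)[of "omega \<phi>" "omega \<phi>"] norm_omega d by (intro mult_mono) auto
      then have "\<bar>E p w\<bar> \<le> ?B"
        using 1 abs_triangle_ineq[of "v / 2 * (grad \<alpha> (Z p w) \<bullet> e1)" "p * (1 - v\<^sup>2) / 4 * hess \<alpha> (mid p v + \<xi> p v \<phi> *\<^sub>R omega \<phi>) (omega \<phi>) (omega \<phi>)"]
        unfolding w E\<xi>[OF p(1) v] by linarith
      then show ?thesis using True by simp
    qed simp
    show "AE w in lborel. ((\<lambda>p. indicator Qbox w *\<^sub>R E p w) \<longlongrightarrow> indicator Qbox w *\<^sub>R E0 w) (at d within {d<..<d+1})"
    proof (rule AE_I2)
      fix w :: "real \<times> real"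
      let ?F = "at d within {d<..<d+1}"
      show "((\<lambda>p. indicator Qbox w *\<^sub>R E p w) \<longlongrightarrow> indicator Qbox w *\<^sub>R E0 w) ?F"
      proof (cases "w \<in> Qbox")
        case True
        obtain v \<phi> where w: "w = (v, \<phi>)" by (cases w)
        have v: "\<bar>v\<bar> \<le> 1" using True by (auto simp: w Qbox_iff)
        have ev: "\<forall>\<^sub>F p in ?F. p > d" by (auto simp: eventually_at_filter)
        have "((\<lambda>p. rad p v) \<longlongrightarrow> rad d v) ?F" unfolding rad_def by (intro tendsto_intros) auto
        then have r0: "((\<lambda>p. rad p v) \<longlongrightarrow> 0) ?F" by (simp add: rad_def)
        \<comment> \<open>The intermediate points were merely chosen and need not depend
          continuously on \<open>p\<close>; squeezing them between 0 and the vanishing radius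
          suffices.\<close>
        have x0: "((\<lambda>p. \<xi> p v \<phi>) \<longlongrightarrow> 0) ?F"
          by (rule tendsto_sandwich[OF _ _ tendsto_const r0]) (use \<xi>[OF _ v] in \<open>auto intro!: eventually_mono[OF ev]\<close>)
        have "((\<lambda>p. mid p v) \<longlongrightarrow> mid d v) ?F" unfolding mid_def by (intro tendsto_intros) auto
        then have "((\<lambda>p. mid p v + \<xi> p v \<phi> *\<^sub>R omega \<phi>) \<longlongrightarrow> mid d v + 0 *\<^sub>R omega \<phi>) ?F"
          by (intro tendsto_intros x0)
        then have m: "((\<lambda>p. mid p v + \<xi> p v \<phi> *\<^sub>R omega \<phi>) \<longlongrightarrow> axis_pt v) ?F"
          by (simp add: mid_def axis_pt_eq)
        have "isCont (\<lambda>z. hess \<alpha> z (omega \<phi>) (omega \<phi>)) (axis_pt v)"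
          using hess_continuous[OF \<alpha>(1) continuous_on_id continuous_on_const continuous_on_const, of UNIV]
          by (simp add: continuous_on_eq_continuous_at)
        note h = isCont_tendsto_compose[OF this m]
        have "isCont (grad \<alpha>) (axis_pt v)"
          using grad_continuous[OF \<alpha>1, of UNIV] by (simp add: continuous_on_eq_continuous_at)
        note g = isCont_tendsto_compose[OF this Z_tendsto_axis[of v \<phi> "{d<..<d+1}"]]
        have "((\<lambda>p. (v / 2) * (grad \<alpha> (Z p (v, \<phi>)) \<bullet> e1) +
            p * (1 - v\<^sup>2) / 4 * hess \<alpha> (mid p v + \<xi> p v \<phi> *\<^sub>R omega \<phi>) (omega \<phi>) (omega \<phi>)) \<longlongrightarrow> E0 w) ?F"
          unfolding E0_def w fst_conv snd_conv by (intro tendsto_intros h g) auto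
        then have "((\<lambda>p. E p w) \<longlongrightarrow> E0 w) ?F"
          by (rule Lim_transform_eventually) (auto simp: w E\<xi>[OF _ v] intro!: eventually_mono[OF ev])
        then show ?thesis using True by simp
      qed simp
    qed
  qed
  moreover have "(LINT w|lborel. indicator Qbox w *\<^sub>R E0 w) =
    2 * pi * d * segment_mean \<alpha> x y"
  proof -
    let ?a = "\<lambda>v. grad \<alpha> (axis_pt v) \<bullet> e1"
    let ?h = "\<lambda>v u. hess \<alpha> (axis_pt v) u u"
    let ?L = "\<lambda>v. laplacian \<alpha> (axis_pt v)"
    have "(LINT w|lborel. indicator Qbox w *\<^sub>R E0 w) = integral Qbox E0"
      using set_integrable_Qbox(2)[OF cE0] by (simp add: set_lebesgue_integral_def)
    also have "\<dots> = integral {-1..1} (\<lambda>v. 2 * pi * (v / 2 * ?a v) + pi * (d * (1 - v\<^sup>2) / 4 * ?h v e2 + d * (1 - v\<^sup>2) / 4 * ?h v e3))"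
    proof (rule integral_Qbox_iterated[OF cE0])
      fix v :: real
      have "E0 (v, \<phi>) = v / 2 * ?a v + (d * (1 - v\<^sup>2) / 4 * ?h v e2 * (cos \<phi>)\<^sup>2 + d * (1 - v\<^sup>2) / 4 * ?h v e3 * (sin \<phi>)\<^sup>2
          + d * (1 - v\<^sup>2) / 4 * (hess \<alpha> (axis_pt v) e2 e3 + hess \<alpha> (axis_pt v) e3 e2) * (cos \<phi> * sin \<phi>))" for \<phi>
        by (simp add: E0_def hess_omega algebra_simps)
      then show "((\<lambda>\<phi>. E0 (v, \<phi>)) has_integral 2 * pi * (v / 2 * ?a v) + pi * (d * (1 - v\<^sup>2) / 4 * ?h v e2 + d * (1 - v\<^sup>2) / 4 * ?h v e3)) {0..2 * pi}"
        by (simp only: integral_trig_period(2))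
    qed
    \<comment> \<open>The missing axial second derivative is added and subtracted. What is
      subtracted is a multiple of the derivative of
      \<open>(1 - v^2) * (grad \<alpha> (axis_pt v) \<bullet> e1)\<close>, which vanishes at both
      ends.\<close>
    also have "\<dots> = integral {-1..1} (\<lambda>v. pi * d / 4 * ((1 - v\<^sup>2) * ?L v) - pi / 2 * (-2 * v * ?a v + (1 - v\<^sup>2) * ((d / 2) * ?h v e1)))"
      by (intro Henstock_Kurzweil_Integration.integral_cong) (simp add: hess_trace[OF frame, symmetric] field_simps)
    also have "\<dots> = pi * d / 4 * integral {-1..1} (\<lambda>v. (1 - v\<^sup>2) * ?L v)"
    proof -
      have "((\<lambda>v. -2 * v * ?a v + (1 - v\<^sup>2) * ((d / 2) * ?h v e1)) has_integral (1 - 1\<^sup>2) * ?a 1 - (1 - (-1)\<^sup>2) * ?a (-1)) {-1..1}"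
      proof (rule fundamental_theorem_of_calculus)
        fix v :: real
        have "((\<lambda>v. (1 - v\<^sup>2) * ?a v) has_real_derivative -2 * v * ?a v + (1 - v\<^sup>2) * ((d / 2) * ?h v e1)) (at v within {-1..1})"
          by (rule derivative_eq_intros grad_axis_pt_deriv[OF \<alpha>(1)] refl)+ simp
        then show "((\<lambda>v. (1 - v\<^sup>2) * ?a v) has_vector_derivative -2 * v * ?a v + (1 - v\<^sup>2) * ((d / 2) * ?h v e1)) (at v within {-1..1})"
          by (simp only: has_real_derivative_iff_has_vector_derivative)
      qed simp
      then have "((\<lambda>v. -2 * v * ?a v + (1 - v\<^sup>2) * ((d / 2) * ?h v e1)) has_integral 0) {-1..1}" by simp
      from has_integral_mult_right[OF this, of "pi / 2"]
      have z: "((\<lambda>v. pi / 2 * (-2 * v * ?a v + (1 - v\<^sup>2) * ((d / 2) * ?h v e1))) has_integral 0) {-1..1}" by simp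
      have "continuous_on {-1..1} (\<lambda>v. (1 - v\<^sup>2) * ?L v)"
        by (intro continuous_intros continuous_on_compose2[OF laplacian_continuous[OF \<alpha>(1), of UNIV]] continuous_on_axis_pt) auto
      then have "((\<lambda>v. (1 - v\<^sup>2) * ?L v) has_integral integral {-1..1} (\<lambda>v. (1 - v\<^sup>2) * ?L v)) {-1..1}"
        by (intro integrable_integral integrable_continuous_interval)
      from has_integral_diff[OF has_integral_mult_right[OF this, of "pi * d / 4"] z]
      show ?thesis by (intro integral_unique) simp
    qed
    also have "integral {-1..1} (\<lambda>v. (1 - v\<^sup>2) * ?L v) = 8 * segment_mean \<alpha> x y"
    proof -
      have c: "continuous_on {0..1} (\<lambda>s. s * (1 - s) * laplacian \<alpha> (x + s *\<^sub>R (y - x)))"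
        by (intro continuous_intros continuous_on_compose2[OF laplacian_continuous[OF \<alpha>(1), of UNIV]]) auto
      then have "((\<lambda>s. s * (1 - s) * laplacian \<alpha> (x + s *\<^sub>R (y - x))) has_integral
          segment_mean \<alpha> x y) (cbox 0 1)"
        by (simp add: segment_mean_def integrable_integral integrable_continuous_interval)
      \<comment> \<open>Substitution \<open>s = (1 + v) / 2\<close>: here
        \<open>1 - v^2 = 4 s (1 - s)\<close> and \<open>dv = 2 ds\<close>, whence the factor
        8.\<close>
      from has_integral_affinity[OF this, of "1/2" "1/2"]
      have "((\<lambda>v. (1/2 * v + 1/2) * (1 - (1/2 * v + 1/2)) * laplacian \<alpha> (x + (1/2 * v + 1/2) *\<^sub>R (y - x))) has_integral
          2 * segment_mean \<alpha> x y) {-1..1}"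
        by (simp add: image_affinity_atLeastAtMost_diff)
      note has_integral_mult_right[OF this, of 4]
      moreover have "4 * ((1/2 * v + 1/2) * (1 - (1/2 * v + 1/2)) * laplacian \<alpha> (x + (1/2 * v + 1/2) *\<^sub>R (y - x))) = (1 - v\<^sup>2) * ?L v" for v
      proof -
        have ap: "x + (1/2 * v + 1/2) *\<^sub>R (y - x) = axis_pt v" by (simp add: axis_pt_def add_divide_distrib add.commute)
        show ?thesis unfolding ap by (simp add: field_simps power2_eq_square)
      qed
      ultimately show ?thesis by (intro integral_unique) (simp only:, simp)
    qed
    finally show ?thesis by simp
  qed
  ultimately have "((\<lambda>p. LINT w|lborel. indicator Qbox w *\<^sub>R E p w) \<longlongrightarrow>
    2 * pi * d * segment_mean \<alpha> x y) (at d within {d<..<d+1})"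
    by (simp only:)
  moreover have "at d within {d<..<d+1} = at_right d"
    by (rule at_within_nhd[of _ "{..<d+1}"]) auto
  ultimately have "((\<lambda>p. LINT w|lborel. indicator Qbox w *\<^sub>R E p w) \<longlongrightarrow>
    2 * pi * d * segment_mean \<alpha> x y) (at_right d)"
    by (simp only:)
  then show ?thesis
    by (rule Lim_transform_eventually) (auto simp: eq eventually_at_filter)
qed

end

lemma segment_integral_laplacian:
  assumes \<alpha>: "\<alpha> \<in> C2" and xy: "x \<noteq> y"
  shows "segment_integral x y (\<lambda>z. (1 - norm (z - x) / norm (y - x)) * norm (z - x) * (\<epsilon> * laplacian \<alpha> z)) =
    \<epsilon> * (norm (y - x))\<^sup>2 * segment_mean \<alpha> x y"
proof -
  let ?d = "norm (y - x)"
  have d: "?d > 0" using xy by simp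
  let ?I = "\<lambda>s. s * (1 - s) * laplacian \<alpha> (x + s *\<^sub>R (y - x))"
  have c: "continuous_on {0..1} ?I"
    by (intro continuous_intros continuous_on_compose2[OF laplacian_continuous[OF \<alpha>, of UNIV]]) auto
  have "(LINT s:{0..1}|lborel. (1 - norm (x + s *\<^sub>R (y - x) - x) / ?d) * norm (x + s *\<^sub>R (y - x) - x) * (\<epsilon> * laplacian \<alpha> (x + s *\<^sub>R (y - x))))
     = (LINT s:{0..1}|lborel. \<epsilon> * ?d * ?I s)"
    using d by (intro set_lebesgue_integral_cong) auto
  also have "\<dots> = \<epsilon> * ?d * (LINT s:{0..1}|lborel. ?I s)" by (rule set_integral_mult_right)
  also have "(LINT s:{0..1}|lborel. ?I s) = integral {0..1} ?I"
    unfolding segment_mean_def by (rule set_borel_integral_eq_integral(2)[OF borel_integrable_atLeastAtMost'[OF c]])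
  finally show ?thesis unfolding segment_integral_def segment_mean_def by (simp add: power2_eq_square)
qed

context focal_frame
begin

lemma integrable_potential:
  assumes "g \<in> borel_measurable borel" "\<And>z. \<bar>g z\<bar> \<le> Mb" "bounded S" "\<And>z. z \<notin> S \<Longrightarrow> g z = 0"
  shows "integrable lborel (\<lambda>z. g z / (norm (z - x) * norm (z - y)))"
proof (rule integrable_two_poles[OF _ _ assms(3), where C = Mb])
  have [measurable]: "g \<in> borel_measurable borel" by fact
  show "(\<lambda>z. g z / (norm (z - x) * norm (z - y))) \<in> borel_measurable borel" by measurable
  fix z assume z: "z \<noteq> x" "z \<noteq> y"
  have "\<bar>g z / (norm (z - x) * norm (z - y))\<bar> = \<bar>g z\<bar> * (1 / (norm (z - x) * norm (z - y)))"
    by (simp add: abs_mult)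
  also have "\<dots> \<le> Mb * poles x y z"
    using assms(2)[of z] z by (intro mult_mono inverse_le_poles) auto
  finally show "\<bar>g z / (norm (z - x) * norm (z - y))\<bar> \<le> Mb * poles x y z" .
qed (use assms in auto)

lemma integrable_potential2:
  assumes d: "d > 0" and "g \<in> borel_measurable borel" "\<And>z. \<bar>g z\<bar> \<le> Mb" "bounded S" "\<And>z. z \<notin> S \<Longrightarrow> g z = 0"
  shows "integrable lborel (\<lambda>z. g z / norm (z - y) / (norm (z - x) * norm (z - y)))"
proof (rule integrable_two_poles[OF _ _ assms(4), where C = "Mb * (2 / d)"])
  have [measurable]: "g \<in> borel_measurable borel" by fact
  show "(\<lambda>z. g z / norm (z - y) / (norm (z - x) * norm (z - y))) \<in> borel_measurable borel" by measurable
  fix z assume z: "z \<noteq> x" "z \<noteq> y"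
  have "\<bar>g z / norm (z - y) / (norm (z - x) * norm (z - y))\<bar> = \<bar>g z\<bar> * (1 / (norm (z - x) * (norm (z - y))\<^sup>2))"
    by (simp add: abs_mult power2_eq_square mult_ac)
  also have "\<dots> \<le> Mb * (2 / d * poles x y z)"
    using assms(3)[of z] z triangle d by (intro mult_mono inverse_square_le_poles) auto
  finally show "\<bar>g z / norm (z - y) / (norm (z - x) * norm (z - y))\<bar> \<le> Mb * (2 / d) * poles x y z"
    by (simp only: mult.assoc)
qed (use assms in auto)

lemma isCont_profile:
  assumes "continuous_on ({d<..} \<times> Qbox) (\<lambda>(p, w). g (Z p w))" "t > d"
  shows "isCont (profile g) t"
proof -
  have "isCont (shell_mean g) t"
    using shell_mean_continuous_on[OF assms(1)] assms(2) by (simp add: continuous_on_eq_continuous_at)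
  moreover have "\<forall>\<^sub>F p in nhds t. profile g p = shell_mean g p"
    using eventually_nhds_in_open[of "{d<..}" t] assms(2) by (auto elim!: eventually_mono simp: profile_def)
  ultimately show ?thesis using isCont_cong by metis
qed

lemma Z_neq_y: "p > d \<Longrightarrow> w \<in> Qbox \<Longrightarrow> Z p w \<noteq> y"
proof -
  assume p: "p > d" and w: "w \<in> Qbox"
  have "\<bar>fst w\<bar> \<le> 1" using w by (cases w) (auto simp: Qbox_iff)
  then have "d * fst w \<le> d * 1" using d_nonneg by (intro mult_left_mono) auto
  then have "norm (Z p w - y) > 0" unfolding norm_Z(2)[OF less_imp_le[OF p] w] using p by simp
  then show ?thesis by auto
qed

lemma continuous_on_radial_Z:
  assumes "\<rho> \<in> C1"
  shows "continuous_on ({d<..} \<times> Qbox) (\<lambda>(p, w). radial \<rho> y (Z p w))"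
    and "continuous_on ({d<..} \<times> Qbox) (\<lambda>(p, w). radial \<rho> y (Z p w) / norm (Z p w - y))"
proof -
  let ?Z = "\<lambda>q. (\<lambda>(p, w). Z p w) q"
  have cG: "continuous_on A (\<lambda>q. grad \<rho> (?Z q))" for A
    by (rule continuous_on_compose2[OF grad_continuous[OF assms, of UNIV] continuous_on_Z]) auto
  have ne: "\<forall>q\<in>{d<..} \<times> Qbox. norm (?Z q - y) \<noteq> 0" using Z_neq_y by auto
  have "continuous_on ({d<..} \<times> Qbox) (\<lambda>q. radial \<rho> y (?Z q))"
    unfolding radial_def using ne by (intro continuous_intros cG continuous_on_Z)
  moreover have "continuous_on ({d<..} \<times> Qbox) (\<lambda>q. radial \<rho> y (?Z q) / norm (?Z q - y))"
    unfolding radial_def using ne by (intro continuous_intros cG continuous_on_Z)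
  ultimately show "continuous_on ({d<..} \<times> Qbox) (\<lambda>(p, w). radial \<rho> y (Z p w))"
    "continuous_on ({d<..} \<times> Qbox) (\<lambda>(p, w). radial \<rho> y (Z p w) / norm (Z p w - y))"
    by (simp_all add: case_prod_unfold)
qed

text \<open>Everything in the kernel becomes a moment of three profiles. The last claim prepares the
  late limit: there the constant left by the \<rho> terms is a difference of moments, recognised as
  the Newtonian integral.\<close>

lemma K_profile:
  assumes d: "d > 0" and t: "t \<ge> d"
    and \<alpha>: "\<alpha> \<in> C1" "compact (supp \<alpha>)" and \<rho>: "\<rho> \<in> C1" "compact (supp \<rho>)"
  shows "integrable lborel (profile \<alpha>)" "integrable lborel (profile (radial \<rho> y))"
    "integrable lborel (profile (\<lambda>z. radial \<rho> y z / norm (z - y)))"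
    "K \<epsilon> \<alpha> \<rho> t x y = (t - d)\<^sup>2 / (8 * pi * d) * (1 - \<epsilon> * \<alpha> y) + \<epsilon> / (32 * pi\<^sup>2) *
      (integral {d..t} (profile \<alpha>) + integral {d..t} (\<lambda>p. (t - p) * profile (radial \<rho> y) p)
       + 1/2 * integral {d..t} (\<lambda>p. (t - p)\<^sup>2 * profile (\<lambda>z. radial \<rho> y z / norm (z - y)) p))"
    "(LINT z:ellipsoid t x y|lborel. radial \<rho> y z / (norm (z - y))\<^sup>2)
      = 1/2 * (integral {d..t} (\<lambda>p. p * profile (\<lambda>z. radial \<rho> y z / norm (z - y)) p) - integral {d..t} (profile (radial \<rho> y)))"
proof -
  obtain Ma where "Ma \<ge> 0" and "\<And>z. norm (\<alpha> z) \<le> Ma"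
    using bounded_compact_support[OF C1_continuous[OF \<alpha>(1)] \<alpha>(2) supp_zero[of _ \<alpha>]] by blast
  then have Ma: "\<bar>\<alpha> z\<bar> \<le> Ma" for z by simp
  obtain Mr where "Mr \<ge> 0" and Mr: "\<And>y z. \<bar>radial \<rho> y z\<bar> \<le> Mr" using radial_bounded[OF \<rho>] by blast
  have \<alpha>m: "\<alpha> \<in> borel_measurable borel" by (intro borel_measurable_continuous_onI C1_continuous \<alpha>)
  note r[measurable] = radial_borel[OF \<rho>(1), of y]
  have ia: "integrable lborel (\<lambda>z. \<alpha> z / (norm (z - x) * norm (z - y)))"
    by (rule integrable_potential[OF \<alpha>m Ma compact_imp_bounded[OF \<alpha>(2)]]) (auto simp: supp_zero)
  have ir: "integrable lborel (\<lambda>z. radial \<rho> y z / (norm (z - x) * norm (z - y)))"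
    by (rule integrable_potential[OF r Mr compact_imp_bounded[OF \<rho>(2)] radial_eq_0])
  let ?q = "\<lambda>z. radial \<rho> y z / norm (z - y)"
  have iq: "integrable lborel (\<lambda>z. ?q z / (norm (z - x) * norm (z - y)))"
    by (rule integrable_potential2[OF d r Mr compact_imp_bounded[OF \<rho>(2)] radial_eq_0])
  have q: "?q \<in> borel_measurable borel" by measurable
  note ea = ellipsoid_moment[OF \<alpha>m ia]
  note er = ellipsoid_moment[OF r ir]
  note eq = ellipsoid_moment[OF q iq]
  show pa: "integrable lborel (profile \<alpha>)" and pr: "integrable lborel (profile (radial \<rho> y))"
    and pq: "integrable lborel (profile ?q)" using ea(1) er(1) eq(1) by auto
  have nd: "norm (y - x) = d" using d e1_norm by (simp add: foci)
  then have xy: "x \<noteq> y" using d by auto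
  \<comment> \<open>The second inverse power of the distance to \<open>y\<close> is absorbed into
    the weight, so that only the product of focal distances remains to be cancelled by the
    Jacobian.\<close>
  have q2: "ellipsoid_integral 2 2 (radial \<rho> y) t x y = ellipsoid_integral 1 2 ?q t x y"
    unfolding ellipsoid_integral_def by (simp add: power2_eq_square[of "norm (_ - y)"] mult_ac)
  show "K \<epsilon> \<alpha> \<rho> t x y = (t - d)\<^sup>2 / (8 * pi * d) * (1 - \<epsilon> * \<alpha> y) + \<epsilon> / (32 * pi\<^sup>2) *
      (integral {d..t} (profile \<alpha>) + integral {d..t} (\<lambda>p. (t - p) * profile (radial \<rho> y) p)
       + 1/2 * integral {d..t} (\<lambda>p. (t - p)\<^sup>2 * profile ?q p))"
    using t xy unfolding K_ellipsoid_integrals[OF xy] q2 ea(3) er(3) eq(3) nd by (simp add: field_simps)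
  \<comment> \<open>With \<open>p\<close> the path length, \<open>|z - x| = p - |z - y|\<close>
    splits the integrand into \<open>p\<close> times the weight \<open>?q\<close> minus the weight
    \<open>radial\<close>, both over the product of focal distances. Writing \<open>p\<close> as
    \<open>t - (t - p)\<close> brings it into the form of \<open>ellipsoid_moment\<close>.\<close>
  have "(LINT z:ellipsoid t x y|lborel. radial \<rho> y z / (norm (z - y))\<^sup>2) =
    (LINT z:ellipsoid t x y|lborel. t * ((t - norm (z - x) - norm (z - y)) ^ 0 * ?q z / (norm (z - x) * norm (z - y)))
      - (t - norm (z - x) - norm (z - y)) ^ 1 * ?q z / (norm (z - x) * norm (z - y))
      - (t - norm (z - x) - norm (z - y)) ^ 0 * radial \<rho> y z / (norm (z - x) * norm (z - y)))"
    (is "_ = (LINT z:_|_. ?R z)")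
    unfolding set_lebesgue_integral_def
  proof (rule integral_cong_AE)
    show "AE z in lborel. indicator (ellipsoid t x y) z *\<^sub>R (radial \<rho> y z / (norm (z - y))\<^sup>2) = indicator (ellipsoid t x y) z *\<^sub>R ?R z"
      using AE_lborel_singleton[of x] AE_lborel_singleton[of y]
    proof eventually_elim
      case (elim z)
      then have "norm (z - x) > 0" "norm (z - y) > 0" by auto
      then have "radial \<rho> y z / (norm (z - y))\<^sup>2 = ?R z" by (simp add: field_simps power2_eq_square)
      then show ?case by simp
    qed
  qed measurable
  also have "\<dots> = t * (1/2 * integral {d..t} (profile ?q)) - 1/2 * integral {d..t} (\<lambda>p. (t - p) * profile ?q p) - 1/2 * integral {d..t} (profile (radial \<rho> y))"
  proof -
    let ?A = "\<lambda>z. (t - norm (z - x) - norm (z - y)) ^ 0 * ?q z / (norm (z - x) * norm (z - y))"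
    let ?B = "\<lambda>z. (t - norm (z - x) - norm (z - y)) ^ 1 * ?q z / (norm (z - x) * norm (z - y))"
    let ?C = "\<lambda>z. (t - norm (z - x) - norm (z - y)) ^ 0 * radial \<rho> y z / (norm (z - x) * norm (z - y))"
    have i: "set_integrable lborel (ellipsoid t x y) (\<lambda>z. t * ?A z)"
      by (intro set_integrable_mult_right eq(2))
    have EI: "(LINT z:ellipsoid t x y|lborel. ?C z) = ellipsoid_integral 1 0 (radial \<rho> y) t x y"
      "(LINT z:ellipsoid t x y|lborel. ?B z) = ellipsoid_integral 1 1 ?q t x y"
      "(LINT z:ellipsoid t x y|lborel. t * ?A z) = t * ellipsoid_integral 1 0 ?q t x y"
      unfolding set_integral_mult_right by (simp_all add: ellipsoid_integral_def)
    have "(LINT z:ellipsoid t x y|lborel. t * ?A z - ?B z - ?C z) =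
        (LINT z:ellipsoid t x y|lborel. t * ?A z - ?B z) - (LINT z:ellipsoid t x y|lborel. ?C z)"
      by (intro set_integral_diff(2) set_integral_diff(1) i eq(2) er(2))
    also have "(LINT z:ellipsoid t x y|lborel. t * ?A z - ?B z) = (LINT z:ellipsoid t x y|lborel. t * ?A z) - (LINT z:ellipsoid t x y|lborel. ?B z)"
      by (intro set_integral_diff(2) i eq(2))
    finally show ?thesis unfolding EI eq(3) er(3) by simp
  qed
  also have "\<dots> = 1/2 * (integral {d..t} (\<lambda>p. p * profile ?q p) - integral {d..t} (profile (radial \<rho> y)))"
    unfolding integral_moment1[OF pq] by (simp add: algebra_simps)
  finally show "(LINT z:ellipsoid t x y|lborel. radial \<rho> y z / (norm (z - y))\<^sup>2)
      = 1/2 * (integral {d..t} (\<lambda>p. p * profile ?q p) - integral {d..t} (profile (radial \<rho> y)))" .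
qed

end

subsection \<open>Time derivatives and the reconstruction formulas\<close>

lemma integral_eventually_zero:
  fixes h :: "real \<Rightarrow> real"
  assumes "h integrable_on {a..t}" "a \<le> T" "T \<le> t" "\<And>p. p \<ge> T \<Longrightarrow> h p = 0"
  shows "integral {a..t} h = integral {a..T} h"
proof -
  have "integral {T..t} h = integral {T..t} (\<lambda>p. 0)"
    by (rule Henstock_Kurzweil_Integration.integral_cong) (use assms(4) in auto)
  then show ?thesis
    using Henstock_Kurzweil_Integration.integral_combine[OF assms(2,3,1)] by simp
qed

context focal_frame
begin

lemma shell_mean_zero:
  assumes "\<And>w. w \<in> Qbox \<Longrightarrow> g (Z p w) = 0"
  shows "shell_mean g p = 0"
  unfolding shell_mean_def set_lebesgue_integral_def
  by (rule integral_eq_zero_AE, rule AE_I2) (use assms in \<open>auto simp: indicator_def\<close>)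

text \<open>Derivatives are local, so agreement of \<open>F\<close> with the kernel at positive
  times fixes them for \<open>t > d\<close>. \<open>F\<close> abstracts the reconstruction at a
  fixed point, with \<open>a\<close> in the role of \<open>f y\<close>.\<close>

lemma kernel_time_limits:
  assumes d: "d > 0" and \<alpha>: "\<alpha> \<in> C2" "compact (supp \<alpha>)" and \<rho>: "\<rho> \<in> C1" "compact (supp \<rho>)" and \<rho>x: "\<rho> x = 0"
    and F: "\<And>t. t > 0 \<Longrightarrow> F t = K \<epsilon> \<alpha> \<rho> t x y * a"
  shows "t > d \<Longrightarrow> F differentiable (at t)" "t > d \<Longrightarrow> deriv F differentiable (at t)"
    and "(deriv (deriv F) \<longlongrightarrow> a * ((1 - \<epsilon> * \<alpha> y) / (4 * pi * d) + \<epsilon> / (32 * pi\<^sup>2) *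
      (2 * pi * d * segment_mean \<alpha> x y - 4 * pi / d * \<rho> y))) (at_right d)"
    and "\<exists>m. (deriv (deriv F) \<longlongrightarrow> m) at_top \<and>
      ((\<lambda>t. m * t - deriv F t) \<longlongrightarrow> a * (1 - \<epsilon> * \<alpha> y - \<epsilon> * \<rho> y) / (4 * pi)) at_top"
proof -
  note \<alpha>1 = C2_C1(1)[OF \<alpha>(1)]
  define \<kappa> where "\<kappa> = 1 - \<epsilon> * \<alpha> y"
  define c where "c = \<epsilon> / (32 * pi\<^sup>2)"
  define pa where "pa = profile \<alpha>"
  define pr where "pr = profile (radial \<rho> y)"
  define pq where "pq = profile (\<lambda>z. radial \<rho> y z / norm (z - y))"
  define da where "da p = integral Qbox (\<lambda>w. grad \<alpha> (Z p w) \<bullet> dZ p w)" for p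
  note KP = K_profile[OF d _ \<alpha>1 \<alpha>(2) \<rho>, folded pa_def pr_def pq_def]
  have ipa: "integrable lborel pa" and ipr: "integrable lborel pr" and ipq: "integrable lborel pq"
    using KP(1-3)[OF order_refl] by auto
  \<comment> \<open>First and second time derivatives up to the factor \<open>a\<close>. The
    \<alpha> moment has order 0, so its profile appears after one differentiation and the derivative
    \<open>da\<close> of the profile after two.\<close>
  define G1 where "G1 t = (t - d) * \<kappa> / (4 * pi * d) + c * (pa t + integral {d..t} pr + integral {d..t} (\<lambda>p. (t - p) * pq p))" for t
  define G2 where "G2 t = \<kappa> / (4 * pi * d) + c * (da t + pr t + integral {d..t} pq)" for t
  have cpa: "isCont pa t" if "t > d" for t
    unfolding pa_def
  proof (rule isCont_profile[OF _ that])
    show "continuous_on ({d<..} \<times> Qbox) (\<lambda>(p, w). \<alpha> (Z p w))"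
      using continuous_on_compose2[OF C1_continuous[OF \<alpha>1, of UNIV] continuous_on_Z] by (simp add: case_prod_unfold)
  qed
  have cpr: "isCont pr t" and cpq: "isCont pq t" if "t > d" for t
    unfolding pr_def pq_def by (intro isCont_profile continuous_on_radial_Z \<rho>(1) that)+
  have dF: "(F has_real_derivative G1 t * a) (at t)" if t: "t > d" for t
  proof -
    have "((\<lambda>t. (t - d)\<^sup>2 / (8 * pi * d) * \<kappa>) has_real_derivative (t - d) * \<kappa> / (4 * pi * d)) (at t)"
      using d by (auto intro!: derivative_eq_intros simp: field_simps)
    from DERIV_add[OF this DERIV_cmult[OF DERIV_add[OF DERIV_add[OF moment_derivatives(1)[OF ipa cpa[OF t] t]
      moment_derivatives(2)[OF ipr cpr[OF t] t]] DERIV_cmult[OF moment_derivatives(3)[OF ipq cpq[OF t] t], of "1/2"]], of c]]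
    have "((\<lambda>t. (t - d)\<^sup>2 / (8 * pi * d) * \<kappa> + c * (integral {d..t} pa + integral {d..t} (\<lambda>p. (t - p) * pr p)
       + 1/2 * integral {d..t} (\<lambda>p. (t - p)\<^sup>2 * pq p))) has_real_derivative G1 t) (at t)"
      by (simp add: G1_def)
    from DERIV_cmult_right[OF this, of a]
    show ?thesis
    proof (rule has_field_derivative_transform_within_open[of _ _ _ "{d<..}"])
      fix s assume "s \<in> {d<..}"
      then have s: "s \<ge> d" "s > 0" using d by auto
      show "((s - d)\<^sup>2 / (8 * pi * d) * \<kappa> + c * (integral {d..s} pa + integral {d..s} (\<lambda>p. (s - p) * pr p)
       + 1/2 * integral {d..s} (\<lambda>p. (s - p)\<^sup>2 * pq p))) * a = F s"
        unfolding F[OF s(2)] KP(4)[OF s(1)] \<kappa>_def c_def ..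
    qed (use t in auto)
  qed
  have dF': "deriv F t = G1 t * a" if "t > d" for t by (rule DERIV_imp_deriv[OF dF[OF that]])
  have ddF: "(deriv F has_real_derivative G2 t * a) (at t)" if t: "t > d" for t
  proof -
    have dpa: "(pa has_real_derivative da t) (at t)"
    proof (rule has_field_derivative_transform_within_open[of "shell_mean \<alpha>" _ _ "{d<..}"])
      show "(shell_mean \<alpha> has_real_derivative da t) (at t)" unfolding da_def by (rule shell_mean_has_derivative[OF \<alpha>1 t])
    qed (use t in \<open>auto simp: pa_def profile_def\<close>)
    have "((\<lambda>t. (t - d) * \<kappa> / (4 * pi * d)) has_real_derivative \<kappa> / (4 * pi * d)) (at t)"
      using d by (auto intro!: derivative_eq_intros simp: field_simps)
    from DERIV_add[OF this DERIV_cmult[OF DERIV_add[OF DERIV_add[OF dpa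
      moment_derivatives(1)[OF ipr cpr[OF t] t]] moment_derivatives(2)[OF ipq cpq[OF t] t]], of c]]
    have "(G1 has_real_derivative G2 t) (at t)" unfolding G1_def[abs_def] G2_def .
    from DERIV_cmult_right[OF this, of a]
    show ?thesis by (rule has_field_derivative_transform_within_open[of _ _ _ "{d<..}"]) (use t dF' in auto)
  qed
  have ddF': "deriv (deriv F) t = G2 t * a" if "t > d" for t by (rule DERIV_imp_deriv[OF ddF[OF that]])
  show "t > d \<Longrightarrow> F differentiable (at t)" using dF real_differentiable_def by blast
  show "t > d \<Longrightarrow> deriv F differentiable (at t)" using ddF real_differentiable_def by blast
  have ev: "\<forall>\<^sub>F t in at_right d. t > d" by (simp add: eventually_at_filter)
  have l1: "(da \<longlongrightarrow> 2 * pi * d * segment_mean \<alpha> x y) (at_right d)"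
    unfolding da_def[abs_def] by (rule shell_mean_derivative_limit[OF d \<alpha>])
  have "(shell_mean (radial \<rho> y) \<longlongrightarrow> - (4 * pi / d) * (\<rho> y - \<rho> x)) (at_right d)"
    by (rule radial_shell_mean_limit[OF d \<rho>])
  then have l2: "(pr \<longlongrightarrow> - (4 * pi / d) * (\<rho> y - \<rho> x)) (at_right d)"
    by (rule Lim_transform_eventually) (auto intro!: eventually_mono[OF ev] simp: pr_def profile_def)
  have l3: "((\<lambda>t. integral {d..t} pq) \<longlongrightarrow> 0) (at_right d)"
  proof -
    have "pq integrable_on {d..d+1}" using power_mult_integrable_on[OF ipq, of 0] by simp
    from indefinite_integral_continuous_1[OF this]
    have "((\<lambda>t. integral {d..t} pq) \<longlongrightarrow> integral {d..d} pq) (at d within {d..d+1})"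
      unfolding continuous_on_def by (rule bspec) simp
    moreover have "at d within {d..d+1} = at_right d" by (rule at_within_Icc_at_right) simp
    ultimately show ?thesis by simp
  qed
  have "(G2 \<longlongrightarrow> \<kappa> / (4 * pi * d) + c * (2 * pi * d * segment_mean \<alpha> x y + - (4 * pi / d) * (\<rho> y - \<rho> x) + 0)) (at_right d)"
    unfolding G2_def[abs_def] by (intro tendsto_intros l1 l2 l3)
  from tendsto_mult_left[OF this, of a]
  have "((\<lambda>t. a * G2 t) \<longlongrightarrow> a * (\<kappa> / (4 * pi * d) + c * (2 * pi * d * segment_mean \<alpha> x y - 4 * pi / d * \<rho> y))) (at_right d)"
    by (simp add: \<rho>x)
  then show "(deriv (deriv F) \<longlongrightarrow> a * ((1 - \<epsilon> * \<alpha> y) / (4 * pi * d) + \<epsilon> / (32 * pi\<^sup>2) *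
      (2 * pi * d * segment_mean \<alpha> x y - 4 * pi / d * \<rho> y))) (at_right d)"
    unfolding \<kappa>_def c_def
    by (rule Lim_transform_eventually) (auto intro!: eventually_mono[OF ev] simp: ddF')
  have "bounded (supp \<alpha> \<union> supp \<rho>)" using \<alpha>(2) \<rho>(2) by (simp add: compact_imp_bounded)
  from bounded_imp_subset_cball[OF this, of x] obtain R where R: "supp \<alpha> \<union> supp \<rho> \<subseteq> cball x R" by blast
  \<comment> \<open>On a shell with \<open>p \<ge> T\<close> points have distance at least
    \<open>(p - d) / 2 > R\<close> from \<open>x\<close>, so it misses both supports. Conversely the
    ellipsoid of parameter \<open>T\<close> contains the support of \<rho>, since path lengths there
    are at most \<open>2 * R + d\<close>.\<close>
  define T where "T = 2 * \<bar>R\<bar> + d + 1"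
  have T: "T > d" "T \<ge> d" by (auto simp: T_def)
  have far: "Z p w \<notin> supp \<alpha>" "Z p w \<notin> supp \<rho>" if p: "p \<ge> T" and w: "w \<in> Qbox" for p w
  proof -
    have "\<bar>fst w\<bar> \<le> 1" using w by (cases w) (auto simp: Qbox_iff)
    then have "d * (-1) \<le> d * fst w" using d by (intro mult_left_mono) auto
    moreover have "norm (Z p w - x) = (p + d * fst w) / 2" using norm_Z(1)[OF _ w, of p] p T by simp
    ultimately have "norm (Z p w - x) > R" using p unfolding T_def by simp
    then have "Z p w \<notin> cball x R" by (simp add: dist_norm norm_minus_commute)
    then show "Z p w \<notin> supp \<alpha>" "Z p w \<notin> supp \<rho>" using R by auto
  qed
  have z: "pa p = 0" "pr p = 0" "pq p = 0" "da p = 0" if "p \<ge> T" for p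
  proof -
    show "pa p = 0" unfolding pa_def profile_def using far(1)[OF that] by (simp add: shell_mean_zero supp_zero)
    show "pr p = 0" unfolding pr_def profile_def using far(2)[OF that] by (simp add: shell_mean_zero radial_eq_0)
    show "pq p = 0" unfolding pq_def profile_def using far(2)[OF that] by (simp add: shell_mean_zero radial_eq_0)
    have "da p = integral Qbox (\<lambda>w. 0)"
      unfolding da_def using far(1)[OF that] by (intro Henstock_Kurzweil_Integration.integral_cong) (simp add: grad_eq_0)
    then show "da p = 0" by simp
  qed
  define I2 where "I2 = integral {d..T} pq"
  define B0 where "B0 = integral {d..T} pr"
  define J where "J = integral {d..T} (\<lambda>p. p * pq p)"
  have const: "integral {d..t} pq = I2" "integral {d..t} pr = B0" "integral {d..t} (\<lambda>p. p * pq p) = J" if "t \<ge> T" for t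
    unfolding I2_def B0_def J_def
    using power_mult_integrable_on[OF ipq, of 0 d t] power_mult_integrable_on[OF ipr, of 0 d t] power_mult_integrable_on[OF ipq, of 1 d t]
    by (auto intro!: integral_eventually_zero T that simp: z)
  have "(LINT z:ellipsoid T x y|lborel. radial \<rho> y z / (norm (z - y))\<^sup>2) = (LINT z|lborel. radial \<rho> y z / (norm (z - y))\<^sup>2)"
    unfolding set_lebesgue_integral_def
  proof (rule Bochner_Integration.integral_cong)
    fix z
    show "indicator (ellipsoid T x y) z *\<^sub>R (radial \<rho> y z / (norm (z - y))\<^sup>2) = radial \<rho> y z / (norm (z - y))\<^sup>2"
    proof (cases "z \<in> supp \<rho>")
      case True
      then have "norm (z - x) \<le> R" using R by (auto simp: dist_norm norm_minus_commute)
      moreover have "norm (z - y) \<le> norm (z - x) + norm (x - y)" using norm_triangle_ineq[of "z - x" "x - y"] by simp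
      moreover have "norm (x - y) = d" using d e1_norm foci by (metis abs_of_pos norm_minus_commute norm_scaleR mult.right_neutral)
      ultimately have "z \<in> ellipsoid T x y" unfolding ellipsoid_def T_def by simp
      then show ?thesis by simp
    qed (simp add: radial_eq_0)
  qed simp
  also have "\<dots> = - 4 * pi * \<rho> y" by (rule integral_radial_derivative[OF \<rho>])
  \<comment> \<open>The moment identity reads
    \<open>(J - B0) / 2 = - 4 * pi * \<rho> y\<close>.\<close>
  finally have BJ: "B0 = J + 8 * pi * \<rho> y" using KP(5)[OF T(2)] by (simp add: B0_def J_def)
  define m where "m = a * (\<kappa> / (4 * pi * d) + c * I2)"
  have "deriv (deriv F) t = m" if "t > T" for t
    using ddF'[of t] that T z[of t] const[of t] by (simp add: G2_def m_def)
  then have "(deriv (deriv F) \<longlongrightarrow> m) at_top"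
    by (intro tendsto_eventually) (auto intro: eventually_mono[OF eventually_gt_at_top[of T]])
  moreover have "m * t - deriv F t = a * (1 - \<epsilon> * \<alpha> y - \<epsilon> * \<rho> y) / (4 * pi)" if "t > T" for t
  proof -
    \<comment> \<open>The slope \<open>I2\<close> cancels against \<open>m * t\<close>, so that the
      \<rho> terms survive only through the difference \<open>B0 - J\<close>.\<close>
    have F't: "deriv F t = ((t - d) * \<kappa> / (4 * pi * d) + c * (B0 + (t * I2 - J))) * a"
      using dF'[of t] that T z[of t] const[of t] by (simp add: G1_def integral_moment1[OF ipq])
    have "m * t - deriv F t = a * (\<kappa> / (4 * pi * d) + c * I2) * t -
        ((t - d) * \<kappa> / (4 * pi * d) + c * (J + 8 * pi * \<rho> y + (t * I2 - J))) * a"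
      unfolding F't m_def BJ ..
    also have "\<dots> = a * (\<kappa> / (4 * pi) - c * (8 * pi * \<rho> y))"
      using d by (simp add: field_simps)
    also have "c * (8 * pi * \<rho> y) = \<epsilon> * \<rho> y / (4 * pi)" by (simp add: c_def power2_eq_square)
    also have "a * (\<kappa> / (4 * pi) - \<epsilon> * \<rho> y / (4 * pi)) = a * (1 - \<epsilon> * \<alpha> y - \<epsilon> * \<rho> y) / (4 * pi)"
      by (simp add: \<kappa>_def field_simps)
    finally show ?thesis .
  qed
  then have "((\<lambda>t. m * t - deriv F t) \<longlongrightarrow> a * (1 - \<epsilon> * \<alpha> y - \<epsilon> * \<rho> y) / (4 * pi)) at_top"
    by (intro tendsto_eventually) (auto intro: eventually_mono[OF eventually_gt_at_top[of T]])
  ultimately show "\<exists>m. (deriv (deriv F) \<longlongrightarrow> m) at_top \<and>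
      ((\<lambda>t. m * t - deriv F t) \<longlongrightarrow> a * (1 - \<epsilon> * \<alpha> y - \<epsilon> * \<rho> y) / (4 * pi)) at_top" by blast
qed

end

text \<open>Up to the arrival time the ellipsoid is contained in the null set where the path length
  equals \<open>t\<close>. Equality is included because the measurements integrate over an open
  ball, so restricting to that ball loses nothing.\<close>

lemma K_outside_ball:
  assumes xy: "x \<noteq> y" and t: "t \<le> norm (y - x)"
  shows "K \<epsilon> \<alpha> \<rho> t x y = 0"
proof -
  obtain e1 e2 e3 where "focal_frame x y e1 e2 e3 (norm (y - x))" using focal_frame_exists[OF xy] .
  then interpret focal_frame x y e1 e2 e3 "norm (y - x)" .
  have "ellipsoid_integral k j g t x y = 0" for k j g
    unfolding ellipsoid_integral_def set_lebesgue_integral_def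
  proof (rule integral_eq_zero_AE)
    show "AE z in lborel. indicator (ellipsoid t x y) z *\<^sub>R
        ((t - norm (z - x) - norm (z - y)) ^ j * g z / (norm (z - x) * norm (z - y) ^ k)) = 0"
      using AE_path_length_neq[of t]
    proof eventually_elim
      case (elim z)
      then have "z \<notin> ellipsoid t x y" using triangle[of z] t by (simp add: ellipsoid_def)
      then show ?case by simp
    qed
  qed
  then show ?thesis using t unfolding K_ellipsoid_integrals[OF xy] by simp
qed

lemma recon_eq:
  assumes t: "t > 0"
    and \<alpha>: "\<alpha> \<in> C1" "compact (supp \<alpha>)" and \<rho>: "\<rho> \<in> C1" "compact (supp \<rho>)"
    and f: "f \<in> Cc" and x: "x \<notin> supp f"
  shows "\<exists>!g. g \<in> Cc \<and> (\<forall>r\<ge>0. \<forall>\<theta>\<in>sphere 0 1. radon3 g r \<theta> = M \<epsilon> \<alpha> \<rho> f t x r \<theta>)"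
    and "recon \<epsilon> \<alpha> \<rho> f x y t = K \<epsilon> \<alpha> \<rho> t x y * f y"
proof -
  let ?g = "\<lambda>y. K \<epsilon> \<alpha> \<rho> t x y * f y"
  have g: "?g \<in> Cc" by (rule K_times_source_Cc[OF less_imp_le[OF t] \<alpha> \<rho> f x])
  have m: "radon3 ?g r \<theta> = M \<epsilon> \<alpha> \<rho> f t x r \<theta>" for r \<theta>
    unfolding radon3_def M_def set_lebesgue_integral_def
  proof (rule Bochner_Integration.integral_cong)
    fix y
    show "?g y = indicator (ball x t) y *\<^sub>R ?g y"
    proof (cases "y \<in> ball x t")
      case False
      then have "t \<le> norm (y - x)" by (simp add: dist_norm norm_minus_commute)
      then have "K \<epsilon> \<alpha> \<rho> t x y = 0" using t by (intro K_outside_ball) auto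
      then show ?thesis by simp
    qed simp
  qed simp
  show "\<exists>!g. g \<in> Cc \<and> (\<forall>r\<ge>0. \<forall>\<theta>\<in>sphere 0 1. radon3 g r \<theta> = M \<epsilon> \<alpha> \<rho> f t x r \<theta>)"
    by (rule radon3_inv_eqI(1)[OF g m])
  have "radon3_inv (M \<epsilon> \<alpha> \<rho> f t x) = ?g" by (rule radon3_inv_eqI(2)[OF g m])
  then show "recon \<epsilon> \<alpha> \<rho> f x y t = K \<epsilon> \<alpha> \<rho> t x y * f y" unfolding recon_def by simp
qed

section \<open>Nonvanishing of the denominator\<close>

lemma abs_le_SUP:
  fixes h :: "real^3 \<Rightarrow> real"
  assumes "continuous_on UNIV h" "compact (supp h)"
  shows "\<bar>h z\<bar> \<le> (SUP z. \<bar>h z\<bar>)" "0 \<le> (SUP z. \<bar>h z\<bar>)"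
proof -
  obtain B where "\<And>z. \<bar>h z\<bar> \<le> B"
    using bounded_compact_support[OF assms supp_zero[of _ h]] by (metis real_norm_def)
  then have bdd: "bdd_above (range (\<lambda>z. \<bar>h z\<bar>))" by (intro bdd_aboveI2)
  show le: "\<bar>h z\<bar> \<le> (SUP z. \<bar>h z\<bar>)" for z by (rule cSUP_upper[OF UNIV_I bdd])
  show "0 \<le> (SUP z. \<bar>h z\<bar>)" by (rule order_trans[OF abs_ge_zero le])
qed

lemma C2_norm_bounds:
  assumes \<alpha>: "\<alpha> \<in> C2" "compact (supp \<alpha>)"
  shows "\<bar>\<alpha> z\<bar> \<le> C2_norm \<alpha>" "\<bar>laplacian \<alpha> z\<bar> \<le> C2_norm \<alpha>"
proof -
  let ?S = "\<lambda>h. SUP z. \<bar>h z\<bar>"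
  have c1: "continuous_on UNIV (partial i \<alpha>)" for i using \<alpha>(1) by (intro C1_continuous C2_C1)
  have c2: "continuous_on UNIV (partial i (partial j \<alpha>))" for i j using \<alpha>(1) by (auto simp: C2_def C1_def)
  note s0 = abs_le_SUP[OF C1_continuous[OF C2_C1(1)[OF \<alpha>(1)]] \<alpha>(2)]
  note s1 = abs_le_SUP[OF c1 compact_supp_partial[OF \<alpha>(2)]]
  note s2 = abs_le_SUP[OF c2 compact_supp_partial[OF compact_supp_partial[OF \<alpha>(2)]]]
  have n1: "0 \<le> (\<Sum>i\<in>UNIV. ?S (partial i \<alpha>))" by (intro sum_nonneg s1)
  have n2: "0 \<le> (\<Sum>i\<in>UNIV. \<Sum>j\<in>UNIV. ?S (partial i (partial j \<alpha>)))" by (intro sum_nonneg s2)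
  show "\<bar>\<alpha> z\<bar> \<le> C2_norm \<alpha>" unfolding C2_norm_def using s0(1)[of z] n1 n2 by linarith
  have "\<bar>laplacian \<alpha> z\<bar> \<le> (\<Sum>i\<in>UNIV. \<bar>partial i (partial i \<alpha>) z\<bar>)"
    unfolding laplacian_def by (rule sum_abs)
  also have "\<dots> \<le> (\<Sum>i\<in>UNIV. \<Sum>j\<in>UNIV. ?S (partial i (partial j \<alpha>)))"
  proof (rule sum_mono)
    fix i :: 3
    have "\<bar>partial i (partial i \<alpha>) z\<bar> \<le> ?S (partial i (partial i \<alpha>))" by (rule s2(1))
    also have "\<dots> \<le> (\<Sum>j\<in>UNIV. ?S (partial i (partial j \<alpha>)))"
      by (rule member_le_sum[of i UNIV "\<lambda>j. ?S (partial i (partial j \<alpha>))"]) (auto intro: s2)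
    finally show "\<bar>partial i (partial i \<alpha>) z\<bar> \<le> (\<Sum>j\<in>UNIV. ?S (partial i (partial j \<alpha>)))" .
  qed
  finally show "\<bar>laplacian \<alpha> z\<bar> \<le> C2_norm \<alpha>" unfolding C2_norm_def using s0(2) n1 by linarith
qed

text \<open>Both \<open>x\<close> and the support lie in the ball of radius \<open>R\<close>, so the
  integrand vanishes for \<open>s > 2 * R / d\<close> with \<open>d = norm (y - x)\<close>. The
  weight is then at most \<open>2 * R / d\<close> on an interval of that length; the two factors
  absorb \<open>d^2\<close>, making the bound uniform in \<open>y\<close>.\<close>

lemma laplacian_segment_bound:
  assumes \<alpha>: "\<alpha> \<in> C2" and xy: "x \<noteq> y" and R: "R \<ge> 0" "supp \<alpha> \<subseteq> cball 0 R" "x \<in> cball 0 R"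
    and N: "\<And>z. \<bar>laplacian \<alpha> z\<bar> \<le> N"
  shows "(norm (y - x))\<^sup>2 * \<bar>segment_mean \<alpha> x y\<bar> \<le> 4 * R\<^sup>2 * N"
proof -
  let ?d = "norm (y - x)"
  have d: "?d > 0" using xy by simp
  let ?h = "\<lambda>s. s * (1 - s) * laplacian \<alpha> (x + s *\<^sub>R (y - x))"
  have N0: "N \<ge> 0" using N[of 0] by linarith
  have c: "continuous_on {0..1} ?h"
    by (intro continuous_intros continuous_on_compose2[OF laplacian_continuous[OF \<alpha>, of UNIV]]) auto
  have i: "set_integrable lborel {0..1} ?h" by (rule borel_integrable_atLeastAtMost'[OF c])
  have ic: "integrable lborel (\<lambda>s::real. indicator {0..2 * R / ?d} s * (2 * R / ?d * N))"
    by (intro integrable_mult_left integrable_real_indicator) (auto simp: emeasure_lborel_Icc_eq)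
  have pt: "\<bar>indicator {0..1} s *\<^sub>R ?h s\<bar> \<le> indicator {0..2 * R / ?d} s * (2 * R / ?d * N)" for s :: real
  proof (cases "s \<in> {0..1} \<and> laplacian \<alpha> (x + s *\<^sub>R (y - x)) \<noteq> 0")
    case True
    then have s: "0 \<le> s" "s \<le> 1" by auto
    have "x + s *\<^sub>R (y - x) \<in> supp \<alpha>"
    proof (rule ccontr)
      assume *: "x + s *\<^sub>R (y - x) \<notin> supp \<alpha>"
      have "x + s *\<^sub>R (y - x) \<notin> supp (partial i \<alpha>)" for i using * supp_partial_subset by blast
      then have "laplacian \<alpha> (x + s *\<^sub>R (y - x)) = 0" by (simp add: laplacian_grad grad_eq_0)
      then show False using True by simp
    qed
    from subsetD[OF R(2) this] have "norm (x + s *\<^sub>R (y - x)) \<le> R" by (simp only: mem_cball_0)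
    moreover have "norm x \<le> R" using R(3) by (simp add: dist_norm)
    moreover have "norm (s *\<^sub>R (y - x)) \<le> norm (x + s *\<^sub>R (y - x)) + norm x"
      using norm_triangle_ineq4[of "x + s *\<^sub>R (y - x)" x] by simp
    ultimately have "s * ?d \<le> 2 * R" using s by simp
    then have sR: "s \<le> 2 * R / ?d" using d by (simp add: pos_le_divide_eq)
    have "\<bar>?h s\<bar> = s * (1 - s) * \<bar>laplacian \<alpha> (x + s *\<^sub>R (y - x))\<bar>" using s by (simp add: abs_mult)
    also have "\<dots> \<le> (2 * R / ?d * 1) * N" using s sR N by (intro mult_mono) auto
    finally show ?thesis using s sR by simp
  next
    case False
    then have "indicator {0..1} s *\<^sub>R ?h s = 0" by (auto simp: indicator_def)
    moreover have "0 \<le> indicator {0..2 * R / ?d} s * (2 * R / ?d * N)" using R(1) N0 d by (intro mult_nonneg_nonneg) auto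
    ultimately show ?thesis by (simp only: abs_zero)
  qed
  have "segment_mean \<alpha> x y = (LINT s:{0..1}|lborel. ?h s)"
    unfolding segment_mean_def by (rule set_borel_integral_eq_integral(2)[OF i, symmetric])
  then have "\<bar>segment_mean \<alpha> x y\<bar> \<le> (LINT s|lborel. \<bar>indicator {0..1} s *\<^sub>R ?h s\<bar>)"
    unfolding set_lebesgue_integral_def by (simp only: integral_abs_bound)
  also have "\<dots> \<le> (LINT s|lborel. indicator {0..2 * R / ?d} s * (2 * R / ?d * N))"
    using i[unfolded set_integrable_def] by (intro integral_mono ic pt integrable_abs)
  also have "\<dots> = (2 * R / ?d)\<^sup>2 * N" using R(1) d by (simp add: power2_eq_square)
  finally have "?d\<^sup>2 * \<bar>segment_mean \<alpha> x y\<bar> \<le> ?d\<^sup>2 * ((2 * R / ?d)\<^sup>2 * N)" by (intro mult_left_mono) auto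
  also have "\<dots> = 4 * R\<^sup>2 * N" using d by (simp add: power_divide power_mult_distrib)
  finally show ?thesis .
qed

text \<open>The complement of a ball in three dimensions is connected. If it met \<open>D\<close>
  while avoiding the frontier, it would lie entirely in \<open>D\<close>, contradicting
  boundedness.\<close>

lemma bounded_open_subset_cball:
  fixes D :: "(real^3) set"
  assumes "bounded D" "frontier D \<subseteq> cball 0 R"
  shows "D \<subseteq> cball 0 R"
proof (rule ccontr)
  assume "\<not> D \<subseteq> cball 0 R"
  then have ne: "(- cball 0 R) \<inter> D \<noteq> {}" by blast
  have con: "connected (- cball (0 :: real^3) R)"
    by (rule connected_complement_bounded_convex) auto
  have "(- cball 0 R) \<subseteq> D"
  proof (rule ccontr)
    assume "\<not> (- cball 0 R) \<subseteq> D"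
    then have "(- cball 0 R) - D \<noteq> {}" by blast
    from connected_Int_frontier[OF con ne this] show False using assms(2) by blast
  qed
  then have "bounded (- cball (0 :: real^3) R)" using assms(1) bounded_subset by blast
  then show False using cobounded_imp_unbounded[of "- cball (0 :: real^3) R"] by simp
qed

theorem proposition5p2:
  fixes \<Sigma> :: "(real^3) set" and \<epsilon> :: real
  assumes "\<epsilon> > 0"
  shows "\<exists>\<delta>>0. \<forall>D f \<alpha> \<rho>.
    open D \<and> bounded D \<and> \<Sigma> = frontier D \<and>
    f \<in> Cc \<and> (\<forall>y. f y \<ge> 0) \<and> supp f \<subseteq> D \<and>
    \<alpha> \<in> C2 \<and> compact (supp \<alpha>) \<and> \<rho> \<in> C1 \<and> compact (supp \<rho>) \<and>
    supp \<alpha> \<union> supp \<rho> \<subset> interior (supp f) \<and>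
    C2_norm \<alpha> < \<delta> \<longrightarrow>
    (\<forall>x\<in>\<Sigma>. \<forall>y. y \<noteq> x \<longrightarrow>
       data_exist \<epsilon> \<alpha> \<rho> f x y \<and>
       1 - \<epsilon> * \<alpha> y + 1 / 2 * segment_integral x y
         (\<lambda>z. (1 - norm (z - x) / norm (y - x)) * norm (z - x) * (\<epsilon> * laplacian \<alpha> z)) \<noteq> 0 \<and>
       f y = (8 * pi * norm (y - x) * N0 \<epsilon> \<alpha> \<rho> f x y - 4 * pi * Ninf \<epsilon> \<alpha> \<rho> f x y) *
         inverse (1 - \<epsilon> * \<alpha> y + 1 / 2 * segment_integral x y
           (\<lambda>z. (1 - norm (z - x) / norm (y - x)) * norm (z - x) * (\<epsilon> * laplacian \<alpha> z)))) \<and>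
    (\<forall>x\<in>\<Sigma>. \<forall>y. f y \<noteq> 0 \<longrightarrow>
       \<epsilon> * \<rho> y = 1 - \<epsilon> * \<alpha> y - 4 * pi * Ninf \<epsilon> \<alpha> \<rho> f x y / f y)"
proof -
  \<comment> \<open>The radius must be fixed before \<open>D\<close> is known, hence from \<Sigma>
    alone; boundedness of \<Sigma> becomes available only later, so it guards the inclusion.\<close>
  obtain R where R: "R \<ge> 0" "bounded \<Sigma> \<Longrightarrow> \<Sigma> \<subseteq> cball 0 R"
  proof (cases "bounded \<Sigma>")
    case True
    then obtain R' where "\<Sigma> \<subseteq> cball 0 R'" using bounded_imp_subset_cball by metis
    also have "cball 0 R' \<subseteq> cball (0 :: real^3) \<bar>R'\<bar>" by (rule subset_cball) simp
    finally show ?thesis using that[of "\<bar>R'\<bar>"] by simp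
  next
    case False
    then show ?thesis using that[of 0] by simp
  qed
  \<comment> \<open>For \<open>C2_norm \<alpha> = C\<close> the term
    \<open>\<epsilon> * \<alpha> y\<close> contributes at most \<open>\<epsilon> * C\<close> and the
    line integral at most \<open>1/2 * \<epsilon> * 4 * R^2 * C\<close>; this \<delta> keeps their
    sum below 1.\<close>
  define \<delta> where "\<delta> = 1 / (\<epsilon> * (1 + 2 * R\<^sup>2))"
  have R2: "1 + 2 * R\<^sup>2 > 0" by (simp add: add_pos_nonneg)
  have \<delta>: "\<delta> > 0" using assms R2 by (simp add: \<delta>_def)
  show ?thesis
  proof (intro exI[of _ \<delta>] conjI[OF \<delta>] allI impI, elim conjE)
    fix D f \<alpha> \<rho>
    assume D: "open D" "bounded D" "\<Sigma> = frontier D" and f: "f \<in> Cc" "supp f \<subseteq> D"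
      and \<alpha>: "\<alpha> \<in> C2" "compact (supp \<alpha>)" and \<rho>: "\<rho> \<in> C1" "compact (supp \<rho>)"
      and sub: "supp \<alpha> \<union> supp \<rho> \<subset> interior (supp f)" and small: "C2_norm \<alpha> < \<delta>"
    note \<alpha>1 = C2_C1(1)[OF \<alpha>(1)]
    have "bounded \<Sigma>" unfolding D(3) using bounded_closure[OF D(2)]
      by (rule bounded_subset) (simp add: frontier_def Diff_subset)
    then have \<Sigma>R: "\<Sigma> \<subseteq> cball 0 R" by (rule R(2))
    have DR: "D \<subseteq> cball 0 R" using bounded_open_subset_cball[OF D(2)] \<Sigma>R D(3) by blast
    have sf: "supp \<alpha> \<subseteq> supp f" "supp \<rho> \<subseteq> supp f" using sub interior_subset[of "supp f"] by auto
    define den where "den x y = 1 - \<epsilon> * \<alpha> y + 1 / 2 * segment_integral x y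
         (\<lambda>z. (1 - norm (z - x) / norm (y - x)) * norm (z - x) * (\<epsilon> * laplacian \<alpha> z))" for x y
    have key: "data_exist \<epsilon> \<alpha> \<rho> f x y \<and> den x y \<noteq> 0 \<and>
        8 * pi * norm (y - x) * N0 \<epsilon> \<alpha> \<rho> f x y - 4 * pi * Ninf \<epsilon> \<alpha> \<rho> f x y = f y * den x y \<and>
        4 * pi * Ninf \<epsilon> \<alpha> \<rho> f x y = f y * (1 - \<epsilon> * \<alpha> y - \<epsilon> * \<rho> y)"
      if x: "x \<in> \<Sigma>" and yx: "y \<noteq> x" for x y
    proof -
      have xD: "x \<notin> D" using x D(1,3) by (auto simp: frontier_def interior_open)
      then have xf: "x \<notin> supp f" using f(2) by auto
      \<comment> \<open>Removes the lower end of the telescoping \<rho> integral in the limit at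
        first arrival.\<close>
      then have \<rho>x: "\<rho> x = 0" using sf by (intro supp_zero) auto
      let ?d = "norm (y - x)"
      have d: "?d > 0" using yx by simp
      obtain e1 e2 e3 where ff: "focal_frame x y e1 e2 e3 ?d" using focal_frame_exists[of x y] yx by metis
      let ?F = "recon \<epsilon> \<alpha> \<rho> f x y"
      have F: "?F t = K \<epsilon> \<alpha> \<rho> t x y * f y" if "t > 0" for t
        by (rule recon_eq(2)[OF that \<alpha>1 \<alpha>(2) \<rho> f(1) xf])
      note lim = focal_frame.kernel_time_limits[OF ff d \<alpha> \<rho> \<rho>x F]
      have seg: "den x y = 1 - \<epsilon> * \<alpha> y + 1/2 * (\<epsilon> * ?d\<^sup>2 * segment_mean \<alpha> x y)"
        unfolding den_def using segment_integral_laplacian[OF \<alpha>(1), of x y] yx by simp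
      have N0: "N0 \<epsilon> \<alpha> \<rho> f x y = f y * ((1 - \<epsilon> * \<alpha> y) / (4 * pi * ?d) + \<epsilon> / (32 * pi\<^sup>2) * (2 * pi * ?d * segment_mean \<alpha> x y - 4 * pi / ?d * \<rho> y))"
        unfolding N0_def by (rule tendsto_Lim[OF _ lim(3)]) simp
      obtain m where m: "(deriv (deriv ?F) \<longlongrightarrow> m) at_top"
        "((\<lambda>t. m * t - deriv ?F t) \<longlongrightarrow> f y * (1 - \<epsilon> * \<alpha> y - \<epsilon> * \<rho> y) / (4 * pi)) at_top"
        using lim(4) by blast
      have Minf: "Minf \<epsilon> \<alpha> \<rho> f x y = m" unfolding Minf_def by (rule tendsto_Lim[OF _ m(1)]) simp
      have Ninf: "Ninf \<epsilon> \<alpha> \<rho> f x y = f y * (1 - \<epsilon> * \<alpha> y - \<epsilon> * \<rho> y) / (4 * pi)"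
        unfolding Ninf_def Minf by (rule tendsto_Lim[OF _ m(2)]) simp
      have "data_exist \<epsilon> \<alpha> \<rho> f x y"
        unfolding data_exist_def Minf
        using recon_eq(1)[OF _ \<alpha>1 \<alpha>(2) \<rho> f(1) xf] lim(1,2,3) m by blast
      moreover have "den x y \<noteq> 0"
      proof -
        have N: "\<bar>\<alpha> y\<bar> \<le> C2_norm \<alpha>" "\<And>z. \<bar>laplacian \<alpha> z\<bar> \<le> C2_norm \<alpha>" using C2_norm_bounds[OF \<alpha>] by auto
        have "?d\<^sup>2 * \<bar>segment_mean \<alpha> x y\<bar> \<le> 4 * R\<^sup>2 * C2_norm \<alpha>"
          using yx sf(1) f(2) DR x \<Sigma>R
          by (intro laplacian_segment_bound[OF \<alpha>(1) _ R(1) _ _ N(2)]) auto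
        then have "\<epsilon> * (?d\<^sup>2 * \<bar>segment_mean \<alpha> x y\<bar>) \<le> \<epsilon> * (4 * R\<^sup>2 * C2_norm \<alpha>)" using assms by (intro mult_left_mono) auto
        then have "\<bar>\<epsilon> * ?d\<^sup>2 * segment_mean \<alpha> x y\<bar> \<le> \<epsilon> * (4 * R\<^sup>2 * C2_norm \<alpha>)" using assms by (simp add: abs_mult mult.assoc)
        moreover have "\<bar>\<epsilon> * \<alpha> y\<bar> \<le> \<epsilon> * C2_norm \<alpha>" using N(1) assms by (simp add: abs_mult)
        moreover have "\<epsilon> * C2_norm \<alpha> + 1/2 * (\<epsilon> * (4 * R\<^sup>2 * C2_norm \<alpha>)) = C2_norm \<alpha> * (\<epsilon> * (1 + 2 * R\<^sup>2))"
          by (simp add: algebra_simps)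
        moreover have "C2_norm \<alpha> * (\<epsilon> * (1 + 2 * R\<^sup>2)) < 1"
          using small assms R2 unfolding \<delta>_def by (simp add: pos_less_divide_eq)
        ultimately show ?thesis unfolding seg by linarith
      qed
      \<comment> \<open>\<open>N0\<close> contributes
        \<open>2 (1 - \<epsilon> \<alpha> y) - \<epsilon> \<rho> y\<close> besides the Laplacian
        term, and subtracting \<open>Ninf\<close> removes one
        \<open>1 - \<epsilon> \<alpha> y\<close> together with \<rho>.\<close>
      moreover have "8 * pi * ?d * N0 \<epsilon> \<alpha> \<rho> f x y - 4 * pi * Ninf \<epsilon> \<alpha> \<rho> f x y = f y * den x y"
        unfolding N0 Ninf seg using d by (simp add: field_simps power2_eq_square)
      moreover have "4 * pi * Ninf \<epsilon> \<alpha> \<rho> f x y = f y * (1 - \<epsilon> * \<alpha> y - \<epsilon> * \<rho> y)"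
        unfolding Ninf by simp
      ultimately show ?thesis by blast
    qed
    have "\<epsilon> * \<rho> y = 1 - \<epsilon> * \<alpha> y - 4 * pi * Ninf \<epsilon> \<alpha> \<rho> f x y / f y" if x: "x \<in> \<Sigma>" and fy: "f y \<noteq> 0" for x y
    proof -
      have "y \<in> supp f" using fy supp_zero[of y f] by blast
      then have "y \<noteq> x" using x D(1,3) f(2) by (auto simp: frontier_def interior_open)
      then show ?thesis using key[OF x, of y] fy by simp
    qed
    moreover have "data_exist \<epsilon> \<alpha> \<rho> f x y \<and> den x y \<noteq> 0 \<and>
        f y = (8 * pi * norm (y - x) * N0 \<epsilon> \<alpha> \<rho> f x y - 4 * pi * Ninf \<epsilon> \<alpha> \<rho> f x y) * inverse (den x y)"
      if "x \<in> \<Sigma>" "y \<noteq> x" for x y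
    proof -
      from key[OF that] have "data_exist \<epsilon> \<alpha> \<rho> f x y" "den x y \<noteq> 0"
        and eq: "8 * pi * norm (y - x) * N0 \<epsilon> \<alpha> \<rho> f x y - 4 * pi * Ninf \<epsilon> \<alpha> \<rho> f x y = f y * den x y" by blast+
      then show ?thesis unfolding eq by simp
    qed
    ultimately show "(\<forall>x\<in>\<Sigma>. \<forall>y. y \<noteq> x \<longrightarrow>
       data_exist \<epsilon> \<alpha> \<rho> f x y \<and>
       1 - \<epsilon> * \<alpha> y + 1 / 2 * segment_integral x y
         (\<lambda>z. (1 - norm (z - x) / norm (y - x)) * norm (z - x) * (\<epsilon> * laplacian \<alpha> z)) \<noteq> 0 \<and>
       f y = (8 * pi * norm (y - x) * N0 \<epsilon> \<alpha> \<rho> f x y - 4 * pi * Ninf \<epsilon> \<alpha> \<rho> f x y) *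
         inverse (1 - \<epsilon> * \<alpha> y + 1 / 2 * segment_integral x y
           (\<lambda>z. (1 - norm (z - x) / norm (y - x)) * norm (z - x) * (\<epsilon> * laplacian \<alpha> z)))) \<and>
    (\<forall>x\<in>\<Sigma>. \<forall>y. f y \<noteq> 0 \<longrightarrow>
       \<epsilon> * \<rho> y = 1 - \<epsilon> * \<alpha> y - 4 * pi * Ninf \<epsilon> \<alpha> \<rho> f x y / f y)"
      unfolding den_def by blast
  qed
qed

end
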